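(* Let $A$ be a commutative ring with unit and let $M$ be the additive subgroup of $A$ generated by all elements $x(a^2-1)$ and $3(b+1)(c+1)$, where $x\in A$ and $a,b,c\in A^\times$. Then there is an exact sequence of $\mathcal{G}_A$-modules \[ H_2(\mathrm{E}_2(A),\mathbb{Z})\to H_1(Y_\bullet(A^2))_{\mathrm{E}_2(A)} \to A/M \to H_1(\mathrm{E}_2(A), \mathbb{Z}) \to 0, \] in which the map $A/M\to H_1(\mathrm{E}_2(A),\mathbb{Z})$ is induced by the homomorphism $A\to \mathrm{E}_2(A)$, $x\mapsto E_{12}(x)=\begin{pmatrix}1 & x\\ 0 & 1\end{pmatrix}$.
   Context: $\mathrm{E}_2(A)$ is the subgroup of $\mathrm{GL}_2(A)$ generated by the elementary matrices $E_{12}(a)=\begin{pmatrix}1 & a\\ 0 & 1\end{pmatrix}$, $E_{21}(a)=\begin{pmatrix}1 & 0\\ a & 1\end{pmatrix}$, $a\in A$. $\mathrm{GE}_2(A)$ is the subgroup of $\mathrm{GL}_2(A)$ generated by the elementary matrices and the invertible diagonal matrices; $\mathrm{E}_2(A)$ is normal in it. A (column) vector $u\in A^2$ is $\mathrm{GE}_2$-unimodular if there is $v\in A^2$ such that the matrix $(u,v)$ with columns $u,v$ lies in $\mathrm{GE}_2(A)$. $\langle v\rangle$ denotes the line (submodule) $Av$. For $n\ge 0$, $Y_n(A^2)$ is the free abelian group on the $(n+1)$-tuples $(\langle v_0\rangle,\dots,\langle v_n\rangle)$ where every $v_i$ is $\mathrm{GE}_2$-unimodular and $(v_i,v_j)\in\mathrm{GL}_2(A)$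 for all $i\ne j$. The differential $\partial_n:Y_n(A^2)\to Y_{n-1}(A^2)$, $n\geq 1$, is the alternating sum of the maps omitting the $i$-th component. $Y_\bullet(A^2)$ is a complex of $\mathrm{GE}_2(A)$-modules (natural left action on vectors), and the subscript $\mathrm{E}_2(A)$ denotes coinvariants. $\mathcal{G}_A:=A^\times/(A^\times)^2$. The class of $a\in A^\times$ acts on $H_n(\mathrm{E}_2(A),\mathbb{Z})$ by conjugation by $\mathrm{diag}(a,1)$, on $H_1(Y_\bullet(A^2))_{\mathrm{E}_2(A)}$ by the action of $\mathrm{diag}(a,1)$, and on $A/M$ by multiplication by $a$. *)

theory Defs
  imports
    "HOL-Algebra.Free_Abelian_Groups"
    "HOL-Algebra.Generated_Groups"
    "HOL-Algebra.Group_Action"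
    "Jordan_Normal_Form.Matrix"
begin

section \<open>The ground ring\<close>

text \<open>
  The class \<open>comm_ring_1\<close> contains the axiom \<open>0 \<noteq> 1\<close>. The following superclass is the class of all
  commutative rings with unit, the zero ring included.
\<close>

class comm_ring_unit = comm_ring + comm_monoid_mult + numeral

subclass (in comm_ring_1) comm_ring_unit ..

definition additive_group :: "'a::comm_ring_unit monoid" where
  "additive_group = \<lparr>carrier = UNIV, monoid.mult = (+), one = 0\<rparr>"

definition unit_group :: "'a::comm_ring_unit monoid" where
  "unit_group = units_of \<lparr>carrier = UNIV, monoid.mult = (*), one = 1\<rparr>"

definition unit_squares :: "'a::comm_ring_unit set" where
  "unit_squares = {a ^ 2 | a. a \<in> carrier unit_group}"

definition square_class_group :: "'a::comm_ring_unit set monoid" where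
  "square_class_group = unit_group Mod unit_squares"

definition square_class :: "'a::comm_ring_unit \<Rightarrow> 'a set" where
  "square_class a = unit_squares #>\<^bsub>unit_group\<^esub> a"

definition subgroup_M :: "'a::comm_ring_unit set" where
  "subgroup_M = generate additive_group
     ({x * (a ^ 2 - 1) | x a. a \<in> carrier unit_group} \<union>
      {3 * (b + 1) * (c + 1) | b c. b \<in> carrier unit_group \<and> c \<in> carrier unit_group})"

definition A_mod_M :: "'a::comm_ring_unit set monoid" where
  "A_mod_M = additive_group Mod subgroup_M"


section \<open>Modules over a group\<close>

definition is_module :: "('g, 'x) monoid_scheme \<Rightarrow> 'm monoid \<Rightarrow> ('g \<Rightarrow> 'm \<Rightarrow> 'm) \<Rightarrow> bool" where
  "is_module G M \<rho> \<longleftrightarrow>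
     comm_group M \<and> group_action G (carrier M) \<rho> \<and> (\<forall>g\<in>carrier G. \<rho> g \<in> hom M M)"

definition equivariant_hom ::
    "('g, 'x) monoid_scheme \<Rightarrow> 'm monoid \<Rightarrow> ('g \<Rightarrow> 'm \<Rightarrow> 'm) \<Rightarrow> 'n monoid \<Rightarrow> ('g \<Rightarrow> 'n \<Rightarrow> 'n) \<Rightarrow>
     ('m \<Rightarrow> 'n) set" where
  "equivariant_hom G M \<rho> N \<sigma> =
     {f \<in> hom M N. \<forall>g\<in>carrier G. \<forall>m\<in>carrier M. f (\<rho> g m) = \<sigma> g (f m)}"

text \<open>
  \<open>\<rho>\<close> makes \<open>M\<close> a module over the group of square classes, in which the class of a unit \<open>a\<close> acts by
  \<open>act a\<close>. This determines \<open>\<rho>\<close>, and it includes that \<open>act a\<close> depends only on the class of \<open>a\<close>.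
\<close>

definition square_class_module ::
    "'m monoid \<Rightarrow> ('a::comm_ring_unit \<Rightarrow> 'm \<Rightarrow> 'm) \<Rightarrow> ('a set \<Rightarrow> 'm \<Rightarrow> 'm) \<Rightarrow> bool" where
  "square_class_module M act \<rho> \<longleftrightarrow>
     is_module square_class_group M \<rho> \<and>
     (\<forall>a\<in>carrier unit_group. \<forall>m\<in>carrier M. \<rho> (square_class a) m = act a m)"

definition coinvariants :: "'g set \<Rightarrow> 'm monoid \<Rightarrow> ('g \<Rightarrow> 'm \<Rightarrow> 'm) \<Rightarrow> 'm set monoid" where
  "coinvariants K M act =
     M Mod generate M {act g m \<otimes>\<^bsub>M\<^esub> inv\<^bsub>M\<^esub> m | g m. g \<in> K \<and> m \<in> carrier M}"


section \<open>Complexes of free abelian groups and group homology\<close>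

text \<open>
  A complex of free abelian groups is given by the bases \<open>B n\<close> and by the boundary \<open>d\<close> of the basis
  elements.
\<close>

definition cycles :: "(nat \<Rightarrow> 'b set) \<Rightarrow> ('b \<Rightarrow> ('b \<Rightarrow>\<^sub>0 int)) \<Rightarrow> nat \<Rightarrow> ('b \<Rightarrow>\<^sub>0 int) set" where
  "cycles B d n = {c \<in> carrier (free_Abelian_group (B n)). frag_extend d c = 0}"

definition boundaries :: "(nat \<Rightarrow> 'b set) \<Rightarrow> ('b \<Rightarrow> ('b \<Rightarrow>\<^sub>0 int)) \<Rightarrow> nat \<Rightarrow> ('b \<Rightarrow>\<^sub>0 int) set" where
  "boundaries B d n = frag_extend d ` carrier (free_Abelian_group (B (Suc n)))"

definition homology ::
    "(nat \<Rightarrow> 'b set) \<Rightarrow> ('b \<Rightarrow> ('b \<Rightarrow>\<^sub>0 int)) \<Rightarrow> nat \<Rightarrow> ('b \<Rightarrow>\<^sub>0 int) set monoid" where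
  "homology B d n = (free_Abelian_group (B n))\<lparr>carrier := cycles B d n\<rparr> Mod boundaries B d n"

definition tuple_chain_map :: "('b \<Rightarrow> 'c) \<Rightarrow> ('b list \<Rightarrow>\<^sub>0 int) \<Rightarrow> ('c list \<Rightarrow>\<^sub>0 int)" where
  "tuple_chain_map f = frag_extend (\<lambda>xs. frag_of (map f xs))"

text \<open>
  The homology \<open>H\<^sub>n(G, \<int>)\<close> is that of the bar complex of \<open>G\<close> with trivial coefficients
  (inhomogeneous and unnormalised). It is free on the tuples \<open>[g\<^sub>1|\<dots>|g\<^sub>n]\<close>, and the boundary is the alternating sum of
  \<open>[g\<^sub>2|\<dots>|g\<^sub>n]\<close>, \<open>[g\<^sub>1|\<dots>|g\<^sub>i g\<^sub>i\<^sub>+\<^sub>1|\<dots>|g\<^sub>n]\<close> for \<open>0 < i < n\<close>, and \<open>[g\<^sub>1|\<dots>|g\<^sub>n\<^sub>-\<^sub>1]\<close>.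
\<close>

definition bar_basis :: "('g, 'x) monoid_scheme \<Rightarrow> nat \<Rightarrow> 'g list set" where
  "bar_basis G n = {gs. length gs = n \<and> set gs \<subseteq> carrier G}"

definition bar_face :: "('g, 'x) monoid_scheme \<Rightarrow> nat \<Rightarrow> 'g list \<Rightarrow> 'g list" where
  "bar_face G i gs =
     (if i = 0 then tl gs
      else if i = length gs then butlast gs
      else take (i - 1) gs @ [gs ! (i - 1) \<otimes>\<^bsub>G\<^esub> gs ! i] @ drop (i + 1) gs)"

definition bar_boundary :: "('g, 'x) monoid_scheme \<Rightarrow> 'g list \<Rightarrow> ('g list \<Rightarrow>\<^sub>0 int)" where
  "bar_boundary G gs =
     (if gs = [] then 0
      else \<Sum>i\<le>length gs. frag_cmul ((-1) ^ i) (frag_of (bar_face G i gs)))"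

definition group_homology ::
    "nat \<Rightarrow> ('g, 'x) monoid_scheme \<Rightarrow> ('g list \<Rightarrow>\<^sub>0 int) set monoid" where
  "group_homology n G = homology (bar_basis G) (bar_boundary G) n"

text \<open>
  The image of \<open>g\<close> under \<open>G \<rightarrow> H\<^sub>1(G, \<int>)\<close>, the homology class of the \<open>1\<close>-cycle \<open>[g]\<close>.
\<close>

definition H1_class :: "('g, 'x) monoid_scheme \<Rightarrow> 'g \<Rightarrow> ('g list \<Rightarrow>\<^sub>0 int) set" where
  "H1_class G g =
     boundaries (bar_basis G) (bar_boundary G) 1
       #>\<^bsub>free_Abelian_group (bar_basis G 1)\<^esub> frag_of [g]"


section \<open>Elementary groups of rank two\<close>

definition GL2 :: "'a::comm_ring_unit mat monoid" where
  "GL2 = units_of \<lparr>carrier = carrier_mat 2 2, monoid.mult = (*), one = 1\<^sub>m 2\<rparr>"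

definition E12 :: "'a::comm_ring_unit \<Rightarrow> 'a mat" where
  "E12 a = mat_of_rows_list 2 [[1, a], [0, 1]]"

definition E21 :: "'a::comm_ring_unit \<Rightarrow> 'a mat" where
  "E21 a = mat_of_rows_list 2 [[1, 0], [a, 1]]"

definition diag2 :: "'a::comm_ring_unit \<Rightarrow> 'a \<Rightarrow> 'a mat" where
  "diag2 a b = mat_of_rows_list 2 [[a, 0], [0, b]]"

definition E2 :: "'a::comm_ring_unit mat monoid" where
  "E2 = subgroup_generated GL2 (range E12 \<union> range E21)"

definition GE2 :: "'a::comm_ring_unit mat monoid" where
  "GE2 = subgroup_generated GL2
     (range E12 \<union> range E21 \<union> {D \<in> carrier GL2. diagonal_mat D})"

definition conj_by :: "'a::comm_ring_unit mat \<Rightarrow> 'a mat \<Rightarrow> 'a mat" where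
  "conj_by d g = d \<otimes>\<^bsub>GL2\<^esub> g \<otimes>\<^bsub>GL2\<^esub> inv\<^bsub>GL2\<^esub> d"

text \<open>
  Elements of homology groups and of coinvariants are cosets. The map that an automorphism induces
  on a quotient sends a coset to its image, which is why actions on quotients are images below.
\<close>

definition conj_action ::
    "'a::comm_ring_unit \<Rightarrow> ('a mat list \<Rightarrow>\<^sub>0 int) set \<Rightarrow> ('a mat list \<Rightarrow>\<^sub>0 int) set" where
  "conj_action a C = tuple_chain_map (conj_by (diag2 a 1)) ` C"

definition mult_action :: "'a::comm_ring_unit \<Rightarrow> 'a set \<Rightarrow> 'a set" where
  "mult_action a C = (\<lambda>x. a * x) ` C"


section \<open>The complex of unimodular lines\<close>

definition GE2_unimodular :: "'a::comm_ring_unit vec \<Rightarrow> bool" where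
  "GE2_unimodular u \<longleftrightarrow>
     u \<in> carrier_vec 2 \<and> (\<exists>v\<in>carrier_vec 2. mat_of_cols 2 [u, v] \<in> carrier GE2)"

definition line :: "'a::comm_ring_unit vec \<Rightarrow> 'a vec set" where
  "line v = {a \<cdot>\<^sub>v v | a. True}"

definition Y_basis :: "nat \<Rightarrow> 'a::comm_ring_unit vec set list set" where
  "Y_basis n = {map line vs | vs. length vs = n + 1 \<and>
     (\<forall>v\<in>set vs. GE2_unimodular v) \<and>
     (\<forall>i<length vs. \<forall>j<length vs. i \<noteq> j \<longrightarrow> mat_of_cols 2 [vs ! i, vs ! j] \<in> carrier GL2)}"

text \<open>The case distinction makes the differential zero in degree \<open>0\<close>.\<close>

definition Y_boundary :: "'b list \<Rightarrow> ('b list \<Rightarrow>\<^sub>0 int)" where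
  "Y_boundary ls =
     (if length ls \<le> 1 then 0
      else \<Sum>i<length ls. frag_cmul ((-1) ^ i) (frag_of (take i ls @ drop (i + 1) ls)))"

definition H1_Y :: "('a::comm_ring_unit vec set list \<Rightarrow>\<^sub>0 int) set monoid" where
  "H1_Y = homology Y_basis Y_boundary 1"

definition H1_Y_action ::
    "'a::comm_ring_unit mat \<Rightarrow> ('a vec set list \<Rightarrow>\<^sub>0 int) set \<Rightarrow> ('a vec set list \<Rightarrow>\<^sub>0 int) set" where
  "H1_Y_action g C = tuple_chain_map (\<lambda>L. (\<lambda>v. g *\<^sub>v v) ` L) ` C"

definition H1_Y_E2 :: "('a::comm_ring_unit vec set list \<Rightarrow>\<^sub>0 int) set set monoid" where
  "H1_Y_E2 = coinvariants (carrier E2) H1_Y H1_Y_action"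

definition H1_Y_E2_action ::
    "'a::comm_ring_unit \<Rightarrow> ('a vec set list \<Rightarrow>\<^sub>0 int) set set \<Rightarrow> ('a vec set list \<Rightarrow>\<^sub>0 int) set set"
  where
  "H1_Y_E2_action a X = H1_Y_action (diag2 a 1) ` X"

end

theory Submission
  imports Defs "HOL-Library.Product_Plus"
begin

text \<open>
  Write \<open>E = E\<^sub>2(A)\<close>, \<open>\<infinity>\<close> for the line of the first basis vector and \<open>B\<close> for its stabiliser. The group
  \<open>E\<close> acts transitively on lines and on edges, and the triangles are the translates of
  \<open>(\<infinity>, w \<infinity>, E\<^sub>2\<^sub>1(a) \<infinity>)\<close> with \<open>a\<close> a unit. Hence the hyperhomology \<open>X = H\<^sub>1(E, Y)\<close>, which fits into
  \<open>H\<^sub>2(E) \<rightarrow> H\<^sub>1(Y)\<^sub>E \<rightarrow> X \<rightarrow> H\<^sub>1(E) \<rightarrow> 0\<close>, is generated by the classes \<open>\<sigma>(x)\<close> of \<open>E\<^sub>1\<^sub>2(x)\<close>, and the triangles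
  force the class of \<open>diag(a, a\<inverse>)\<close> to be \<open>3 \<sigma>(a - 1)\<close>. Multiplicativity of the latter in \<open>a\<close> gives
  \<open>\<sigma>(3 (b + 1) (c + 1)) = 0\<close>, and conjugation by \<open>diag(a, a\<inverse>)\<close> gives \<open>\<sigma>(x (a\<^sup>2 - 1)) = 0\<close>.
  Conversely, \<open>\<chi>(diag(a, a\<inverse>) E\<^sub>1\<^sub>2(x)) = x + 3 (a - 1)\<close> is a homomorphism from \<open>B\<close> to \<open>A/M\<close>. A choice of
  representatives of \<open>E/B\<close> extends it to a map \<open>X \<rightarrow> A/M\<close> that is inverse to \<open>\<sigma>\<close>, so \<open>X = A/M\<close>.
\<close>

section \<open>Additive subgroups and quotients\<close>

text \<open>The homological part is done for an abstract action, \<open>elementary_action\<close>;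
  matrices enter through its instance and through the bases of Y_1 and Y_2. No spectral sequence is
  used: X is presented by pairs of a bar 1-chain and a Y-chain modulo \<open>S\<close>, and H_2(E)
  -> H_1(Y)_E is the explicit map \<open>alpha\<close>, the failure of chosen paths starting at
  infinity to form a crossed homomorphism. The factor 3 comes from a triangle. Every edge has the
  same class \<open>kap\<close> up to terms at its endpoints. In the boundary of a triangle one
  \<open>kap\<close> survives, with three unipotent contributions and one diagonal one, so kap = 3
  sigma(a) - [diag(a^-1, a)]; the case a = 1 gives kap = sigma(3). The obstacle is that paths,
  representatives of E/B and values on edges are choices that neither E nor diag(u, 1) respects.
  Identities therefore hold only modulo \<open>N\<close> or M, and up to error terms that depend on
  the boundary of a chain and vanish on cycles. For this reason the equivariance of
  \<open>phi\<close> is derived through sigma and not computed from its definition.\<close>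

definition add_subgroup :: "'v::ab_group_add set \<Rightarrow> bool" where
  "add_subgroup S \<longleftrightarrow> 0 \<in> S \<and> (\<forall>x\<in>S. \<forall>y\<in>S. x - y \<in> S)"

lemma add_subgroupI: "0 \<in> S \<Longrightarrow> (\<And>x y. x \<in> S \<Longrightarrow> y \<in> S \<Longrightarrow> x - y \<in> S) \<Longrightarrow> add_subgroup S"
  by (simp add: add_subgroup_def)

lemma add_subgroup_zero: "add_subgroup S \<Longrightarrow> 0 \<in> S"
  by (simp add: add_subgroup_def)

lemma add_subgroup_diff: "add_subgroup S \<Longrightarrow> x \<in> S \<Longrightarrow> y \<in> S \<Longrightarrow> x - y \<in> S"
  by (simp add: add_subgroup_def)

lemma add_subgroup_minus: "add_subgroup S \<Longrightarrow> x \<in> S \<Longrightarrow> - x \<in> S"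
  by (metis add_subgroup_def diff_0)

lemma add_subgroup_add: "add_subgroup S \<Longrightarrow> x \<in> S \<Longrightarrow> y \<in> S \<Longrightarrow> x + y \<in> S"
  by (metis add_subgroup_def add_subgroup_minus diff_minus_eq_add)

lemmas add_subgroup_intros = add_subgroup_zero add_subgroup_diff add_subgroup_minus add_subgroup_add

abbreviation supported :: "('b \<Rightarrow>\<^sub>0 int) \<Rightarrow> 'b set \<Rightarrow> bool" where
  "supported c X \<equiv> Poly_Mapping.keys c \<subseteq> X"

lemma add_subgroup_keys: "add_subgroup {c :: 'b \<Rightarrow>\<^sub>0 int. supported c X}"
  by (rule add_subgroupI) (use keys_diff in fastforce)+

text \<open>The targets needed are \<open>A\<close> and a product of two chain groups, whereas
  \<open>frag_extend\<close> takes values in finitely supported integer functions.\<close>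

definition lin_ext :: "('b \<Rightarrow> 'v::ab_group_add) \<Rightarrow> ('b \<Rightarrow>\<^sub>0 int) \<Rightarrow> 'v" where
  "lin_ext f = (SOME h. Modules.additive h \<and> (\<forall>x. h (frag_of x) = f x))"

lemma lin_ext_exists: "\<exists>h. Modules.additive h \<and> (\<forall>x. h (frag_of x) = (f x :: 'v::ab_group_add))"
proof -
  let ?G = "\<lparr>carrier = UNIV, monoid.mult = (+), one = 0\<rparr> :: 'v monoid"
  interpret G: comm_group ?G
    by (rule comm_groupI) (simp_all add: add.assoc add.commute, metis add.left_inverse add.commute)
  obtain h where h: "h \<in> hom (free_Abelian_group UNIV) ?G" "\<And>x. x \<in> UNIV \<Longrightarrow> h (frag_of x) = f x"
    using G.free_Abelian_group_universal[of f UNIV] by auto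
  then show ?thesis
    by (intro exI[of _ h]) (auto simp: Modules.additive_def hom_def)
qed

lemma lin_ext_additive: "Modules.additive (lin_ext f)"
  and lin_ext_of [simp]: "lin_ext f (frag_of x) = f x"
  using someI_ex[OF lin_ext_exists[of f]] unfolding lin_ext_def by auto

lemmas lin_ext_diff = additive.diff[OF lin_ext_additive]
  and lin_ext_add = additive.add[OF lin_ext_additive]
  and lin_ext_zero [simp] = additive.zero[OF lin_ext_additive]

lemma additive_frag_extend: "Modules.additive (frag_extend f)"
  by (simp add: Modules.additive_def frag_extend_add)

text \<open>The standard method below: a membership that is additive in a chain is checked on the
  basis elements.\<close>

lemma additive_mem_of_basis:
  assumes "Modules.additive F" "add_subgroup S" "supported c X"
    and "\<And>x. x \<in> X \<Longrightarrow> F (frag_of x) \<in> S"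
  shows "F c \<in> S"
  by (rule free_Abelian_group_induct[OF assms(3)])
     (auto simp: additive.zero[OF assms(1)] additive.diff[OF assms(1)] assms(4)
           intro: add_subgroup_intros[OF assms(2)])

lemma additive_eq_of_basis:
  assumes "Modules.additive F" "Modules.additive F'" "supported c X"
    and "\<And>x. x \<in> X \<Longrightarrow> F (frag_of x) = F' (frag_of x)"
  shows "F c = F' c"
  by (rule free_Abelian_group_induct[OF assms(3)])
     (auto simp: additive.zero[OF assms(1)] additive.diff[OF assms(1)]
       additive.zero[OF assms(2)] additive.diff[OF assms(2)] assms(4))

text \<open>The groups of the theorem are monoids of cosets, or of cosets of cosets. Presenting them
  as \<open>Z\<close> modulo \<open>N\<close> inside a type class group lets all computations be
  done on representatives with ordinary addition.\<close>

definition quotient_map :: "('q, 'x) monoid_scheme \<Rightarrow> 'v::ab_group_add set \<Rightarrow> 'v set \<Rightarrow> ('v \<Rightarrow> 'q) \<Rightarrow> bool" where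
  "quotient_map Q Z N q \<longleftrightarrow> comm_group Q \<and> add_subgroup Z \<and> add_subgroup N \<and> N \<subseteq> Z \<and>
     q ` Z = carrier Q \<and> (\<forall>x\<in>Z. \<forall>y\<in>Z. q (x + y) = q x \<otimes>\<^bsub>Q\<^esub> q y) \<and>
     (\<forall>x\<in>Z. q x = \<one>\<^bsub>Q\<^esub> \<longleftrightarrow> x \<in> N)"

lemma quotient_mapD:
  assumes "quotient_map Q Z N q"
  shows "comm_group Q" "add_subgroup Z" "add_subgroup N" "N \<subseteq> Z" "q ` Z = carrier Q"
    "\<And>x y. x \<in> Z \<Longrightarrow> y \<in> Z \<Longrightarrow> q (x + y) = q x \<otimes>\<^bsub>Q\<^esub> q y"
    "\<And>x. x \<in> Z \<Longrightarrow> q x = \<one>\<^bsub>Q\<^esub> \<longleftrightarrow> x \<in> N"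
    "\<And>x. x \<in> Z \<Longrightarrow> q x \<in> carrier Q"
  using assms by (auto simp: quotient_map_def)

lemma quotient_map_eq_iff:
  assumes "quotient_map Q Z N q" "x \<in> Z" "y \<in> Z"
  shows "q x = q y \<longleftrightarrow> x - y \<in> N"
proof -
  note Q = quotient_mapD[OF assms(1)]
  interpret comm_group Q by (rule Q(1))
  have d: "x - y \<in> Z" using Q(2) assms by (auto intro: add_subgroup_diff)
  have "q x = q (x - y) \<otimes>\<^bsub>Q\<^esub> q y"
    using Q(6)[OF d assms(3)] by simp
  then have "q x = q y \<longleftrightarrow> q (x - y) = \<one>\<^bsub>Q\<^esub>"
    using Q(8) d assms(3) by (simp add: l_cancel_one')
  then show ?thesis using Q(7)[OF d] by simp
qed

text \<open>Keeps an iterated quotient, such as the coinvariants of a homology group, presented by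
  the original cycles.\<close>

lemma quotient_map_Mod:
  assumes Q: "quotient_map Q Z N q" and K: "subgroup K Q"
  shows "quotient_map (Q Mod K) Z {z \<in> Z. q z \<in> K} (\<lambda>z. K #>\<^bsub>Q\<^esub> q z)"
proof -
  note Q' = quotient_mapD[OF Q]
  interpret Q: comm_group Q by (rule Q'(1))
  interpret K: normal K Q using K by (rule Q.subgroup_imp_normal)
  have one: "q 0 = \<one>\<^bsub>Q\<^esub>" using Q' by (simp add: add_subgroup_zero)
  have diff: "q (x - y) \<otimes>\<^bsub>Q\<^esub> q y = q x" if "x \<in> Z" "y \<in> Z" for x y
    using Q'(6)[of "x - y" y] that Q'(2) by (simp add: add_subgroup_diff)
  have diff': "q (x - y) = q x \<otimes>\<^bsub>Q\<^esub> inv\<^bsub>Q\<^esub> (q y)" if "x \<in> Z" "y \<in> Z" for x y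
    using diff[OF that] Q'(8) that add_subgroup_diff[OF Q'(2) that] by (metis Q.inv_solve_right)
  have N: "add_subgroup {z \<in> Z. q z \<in> K}"
    using Q'(2) K.one_closed one diff'
    by (intro add_subgroupI) (auto intro: add_subgroup_intros K.m_closed K.m_inv_closed)
  show ?thesis
    unfolding quotient_map_def
  proof (intro conjI ballI)
    show "comm_group (Q Mod K)" by (rule Q.abelian_FactGroup[OF K])
    show "add_subgroup Z" by (rule Q'(2))
    show "add_subgroup {z \<in> Z. q z \<in> K}" by (rule N)
    show "{z \<in> Z. q z \<in> K} \<subseteq> Z" by auto
    show "(\<lambda>z. K #>\<^bsub>Q\<^esub> q z) ` Z = carrier (Q Mod K)"
      by (simp add: carrier_FactGroup image_image flip: Q'(5))
  next
    fix x y assume "x \<in> Z" "y \<in> Z"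
    then show "K #>\<^bsub>Q\<^esub> q (x + y) = (K #>\<^bsub>Q\<^esub> q x) \<otimes>\<^bsub>Q Mod K\<^esub> (K #>\<^bsub>Q\<^esub> q y)"
      using Q'(6,8) by (simp add: K.rcos_sum)
  next
    fix x assume "x \<in> Z"
    then show "(K #>\<^bsub>Q\<^esub> q x = \<one>\<^bsub>Q Mod K\<^esub>) = (x \<in> {z \<in> Z. q z \<in> K})"
      using Q'(8) by (auto simp: Q.coset_join2[OF _ K] intro: Q.coset_join1[OF _ _ K])
  qed
qed

lemma quotient_map_self:
  fixes Z :: "'v::ab_group_add set"
  assumes "add_subgroup Z"
  shows "quotient_map \<lparr>carrier = Z, monoid.mult = (+), one = 0\<rparr> Z {0} (\<lambda>z. z)"
proof -
  have "comm_group \<lparr>carrier = Z, monoid.mult = (+), one = 0\<rparr>"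
    using add_subgroup_intros[OF assms]
    by (intro comm_groupI) (simp_all add: add.assoc add.commute, metis add.left_inverse add.commute)
  then show ?thesis
    using assms by (auto simp: quotient_map_def add_subgroup_def)
qed

lemma subgroup_add_record:
  assumes "add_subgroup Z" "add_subgroup N" "N \<subseteq> Z"
  shows "subgroup N \<lparr>carrier = Z, monoid.mult = (+), one = 0\<rparr>"
proof -
  interpret comm_group "\<lparr>carrier = Z, monoid.mult = (+), one = 0\<rparr>"
    using quotient_map_self[OF assms(1)] by (rule quotient_mapD)
  show ?thesis
  proof (rule subgroupI)
    fix a assume a: "a \<in> N"
    then have "inv\<^bsub>\<lparr>carrier = Z, monoid.mult = (+), one = 0\<rparr>\<^esub> a = - a"
      using assms by (intro inv_equality) (auto intro: add_subgroup_intros)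
    then show "inv\<^bsub>\<lparr>carrier = Z, monoid.mult = (+), one = 0\<rparr>\<^esub> a \<in> N"
      using a assms(2) by (simp add: add_subgroup_minus)
  qed (use assms in \<open>auto intro: add_subgroup_intros\<close>)
qed

definition coset :: "'v::ab_group_add set \<Rightarrow> 'v \<Rightarrow> 'v set" where
  "coset N z = (\<lambda>n. n + z) ` N"

lemma r_coset_eq_coset: "monoid.mult Q = (+) \<Longrightarrow> N #>\<^bsub>Q\<^esub> z = coset N z"
  by (auto simp: r_coset_def coset_def)

lemma quotient_map_record:
  fixes Z :: "'v::ab_group_add set"
  assumes "add_subgroup Z" "add_subgroup N" "N \<subseteq> Z"
  shows "quotient_map (\<lparr>carrier = Z, monoid.mult = (+), one = 0\<rparr> Mod N) Z N (coset N)"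
proof -
  have "{z \<in> Z. z \<in> N} = N" using assms(3) by auto
  then show ?thesis
    using quotient_map_Mod[OF quotient_map_self[OF assms(1)] subgroup_add_record[OF assms]]
    by (simp add: r_coset_eq_coset)
qed

text \<open>Actions on quotients are images of cosets, and the image is a full coset only if
  \<open>f\<close> maps \<open>N\<close> onto itself. This is why surjectivity on boundaries is
  proved for every action below.\<close>

lemma image_coset:
  assumes "Modules.additive f" "f ` N = N"
  shows "f ` coset N z = coset N (f z)"
proof -
  have "f ` coset N z = (\<lambda>n. n + f z) ` (f ` N)"
    by (simp add: coset_def image_image additive.add[OF assms(1)])
  then show ?thesis by (simp add: assms(2) coset_def)
qed

text \<open>Additivity is asked only modulo \<open>N'\<close> because the map that sends
  \<open>x\<close> to the bar generator of \<open>E12 x\<close> is additive only up to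
  boundaries.\<close>

lemma quotient_map_induced:
  assumes Q: "quotient_map Q Z N q" and R: "quotient_map R Z' N' r"
    and f: "\<And>x. x \<in> Z \<Longrightarrow> f x \<in> Z'" "\<And>x y. x \<in> Z \<Longrightarrow> y \<in> Z \<Longrightarrow> f (x + y) - (f x + f y) \<in> N'"
      "\<And>x. x \<in> N \<Longrightarrow> f x \<in> N'"
  obtains F where "F \<in> hom Q R" "\<And>x. x \<in> Z \<Longrightarrow> F (q x) = r (f x)"
proof
  define F where "F C = r (f (SOME x. x \<in> Z \<and> q x = C))" for C
  note Q' = quotient_mapD[OF Q] and R' = quotient_mapD[OF R]
  show eq: "F (q x) = r (f x)" if x: "x \<in> Z" for x
  proof -
    define y where "y = (SOME y. y \<in> Z \<and> q y = q x)"
    have y: "y \<in> Z \<and> q y = q x" unfolding y_def by (rule someI[of _ x]) (use x in auto)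
    then have "y - x \<in> N" using quotient_map_eq_iff[OF Q] x by blast
    moreover have "f (y - x + x) - (f (y - x) + f x) \<in> N'"
      using y x by (blast intro: f(2) add_subgroup_diff[OF Q'(2)])
    then have "f y - (f (y - x) + f x) \<in> N'" by simp
    ultimately have "(f y - (f (y - x) + f x)) + f (y - x) \<in> N'"
      using f(3) \<open>y - x \<in> N\<close> by (blast intro: add_subgroup_add[OF R'(3)])
    then have "f y - f x \<in> N'" by (simp add: algebra_simps)
    then show ?thesis
      using quotient_map_eq_iff[OF R] f(1) y x unfolding F_def y_def by blast
  qed
  show "F \<in> hom Q R"
  proof (rule homI)
    fix C assume "C \<in> carrier Q"
    then obtain x where "x \<in> Z" "C = q x" using Q'(5) by auto
    then show "F C \<in> carrier R" using eq R'(8) f(1) by simp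
  next
    fix C D assume "C \<in> carrier Q" "D \<in> carrier Q"
    then obtain x y where xy: "x \<in> Z" "C = q x" "y \<in> Z" "D = q y"
      unfolding Q'(5)[symmetric] by blast
    have "F (q x \<otimes>\<^bsub>Q\<^esub> q y) = F (q (x + y))" using Q'(6) xy by simp
    also have "\<dots> = r (f (x + y))" using eq xy Q'(2) by (simp add: add_subgroup_add)
    also have "\<dots> = r (f x + f y)"
      using quotient_map_eq_iff[OF R] f(1,2) xy Q'(2) R'(2) by (simp add: add_subgroup_add)
    also have "\<dots> = r (f x) \<otimes>\<^bsub>R\<^esub> r (f y)" using R'(6) f(1) xy by simp
    finally show "F (C \<otimes>\<^bsub>Q\<^esub> D) = F C \<otimes>\<^bsub>R\<^esub> F D" using eq xy by simp
  qed
qed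

lemma image_r_coset_hom:
  assumes "group Q" "K \<subseteq> carrier Q" "x \<in> carrier Q" "f \<in> hom Q Q" "f ` K = K"
  shows "f ` (K #>\<^bsub>Q\<^esub> x) = K #>\<^bsub>Q\<^esub> f x"
proof -
  have "f ` (K #>\<^bsub>Q\<^esub> x) = (\<lambda>k. f k \<otimes>\<^bsub>Q\<^esub> f x) ` K"
  proof -
    have "f (k \<otimes>\<^bsub>Q\<^esub> x) = f k \<otimes>\<^bsub>Q\<^esub> f x" if "k \<in> K" for k
      using assms that by (auto simp: hom_def)
    moreover have "f ` (K #>\<^bsub>Q\<^esub> x) = (\<lambda>k. f (k \<otimes>\<^bsub>Q\<^esub> x)) ` K"
      unfolding r_coset_def by blast
    ultimately show ?thesis by simp
  qed
  also have "\<dots> = (\<lambda>k. k \<otimes>\<^bsub>Q\<^esub> f x) ` (f ` K)" by (simp add: image_image)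
  finally show ?thesis using assms(5) by (auto simp: r_coset_def)
qed

section \<open>Chains\<close>

lemma cycles_subgroup: "add_subgroup (cycles B d n)"
  unfolding cycles_def
  by (rule add_subgroupI)
     (simp_all add: frag_extend_diff add_subgroup_diff[OF add_subgroup_keys, unfolded mem_Collect_eq])

lemma boundaries_subgroup: "add_subgroup (boundaries B d n)"
proof (rule add_subgroupI)
  show "0 \<in> boundaries B d n"
    unfolding boundaries_def by (rule image_eqI[of _ _ 0]) auto
next
  fix x y assume "x \<in> boundaries B d n" "y \<in> boundaries B d n"
  then obtain c c' where c: "x = frag_extend d c" "y = frag_extend d c'"
      "supported c (B (Suc n))" "supported c' (B (Suc n))"
    by (auto simp: boundaries_def)
  then have "supported (c - c') (B (Suc n))"
    by (intro add_subgroup_diff[OF add_subgroup_keys, unfolded mem_Collect_eq])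
  then show "x - y \<in> boundaries B d n"
    unfolding boundaries_def using c by (intro image_eqI[of _ _ "c - c'"]) (auto simp: frag_extend_diff)
qed

lemma homology_quotient_map:
  assumes "boundaries B d n \<subseteq> cycles B d n"
  shows "quotient_map (homology B d n) (cycles B d n) (boundaries B d n) (coset (boundaries B d n))"
  using quotient_map_record[OF cycles_subgroup boundaries_subgroup assms]
  by (simp add: homology_def free_Abelian_group_def)

section \<open>Chain maps induced by maps of tuple entries\<close>

lemma additive_tuple_chain_map: "Modules.additive (tuple_chain_map f)"
  unfolding tuple_chain_map_def by (rule additive_frag_extend)

lemmas tuple_chain_map_simps = additive.add[OF additive_tuple_chain_map]
  additive.diff[OF additive_tuple_chain_map] additive.minus[OF additive_tuple_chain_map]
  additive.zero[OF additive_tuple_chain_map]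

lemma tuple_chain_map_of [simp]: "tuple_chain_map f (frag_of xs) = frag_of (map f xs)"
  by (simp add: tuple_chain_map_def)

lemma tuple_chain_map_keys:
  assumes "supported c X" "\<And>x. x \<in> X \<Longrightarrow> map f x \<in> X'"
  shows "supported (tuple_chain_map f c) X'"
proof -
  have "tuple_chain_map f c \<in> {c. supported c X'}"
    by (rule additive_mem_of_basis[OF additive_tuple_chain_map add_subgroup_keys assms(1)])
       (use assms(2) in auto)
  then show ?thesis by simp
qed

lemma tuple_chain_map_compose:
  "tuple_chain_map f (tuple_chain_map g c) = tuple_chain_map (\<lambda>x. f (g x)) c"
  by (rule additive_eq_of_basis[OF _ additive_tuple_chain_map subset_UNIV])
     (simp_all add: Modules.additive_def tuple_chain_map_simps comp_def)

lemma tuple_chain_map_cong: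
  assumes "supported c X" "\<And>x. x \<in> X \<Longrightarrow> map f x = map g x"
  shows "tuple_chain_map f c = tuple_chain_map g c"
  by (rule additive_eq_of_basis[OF additive_tuple_chain_map additive_tuple_chain_map assms(1)])
     (simp add: assms(2))

lemma tuple_chain_map_id:
  assumes "supported c X" "\<And>x. x \<in> X \<Longrightarrow> map f x = x"
  shows "tuple_chain_map f c = c"
  by (rule additive_eq_of_basis[OF additive_tuple_chain_map _ assms(1)])
     (simp_all add: assms(2) Modules.additive_def)

lemma tuple_chain_map_commute:
  assumes "supported c X" "\<And>x. x \<in> X \<Longrightarrow> d' (map f x) = tuple_chain_map f (d x)"
  shows "frag_extend d' (tuple_chain_map f c) = tuple_chain_map f (frag_extend d c)"
  by (rule additive_eq_of_basis[OF _ _ assms(1)])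
     (simp_all add: Modules.additive_def tuple_chain_map_simps frag_extend_add assms(2))

lemma tuple_chain_map_cycles:
  assumes "c \<in> cycles B d n" "\<And>x. x \<in> B n \<Longrightarrow> map f x \<in> B' n"
    "\<And>x. x \<in> B n \<Longrightarrow> d' (map f x) = tuple_chain_map f (d x)"
  shows "tuple_chain_map f c \<in> cycles B' d' n"
  using assms(1) tuple_chain_map_keys[of c "B n" f "B' n"] tuple_chain_map_commute[of c "B n" d' f d] assms(2,3)
  by (simp add: cycles_def tuple_chain_map_simps)

lemma tuple_chain_map_boundaries:
  assumes "c \<in> boundaries B d n" "\<And>x. x \<in> B (Suc n) \<Longrightarrow> map f x \<in> B' (Suc n)"
    "\<And>x. x \<in> B (Suc n) \<Longrightarrow> d' (map f x) = tuple_chain_map f (d x)"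
  shows "tuple_chain_map f c \<in> boundaries B' d' n"
proof -
  obtain k where k: "c = frag_extend d k" "supported k (B (Suc n))"
    using assms(1) by (auto simp: boundaries_def)
  have "frag_extend d' (tuple_chain_map f k) = tuple_chain_map f (frag_extend d k)"
    by (rule tuple_chain_map_commute[OF k(2)]) (rule assms(3))
  moreover have "supported (tuple_chain_map f k) (B' (Suc n))"
    by (rule tuple_chain_map_keys[OF k(2)]) (rule assms(2))
  ultimately show ?thesis
    unfolding boundaries_def using k by (intro image_eqI[of _ _ "tuple_chain_map f k"]) auto
qed

section \<open>Elementary actions\<close>

abbreviation units :: "'a::comm_ring_unit set" where "units \<equiv> carrier unit_group"

lemma carrier_unit_group: "a \<in> units \<longleftrightarrow> (\<exists>b. a * b = (1 :: 'a::comm_ring_unit))"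
  by (auto simp: unit_group_def units_of_def Units_def mult.commute)

lemma unit_minus: "a \<in> units \<Longrightarrow> - (a :: 'a::comm_ring_unit) \<in> units"
  unfolding carrier_unit_group by (metis minus_mult_minus)

lemma additive_group_group: "comm_group (additive_group :: 'a::comm_ring_unit monoid)"
  using quotient_mapD(1)[OF quotient_map_self[of "UNIV :: 'a set"]]
  by (simp add: additive_group_def add_subgroup_def)

lemma inv_additive_group: "inv\<^bsub>additive_group\<^esub> x = - (x :: 'a::comm_ring_unit)"
proof -
  interpret comm_group "additive_group :: 'a monoid" by (rule additive_group_group)
  show ?thesis by (rule inv_equality) (auto simp: additive_group_def)
qed

lemma add_subgroup_M: "add_subgroup (subgroup_M :: 'a::comm_ring_unit set)"
proof -
  interpret comm_group "additive_group :: 'a monoid" by (rule additive_group_group)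
  have M: "subgroup (subgroup_M :: 'a set) additive_group"
    unfolding subgroup_M_def by (rule generate_is_subgroup) (auto simp: additive_group_def)
  show ?thesis
  proof (rule add_subgroupI)
    show "(0 :: 'a) \<in> subgroup_M"
      using subgroup.one_closed[OF M] by (simp add: additive_group_def)
    fix x y :: 'a assume "x \<in> subgroup_M" "y \<in> subgroup_M"
    then have "x \<otimes>\<^bsub>additive_group\<^esub> inv\<^bsub>additive_group\<^esub> y \<in> subgroup_M"
      by (intro subgroup.m_closed[OF M] subgroup.m_inv_closed[OF M])
    then show "x - y \<in> subgroup_M"
      by (simp add: inv_additive_group, simp add: additive_group_def)
  qed
qed

lemmas M_intros = add_subgroup_intros[OF add_subgroup_M]

lemma M_square: "a \<in> units \<Longrightarrow> x * (a * a - 1) \<in> subgroup_M"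
  unfolding subgroup_M_def by (rule generate.incl) (auto simp: power2_eq_square)

lemma M_three:
  "b \<in> units \<Longrightarrow> c \<in> units \<Longrightarrow> 3 * (b + 1) * (c + 1) \<in> subgroup_M"
  unfolding subgroup_M_def by (rule generate.incl) blast

lemma M_least:
  fixes T :: "'a::comm_ring_unit set"
  assumes "add_subgroup T" "\<And>x a. a \<in> units \<Longrightarrow> x * (a * a - 1) \<in> T"
    "\<And>b c. b \<in> units \<Longrightarrow> c \<in> units \<Longrightarrow> 3 * (b + 1) * (c + 1) \<in> T"
    "x \<in> subgroup_M"
  shows "x \<in> T"
  using assms(4) unfolding subgroup_M_def
proof (induction rule: generate.induct)
  case one
  then show ?case using assms(1) by (simp add: additive_group_def add_subgroup_zero)
next
  case (incl h)
  then show ?case using assms(2,3) by (auto simp: power2_eq_square)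
next
  case (inv h)
  then show ?case using assms(1-3) by (auto simp: inv_additive_group power2_eq_square intro!: add_subgroup_minus)
next
  case (eng h1 h2)
  then show ?case using assms(1) by (simp add: additive_group_def add_subgroup_add)
qed

lemma three_times: "3 * (x :: 'a::comm_ring_unit) = x + x + x"
  by (simp only: numeral.simps distrib_right mult_1)

text \<open>For the second kind of generator use u (b + 1) = (u b + 1) - (- u + 1), where
  \<open>u * b\<close> and \<open>- u\<close> are again units.\<close>

lemma M_mult_unit:
  fixes u :: "'a::comm_ring_unit"
  assumes u: "u \<in> units" and x: "x \<in> subgroup_M"
  shows "u * x \<in> subgroup_M"
proof -
  have "x \<in> {x. u * x \<in> subgroup_M}"
  proof (rule M_least[OF _ _ _ x])
    show "add_subgroup {x. u * x \<in> subgroup_M}"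
      by (rule add_subgroupI) (auto simp: right_diff_distrib intro: M_intros)
    show "y * (a * a - 1) \<in> {x. u * x \<in> subgroup_M}" if "a \<in> units" for y a
      using M_square[OF that, of "u * y"] by (simp add: mult.assoc)
    fix b c :: 'a assume bc: "b \<in> units" "c \<in> units"
    have ub: "u * b \<in> units"
      using u bc unfolding carrier_unit_group by (metis mult.assoc mult.commute mult_1)
    have "u * (3 * (b + 1) * (c + 1)) = 3 * (u * b + 1) * (c + 1) - 3 * (- u + 1) * (c + 1)"
      by (simp add: algebra_simps)
    then show "3 * (b + 1) * (c + 1) \<in> {x. u * x \<in> subgroup_M}"
      using M_three[OF ub bc(2)] M_three[OF unit_minus[OF u] bc(2)] by (auto intro: M_intros)
  qed
  then show ?thesis by simp
qed

text \<open>The defect is 3 (a - 1) (b - 1), a generator of M taken at \<open>- a\<close> and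
  \<open>- b\<close>. So 3 (a - 1) is a homomorphism from the units to A/M.\<close>

lemma M_three_hom:
  fixes a b :: "'a::comm_ring_unit"
  assumes "a \<in> units" "b \<in> units"
  shows "3 * (a * b - 1) - (3 * (a - 1) + 3 * (b - 1)) \<in> subgroup_M"
proof -
  have "3 * (a * b - 1) - (3 * (a - 1) + 3 * (b - 1)) = 3 * (- a + 1) * (- b + 1)"
    by (simp add: algebra_simps)
  then show ?thesis using M_three[OF unit_minus[OF assms(1)] unit_minus[OF assms(2)]] by simp
qed

text \<open>That homomorphism kills squares, since 3 (a^2 - 1) is a generator of the first kind; its
  values have order at most two.\<close>

lemma M_three_double:
  fixes a :: "'a::comm_ring_unit"
  assumes "a \<in> units"
  shows "3 * (a - 1) + 3 * (a - 1) \<in> subgroup_M"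
proof -
  have "3 * (a - 1) + 3 * (a - 1) = 3 * (a * a - 1) - (3 * (a * a - 1) - (3 * (a - 1) + 3 * (a - 1)))"
    by simp
  also have "\<dots> \<in> subgroup_M"
    using M_square[OF assms, of 3] M_three_hom[OF assms assms] by (rule M_intros(2))
  finally show ?thesis .
qed

text \<open>
  \<open>D a b\<close> stands for \<open>diag(a, b)\<close> with \<open>b = a\<inverse>\<close>; carrying both entries avoids a choice of inverses.
  The matrix \<open>w \<otimes> U (- a) \<otimes> inv w\<close> is \<open>E\<^sub>2\<^sub>1(a)\<close>.
\<close>

locale elementary_action = group G for G (structure) +
  fixes act :: "'g \<Rightarrow> 'l \<Rightarrow> 'l" and pt :: 'l
    and U :: "'a::comm_ring_unit \<Rightarrow> 'g" and D :: "'a \<Rightarrow> 'a \<Rightarrow> 'g" and w :: 'g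
  assumes w_closed [simp]: "w \<in> carrier G"
    and U_closed [simp]: "U x \<in> carrier G"
    and D_closed [simp]: "a * b = 1 \<Longrightarrow> D a b \<in> carrier G"
    and act_act [simp]: "g \<in> carrier G \<Longrightarrow> h \<in> carrier G \<Longrightarrow> act g (act h pt) = act (g \<otimes> h) pt"
    and act_U: "act (U x) pt = pt"
    and act_D: "a * b = 1 \<Longrightarrow> act (D a b) pt = pt"
    and U_add: "U x \<otimes> U y = U (x + y)"
    and D_mult: "a * b = 1 \<Longrightarrow> c * d = 1 \<Longrightarrow> D a b \<otimes> D c d = D (a * c) (b * d)"
    and D_U: "a * b = 1 \<Longrightarrow> D a b \<otimes> U x = U (a * a * x) \<otimes> D a b"
    and D_w: "a * b = 1 \<Longrightarrow> D a b \<otimes> w = w \<otimes> D b a"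
    and w_w: "w \<otimes> w = D (- 1) (- 1)"
    and U_w: "a * b = 1 \<Longrightarrow> U b \<otimes> w = w \<otimes> U (- a) \<otimes> inv w \<otimes> D (- b) (- a) \<otimes> U (- a)"
    and stab: "g \<in> carrier G \<Longrightarrow> act g pt = pt \<Longrightarrow> \<exists>a b x. a * b = 1 \<and> g = D a b \<otimes> U x"
    and stab_edge: "g \<in> carrier G \<Longrightarrow> act g pt = pt \<Longrightarrow> act (g \<otimes> w) pt = act w pt
      \<Longrightarrow> \<exists>a b. a * b = 1 \<and> g = D a b"
    and DU_inj: "a * b = 1 \<Longrightarrow> c * d = 1 \<Longrightarrow> D a b \<otimes> U x = D c d \<otimes> U y \<Longrightarrow> a = c \<and> x = y"
    and gen: "carrier G = generate G (range U \<union> {w})"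
begin

lemma U_zero [simp]: "U 0 = \<one>"
  using U_add[of 0 0] l_cancel_one[of "U 0" "U 0"] by (simp only: U_closed add_0_left)

lemma D_one [simp]: "D 1 1 = \<one>"
  using D_mult[of 1 1 1 1] l_cancel_one[of "D 1 1" "D 1 1"] by (simp only: D_closed mult_1)

lemma act_one [simp]: "act \<one> pt = pt"
  by (metis act_U U_zero)

lemma inv_U: "inv (U x) = U (- x)"
  by (rule inv_equality) (auto simp: U_add)

lemma U_D: "a * b = 1 \<Longrightarrow> U x \<otimes> D a b = D a b \<otimes> U (b * b * x)"
proof -
  assume ab: "a * b = 1"
  have "a * a * (b * b * x) = (a * b) * (a * b) * x" by (simp add: ac_simps)
  then have "a * a * (b * b * x) = x" using ab by simp
  then show ?thesis using D_U[OF ab, of "b * b * x"] by simp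
qed

section \<open>Stabiliser, edges and triangles\<close>

definition B :: "'g set" where "B = {g \<in> carrier G. act g pt = pt}"

lemma B_closed [simp]: "b \<in> B \<Longrightarrow> b \<in> carrier G"
  unfolding B_def by simp

lemma act_B [simp]: "b \<in> B \<Longrightarrow> act b pt = pt"
  unfolding B_def by simp

lemma act_mult_B: "g \<in> carrier G \<Longrightarrow> b \<in> B \<Longrightarrow> act (g \<otimes> b) pt = act g pt"
  using act_act[of g b] unfolding B_def by simp

lemma U_B [simp]: "U x \<in> B"
  unfolding B_def by (simp add: act_U)

lemma D_B [simp]: "a * b = 1 \<Longrightarrow> D a b \<in> B"
  unfolding B_def by (simp add: act_D)

lemma one_B [simp]: "\<one> \<in> B"
  using U_B[of 0] by simp

lemma D_minus_one_B [simp]: "D (- 1) (- 1) \<in> B"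
  by (rule D_B) simp

lemma mult_B: "b \<in> B \<Longrightarrow> c \<in> B \<Longrightarrow> b \<otimes> c \<in> B"
  using act_mult_B[of b c] unfolding B_def by simp

lemma same_point:
  assumes "g \<in> carrier G" "h \<in> carrier G" "act g pt = act h pt"
  shows "inv h \<otimes> g \<in> B"
proof -
  have "act (inv h \<otimes> g) pt = act (inv h) (act h pt)"
    using assms act_act[of "inv h" g] by simp
  also have "\<dots> = pt" using assms act_act[of "inv h" h] by simp
  finally show ?thesis using assms unfolding B_def by simp
qed

definition edge :: "'g \<Rightarrow> 'l list" where "edge g = [act g pt, act (g \<otimes> w) pt]"

definition V :: "'a \<Rightarrow> 'g" where "V a = w \<otimes> U (- a) \<otimes> inv w"

definition tri :: "'g \<Rightarrow> 'a \<Rightarrow> 'l list" where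
  "tri g a = [act g pt, act (g \<otimes> w) pt, act (g \<otimes> V a) pt]"

text \<open>In the matrix case \<open>Y1\<close> and \<open>Y2\<close> are the bases of the complex
  in degrees 1 and 2, by \<open>Y_basis_1\<close> and \<open>Y_basis_2\<close>.\<close>

definition Y1 :: "'l list set" where "Y1 = edge ` carrier G"

definition Y2 :: "'l list set" where "Y2 = {tri g a | g a. g \<in> carrier G \<and> a \<in> units}"

abbreviation bdy :: "('l list \<Rightarrow>\<^sub>0 int) \<Rightarrow> ('l list \<Rightarrow>\<^sub>0 int)" where "bdy \<equiv> frag_extend Y_boundary"

abbreviation chain1 :: "('l list \<Rightarrow>\<^sub>0 int) \<Rightarrow> bool" where "chain1 c \<equiv> supported c Y1"

definition Z1 :: "('l list \<Rightarrow>\<^sub>0 int) set" where "Z1 = {c. chain1 c \<and> bdy c = 0}"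

abbreviation vtx :: "'l \<Rightarrow> ('l list \<Rightarrow>\<^sub>0 int)" where "vtx l \<equiv> frag_of [l]"

abbreviation eg :: "'g \<Rightarrow> ('l list \<Rightarrow>\<^sub>0 int)" where "eg g \<equiv> frag_of (edge g)"

abbreviation tact :: "'g \<Rightarrow> ('l list \<Rightarrow>\<^sub>0 int) \<Rightarrow> ('l list \<Rightarrow>\<^sub>0 int)" where
  "tact g \<equiv> tuple_chain_map (act g)"

lemma V_closed [simp]: "V a \<in> carrier G"
  by (simp add: V_def)

lemma Y_boundary_edge [simp]: "Y_boundary (edge g) = vtx (act (g \<otimes> w) pt) - vtx (act g pt)"
  by (simp add: edge_def Y_boundary_def numeral_2_eq_2)

lemma edge_Y1 [simp]: "g \<in> carrier G \<Longrightarrow> edge g \<in> Y1"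
  by (simp add: Y1_def)

text \<open>Each face is a translate of the standard edge. The translating elements come from
  \<open>w \<otimes> U (- a) \<otimes> w = V a \<otimes> (w \<otimes> w)\<close> and from
  \<open>U_w\<close>, in both cases up to a right factor in \<open>B\<close>, which does not move
  the base point.\<close>

lemma Y_boundary_tri:
  assumes g: "g \<in> carrier G" and ab: "a * b = 1"
  shows "Y_boundary (tri g a) = eg (g \<otimes> w \<otimes> U (- a)) - eg (g \<otimes> U b) + eg g"
proof -
  have ba: "(- b) * (- a) = 1" using ab by (simp add: mult.commute)
  have 1: "act (g \<otimes> w \<otimes> U (- a)) pt = act (g \<otimes> w) pt"
    using g by (simp add: act_mult_B)
  have "w \<otimes> U (- a) \<otimes> w = V a \<otimes> (w \<otimes> w)"
    by (simp add: V_def m_assoc inv_solve_left)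
  then have "g \<otimes> w \<otimes> U (- a) \<otimes> w = g \<otimes> V a \<otimes> D (- 1) (- 1)"
    using g by (simp add: m_assoc w_w)
  then have 2: "act (g \<otimes> w \<otimes> U (- a) \<otimes> w) pt = act (g \<otimes> V a) pt"
    using g by (simp add: act_mult_B)
  have "g \<otimes> U b \<otimes> w = g \<otimes> V a \<otimes> (D (- b) (- a) \<otimes> U (- a))"
    using g ba U_w[OF ab] by (simp add: m_assoc V_def)
  moreover have "D (- b) (- a) \<otimes> U (- a) \<in> B" using ba by (simp add: mult_B)
  ultimately have 3: "act (g \<otimes> U b \<otimes> w) pt = act (g \<otimes> V a) pt"
    using g by (simp add: act_mult_B)
  have 4: "act (g \<otimes> U b) pt = act g pt"
    using g by (simp add: act_mult_B)
  show ?thesis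
    by (simp add: tri_def Y_boundary_def edge_def 1 2 3 4 numeral_3_eq_3)
qed

lemma map_act_edge [simp]: "g \<in> carrier G \<Longrightarrow> h \<in> carrier G \<Longrightarrow> map (act g) (edge h) = edge (g \<otimes> h)"
  by (simp add: edge_def m_assoc)

lemma chain1_subgroup: "add_subgroup {c. chain1 c}"
  by (rule add_subgroup_keys)

lemmas chain1_intros = add_subgroup_intros[OF chain1_subgroup, unfolded mem_Collect_eq]

lemma tact_chain1 [simp]:
  assumes "g \<in> carrier G" "chain1 c"
  shows "chain1 (tact g c)"
proof -
  have "tact g c \<in> {c. chain1 c}"
    by (rule additive_mem_of_basis[OF additive_tuple_chain_map chain1_subgroup assms(2)])
       (use assms(1) in \<open>auto simp: Y1_def\<close>)
  then show ?thesis by simp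
qed

lemma additive_comp: "Modules.additive f \<Longrightarrow> Modules.additive g \<Longrightarrow> Modules.additive (\<lambda>x. f (g x))"
  by (simp add: Modules.additive_def)

lemma bdy_tact:
  assumes "g \<in> carrier G" "chain1 c"
  shows "bdy (tact g c) = tact g (bdy c)"
  by (rule additive_eq_of_basis[OF additive_comp additive_comp assms(2), OF additive_frag_extend additive_tuple_chain_map
        additive_tuple_chain_map additive_frag_extend])
     (use assms(1) in \<open>auto simp: Y1_def tuple_chain_map_simps m_assoc\<close>)

lemma Z1_subgroup: "add_subgroup Z1"
  unfolding Z1_def by (rule add_subgroupI) (simp_all add: frag_extend_diff chain1_intros(2))

lemma tact_Z1: "g \<in> carrier G \<Longrightarrow> z \<in> Z1 \<Longrightarrow> tact g z \<in> Z1"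
  by (auto simp: Z1_def bdy_tact tuple_chain_map_simps)

definition B1 :: "('l list \<Rightarrow>\<^sub>0 int) set" where "B1 = bdy ` {c. supported c Y2}"

lemma B1_Z1: "B1 \<subseteq> Z1"
proof -
  have "bdy c \<in> Z1" if "supported c Y2" for c
  proof (rule additive_mem_of_basis[OF additive_frag_extend Z1_subgroup that])
    fix x assume "x \<in> Y2"
    then obtain g a b where x: "g \<in> carrier G" "a * b = 1" "x = tri g a"
      by (auto simp: Y2_def carrier_unit_group)
    have "bdy (Y_boundary (tri g a)) = 0"
      by (simp add: tri_def Y_boundary_def numeral_3_eq_3 frag_extend_add frag_extend_diff frag_extend_minus)
    moreover have "chain1 (Y_boundary (tri g a))"
      unfolding Y_boundary_tri[OF x(1,2)] using x by (intro chain1_intros) auto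
    ultimately show "bdy (frag_of x) \<in> Z1" using x by (simp add: Z1_def)
  qed
  then show ?thesis by (auto simp: B1_def)
qed

text \<open>Right multiplication by \<open>U x\<close> leaves the point of \<open>g\<close> where it
  is, and right multiplication by \<open>w\<close> prolongs a path by the edge of \<open>g\<close>.
  Since these elements generate the group, every point is reached.\<close>

lemma connected:
  assumes "g \<in> carrier G"
  shows "\<exists>c. chain1 c \<and> bdy c = vtx (act g pt) - vtx pt"
proof -
  let ?P = "\<lambda>g. \<exists>c. chain1 c \<and> bdy c = vtx (act g pt) - vtx pt"
  have U: "?P (g \<otimes> U x)" if "g \<in> carrier G" "?P g" for g x
    using that by (simp add: act_mult_B)
  have w: "?P (g \<otimes> w)" if g: "g \<in> carrier G" and P: "?P g" for g
  proof -
    obtain c where "chain1 c" "bdy c = vtx (act g pt) - vtx pt" using P by blast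
    then show ?thesis
      using g by (intro exI[of _ "c + eg g"]) (simp add: frag_extend_add chain1_intros(4))
  qed
  have iw: "?P (g \<otimes> inv w)" if g: "g \<in> carrier G" and P: "?P g" for g
  proof -
    \<comment> \<open>The square of \<open>w\<close> is the involution \<open>D (- 1) (- 1)\<close>
      in \<open>B\<close>, so \<open>inv w\<close> and \<open>w\<close> send the base point to the
      same point.\<close>
    have "inv w = w \<otimes> D (- 1) (- 1)"
    proof (rule inv_equality)
      show "w \<otimes> D (- 1) (- 1) \<otimes> w = \<one>"
        using D_w[of "- 1" "- 1"] D_mult[of "- 1" "- 1" "- 1" "- 1"] w_w
        by (simp add: m_assoc) (simp flip: m_assoc)
    qed auto
    then have "g \<otimes> inv w = g \<otimes> w \<otimes> D (- 1) (- 1)" using g by (simp add: m_assoc)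
    then show ?thesis using w[OF g P] g by (simp add: act_mult_B)
  qed
  \<comment> \<open>Quantifying over the left factor \<open>h\<close> makes the claim stable under
    products, as the induction over \<open>generate\<close> requires.\<close>
  have "\<forall>h\<in>carrier G. ?P h \<longrightarrow> ?P (h \<otimes> g)" if "g \<in> generate G (range U \<union> {w})" for g
    using that
  proof (induction rule: generate.induct)
    case one
    then show ?case by simp
  next
    case (incl h)
    then have "h = w \<or> (\<exists>x. h = U x)" by auto
    then show ?case using U w by blast
  next
    case (inv h)
    then have "inv h = inv w \<or> (\<exists>x. inv h = U x)" by (auto simp: inv_U)
    then show ?case using U iw by (elim disjE exE) simp_all
  next
    case (eng h1 h2)
    then have h12: "h1 \<in> carrier G" "h2 \<in> carrier G" by (simp_all only: gen)
    show ?case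
    proof (intro ballI impI)
      fix h assume h: "h \<in> carrier G" "?P h"
      then have "?P (h \<otimes> h1)" using eng by blast
      then have "?P ((h \<otimes> h1) \<otimes> h2)" using eng h h12 by blast
      then show "?P (h \<otimes> (h1 \<otimes> h2))" using h h12 by (simp only: m_assoc)
    qed
  qed
  from mp[OF bspec[OF this[OF assms[unfolded gen]] one_closed]]
  have "?P \<one> \<Longrightarrow> ?P (\<one> \<otimes> g)" .
  moreover have "?P \<one>" by (intro exI[of _ 0]) simp
  ultimately show ?thesis using assms by simp
qed

end

section \<open>The hyperhomology relations\<close>

lemma bar_boundary_2: "bar_boundary G [g, h] = frag_of [h] - frag_of [g \<otimes>\<^bsub>G\<^esub> h] + frag_of [g]"
  by (simp add: bar_boundary_def bar_face_def numeral_2_eq_2)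

lemma bar_basis_2: "bar_basis G 2 = {[g, h] | g h. g \<in> carrier G \<and> h \<in> carrier G}"
  by (auto simp: bar_basis_def numeral_2_eq_2 length_Suc_conv)

context elementary_action
begin

section \<open>Chosen paths, coinvariant relations and the connecting map\<close>

definition path :: "'g \<Rightarrow> ('l list \<Rightarrow>\<^sub>0 int)" where
  "path g = (SOME c. chain1 c \<and> bdy c = vtx (act g pt) - vtx pt)"

lemma path_chain1 [simp]: "g \<in> carrier G \<Longrightarrow> chain1 (path g)"
  and bdy_path [simp]: "g \<in> carrier G \<Longrightarrow> bdy (path g) = vtx (act g pt) - vtx pt"
  using someI_ex[OF connected, of g] unfolding path_def by auto

text \<open>\<open>Z1\<close> modulo \<open>N\<close> is the group of coinvariants of H_1(Y), see
  \<open>quotient_coinvariants\<close>. The form as a least subgroup provides the induction rule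
  \<open>N_least\<close>.\<close>

definition N :: "('l list \<Rightarrow>\<^sub>0 int) set" where
  "N = \<Inter> {T. add_subgroup T \<and> B1 \<subseteq> T \<and> (\<forall>g\<in>carrier G. \<forall>z\<in>Z1. tact g z - z \<in> T)}"

lemma N_subgroup: "add_subgroup N"
  unfolding N_def by (rule add_subgroupI) (auto intro: add_subgroup_intros)

lemmas N_intros = add_subgroup_intros[OF N_subgroup]

lemma B1_N: "B1 \<subseteq> N"
  and tact_N: "g \<in> carrier G \<Longrightarrow> z \<in> Z1 \<Longrightarrow> tact g z - z \<in> N"
  by (auto simp: N_def)

lemma N_least:
  assumes "add_subgroup T" "B1 \<subseteq> T" "\<And>g z. g \<in> carrier G \<Longrightarrow> z \<in> Z1 \<Longrightarrow> tact g z - z \<in> T"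
  shows "N \<subseteq> T"
  using assms by (auto simp: N_def)

lemma N_Z1: "N \<subseteq> Z1"
  by (rule N_least) (auto intro: add_subgroup_diff tact_Z1 Z1_subgroup subsetD[OF B1_Z1])

text \<open>On [g|h] this is the failure of \<open>path\<close> to be a crossed homomorphism. It is
  a cycle because the boundary of \<open>path\<close> is one exactly, and it induces the map from
  H_2(E) to H_1(Y)_E.\<close>

definition alpha :: "('g list \<Rightarrow>\<^sub>0 int) \<Rightarrow> ('l list \<Rightarrow>\<^sub>0 int)" where
  "alpha = frag_extend (\<lambda>gs. path (gs ! 0) + tact (gs ! 0) (path (gs ! 1)) - path (gs ! 0 \<otimes> gs ! 1))"

abbreviation bar_bdy :: "('g list \<Rightarrow>\<^sub>0 int) \<Rightarrow> ('g list \<Rightarrow>\<^sub>0 int)" where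
  "bar_bdy \<equiv> frag_extend (bar_boundary G)"

lemma additive_alpha: "Modules.additive alpha"
  unfolding alpha_def by (rule additive_frag_extend)

lemmas alpha_simps = additive.add[OF additive_alpha] additive.diff[OF additive_alpha]
  additive.minus[OF additive_alpha] additive.zero[OF additive_alpha]

lemma alpha_pair [simp]: "alpha (frag_of [g, h]) = path g + tact g (path h) - path (g \<otimes> h)"
  by (simp add: alpha_def)

lemma alpha_Z1:
  assumes "supported c (bar_basis G 2)"
  shows "alpha c \<in> Z1"
proof (rule additive_mem_of_basis[OF additive_alpha Z1_subgroup assms])
  fix gs assume "gs \<in> bar_basis G 2"
  then obtain g h where gh: "gs = [g, h]" "g \<in> carrier G" "h \<in> carrier G"
    by (auto simp: bar_basis_2)
  then have "chain1 (path g + tact g (path h) - path (g \<otimes> h))"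
    by (intro chain1_intros(2,4)) auto
  then show "alpha (frag_of gs) \<in> Z1"
    using gh by (simp add: Z1_def frag_extend_add frag_extend_diff bdy_tact tuple_chain_map_simps)
qed

text \<open>
  The relations of \<open>H\<^sub>1\<close> of the group with coefficients in the complex \<open>Y\<close>, in which a bar generator
  \<open>[g]\<close> stands for the hyperhomology cycle \<open>[g] \<otimes> pt\<close> completed by the chain \<open>path g\<close>.
\<close>

definition S :: "(('g list \<Rightarrow>\<^sub>0 int) \<times> ('l list \<Rightarrow>\<^sub>0 int)) set" where
  "S = {(bar_bdy c, n - alpha c) | c n. supported c (bar_basis G 2) \<and> n \<in> N}"

lemma S_subgroup: "add_subgroup S"
proof (rule add_subgroupI)
  show "0 \<in> S"
    unfolding S_def by (rule CollectI, rule exI[of _ 0], rule exI[of _ 0])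
      (simp add: alpha_simps N_intros zero_prod_def)
next
  fix x y assume "x \<in> S" "y \<in> S"
  then obtain c n c' n' where x: "x = (bar_bdy c, n - alpha c)" "supported c (bar_basis G 2)" "n \<in> N"
    and y: "y = (bar_bdy c', n' - alpha c')" "supported c' (bar_basis G 2)" "n' \<in> N"
    by (auto simp: S_def)
  have "supported (c - c') (bar_basis G 2)"
    using x y keys_diff[of c c'] by blast
  then show "x - y \<in> S"
    unfolding S_def using x y
    by (intro CollectI exI[of _ "c - c'"] exI[of _ "n - n'"])
       (simp add: frag_extend_diff alpha_simps N_intros)
qed

lemmas S_intros = add_subgroup_intros[OF S_subgroup]

section \<open>Relations between the classes sigma(x)\<close>

definition br :: "'g \<Rightarrow> ('g list \<Rightarrow>\<^sub>0 int) \<times> ('l list \<Rightarrow>\<^sub>0 int)" where "br g = (frag_of [g], 0)"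

definition yy :: "('l list \<Rightarrow>\<^sub>0 int) \<Rightarrow> ('g list \<Rightarrow>\<^sub>0 int) \<times> ('l list \<Rightarrow>\<^sub>0 int)" where "yy c = (0, c)"

text \<open>Removing the path leaves the bare chain [g] tensor \<open>pt\<close>, so that relations
  between values of \<open>eta\<close> do not mention the chosen paths. Its second component is a
  cycle only for \<open>g\<close> in \<open>B\<close>.\<close>

definition eta :: "'g \<Rightarrow> ('g list \<Rightarrow>\<^sub>0 int) \<times> ('l list \<Rightarrow>\<^sub>0 int)" where "eta g = br g - yy (path g)"

text \<open>By \<open>eta_edge\<close> below, all edges have the same class \<open>kap\<close> up to differences of values of \<open>eta\<close>.\<close>

definition kap :: "('g list \<Rightarrow>\<^sub>0 int) \<times> ('l list \<Rightarrow>\<^sub>0 int)" where "kap = eta w + yy (eg \<one>)"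

abbreviation sig :: "'a \<Rightarrow> ('g list \<Rightarrow>\<^sub>0 int) \<times> ('l list \<Rightarrow>\<^sub>0 int)" where "sig x \<equiv> eta (U x)"

lemma additive_yy: "Modules.additive yy"
  by (simp add: Modules.additive_def yy_def)

lemmas yy_simps = additive.add[OF additive_yy] additive.diff[OF additive_yy]
  additive.minus[OF additive_yy] additive.zero[OF additive_yy]

lemma yy_N: "n \<in> N \<Longrightarrow> yy n \<in> S"
  unfolding S_def yy_def by (rule CollectI, rule exI[of _ 0], rule exI[of _ n])
    (simp add: alpha_simps)

lemma yy_tact: "g \<in> carrier G \<Longrightarrow> z \<in> Z1 \<Longrightarrow> yy (tact g z) - yy z \<in> S"
  using yy_N[OF tact_N] by (simp add: yy_simps)

lemma eta_mult:
  assumes "g \<in> carrier G" "h \<in> carrier G"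
  shows "eta g + eta h - eta (g \<otimes> h) - (yy (tact g (path h)) - yy (path h)) \<in> S"
proof -
  have "eta g + eta h - eta (g \<otimes> h) - (yy (tact g (path h)) - yy (path h)) =
    (bar_bdy (frag_of [g, h]), 0 - alpha (frag_of [g, h]))"
    by (simp add: eta_def br_def yy_def bar_boundary_2 prod_eq_iff)
  also have "\<dots> \<in> S"
    unfolding S_def
    by (rule CollectI, rule exI[of _ "frag_of [g, h]"], rule exI[of _ 0])
       (use assms N_intros(1) in \<open>auto simp: bar_basis_2\<close>)
  finally show ?thesis .
qed

lemma path_Z1: "b \<in> B \<Longrightarrow> path b \<in> Z1"
  by (simp add: Z1_def)

text \<open>The correction in \<open>eta_mult\<close> moves the path of \<open>b\<close> by
  \<open>g\<close>. For \<open>b\<close> in \<open>B\<close> that path is closed, so moving it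
  changes nothing modulo \<open>N\<close>.\<close>

lemma eta_B:
  assumes "g \<in> carrier G" "b \<in> B"
  shows "eta g + eta b - eta (g \<otimes> b) \<in> S"
proof -
  have "eta g + eta b - eta (g \<otimes> b) = (eta g + eta b - eta (g \<otimes> b) - (yy (tact g (path b)) - yy (path b)))
      + (yy (tact g (path b)) - yy (path b))" by simp
  also have "\<dots> \<in> S" using assms by (intro S_intros(4) eta_mult yy_tact path_Z1) auto
  finally show ?thesis .
qed

text \<open>The standard edge and \<open>path w\<close> have the same ends, so their difference is a
  cycle and may be translated by \<open>g\<close>; \<open>eta_mult\<close> at \<open>g\<close> and
  \<open>w\<close> accounts for the translated path.\<close>

lemma eta_edge:
  assumes "g \<in> carrier G"
  shows "yy (eg g) - (kap + eta g - eta (g \<otimes> w)) \<in> S"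
proof -
  have z: "eg \<one> - path w \<in> Z1"
    by (simp add: Z1_def frag_extend_diff chain1_intros(2))
  have "yy (eg g) - (kap + eta g - eta (g \<otimes> w)) =
      (yy (tact g (eg \<one> - path w)) - yy (eg \<one> - path w)) -
      (eta g + eta w - eta (g \<otimes> w) - (yy (tact g (path w)) - yy (path w)))"
    using assms by (simp add: tuple_chain_map_simps yy_simps kap_def)
  also have "\<dots> \<in> S" using assms by (intro S_intros(2) eta_mult yy_tact z) auto
  finally show ?thesis .
qed

lemma eta_one: "eta \<one> \<in> S"
  using eta_B[of \<one> \<one>] by simp

lemma sig_add: "sig x + sig y - sig (x + y) \<in> S"
  using eta_B[of "U x" "U y"] by (simp add: U_add)

lemma sig_minus: "sig x + sig (- x) \<in> S"
proof -
  have "sig x + sig (- x) = (sig x + sig (- x) - sig (x + - x)) + eta \<one>" by simp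
  also have "\<dots> \<in> S" by (intro S_intros(4) sig_add eta_one)
  finally show ?thesis .
qed

lemma sig_diff: "sig x - sig y - sig (x - y) \<in> S"
proof -
  have "sig x - sig y - sig (x - y) = (sig x + sig (- y) - sig (x + - y)) - (sig y + sig (- y))"
    by (simp del: add_uminus_conv_diff) (simp add: algebra_simps)
  also have "\<dots> \<in> S" by (intro S_intros(2) sig_add sig_minus)
  finally show ?thesis .
qed

text \<open>All factors of \<open>D_U\<close> lie in \<open>B\<close>, where \<open>eta\<close> is
  additive, and the two copies of \<open>eta (D a b)\<close> cancel.\<close>

lemma sig_square:
  assumes ab: "a * b = 1"
  shows "sig (a * a * x) - sig x \<in> S"
proof -
  have "sig (a * a * x) - sig x = (sig (a * a * x) + eta (D a b) - eta (U (a * a * x) \<otimes> D a b)) -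
     (eta (D a b) + sig x - eta (D a b \<otimes> U x))"
    by (simp add: D_U[OF ab])
  also have "\<dots> \<in> S" using ab by (intro S_intros(2) eta_B) auto
  finally show ?thesis .
qed

lemma eta_D_mult:
  assumes "a * b = 1" "c * d = 1"
  shows "eta (D a b) + eta (D c d) - eta (D (a * c) (b * d)) \<in> S"
  using eta_B[of "D a b" "D c d"] assms by (simp add: D_mult)

lemma act_DU: "a * b = 1 \<Longrightarrow> g \<in> carrier G \<Longrightarrow> edge (g \<otimes> D a b) = edge g"
proof -
  assume *: "a * b = 1" "g \<in> carrier G"
  then have "g \<otimes> D a b \<otimes> w = g \<otimes> w \<otimes> D b a" by (simp add: m_assoc D_w mult.commute)
  then show ?thesis using * by (simp add: edge_def act_mult_B mult.commute)
qed

text \<open>\<open>D a b\<close> fixes the standard edge, but \<open>D_w\<close> makes it appear as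
  \<open>D b a\<close> at the far endpoint. Comparing \<open>eta_edge\<close> at
  \<open>\<one>\<close> and at \<open>D a b\<close> equates the two.\<close>

lemma eta_D_double:
  assumes ab: "a * b = 1"
  shows "eta (D a b) - eta (D b a) \<in> S"
proof -
  have ba: "b * a = 1" using ab by (simp add: mult.commute)
  have e1: "yy (eg (\<one> \<otimes> D a b)) - (kap + eta (D a b) - eta (D a b \<otimes> w)) \<in> S"
    using eta_edge[of "D a b"] ab by simp
  have e2: "eta w + eta (D b a) - eta (w \<otimes> D b a) \<in> S"
    using ba by (intro eta_B) auto
  have "eta (D a b) - eta (D b a) = (yy (eg \<one>) - (kap + eta \<one> - eta (\<one> \<otimes> w)))
      - (yy (eg (\<one> \<otimes> D a b)) - (kap + eta (D a b) - eta (D a b \<otimes> w)))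
      - (eta w + eta (D b a) - eta (w \<otimes> D b a)) + eta \<one>"
    using ab by (simp only: act_DU one_closed) (simp add: D_w ab)
  also have "\<dots> \<in> S" by (intro S_intros(2,4) e1 e2 eta_edge eta_one one_closed)
  finally show ?thesis .
qed

text \<open>The triangle relation. Each face of \<open>tri \<one> a\<close> is evaluated by
  \<open>eta_edge\<close>. Two of the three copies of \<open>kap\<close> cancel, and so do the terms
  \<open>eta w\<close> and \<open>eta ?v\<close> at the vertices. What remains are the factors in
  \<open>B\<close> by which representatives of the same vertex differ: \<open>U (- a)\<close> twice,
  \<open>U b\<close> once, and \<open>?d\<close> against \<open>D (- 1) (- 1)\<close>, which leaves
  \<open>D b a\<close>.\<close>

lemma kap_eq:
  assumes ab: "a * b = 1"
  shows "kap - (sig a + sig a + sig a) + eta (D b a) \<in> S"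
proof -
  let ?v = "w \<otimes> U (- a) \<otimes> inv w"
  have ba: "(- b) * (- a) = 1" "b * a = 1" using ab by (simp_all add: mult.commute)
  let ?d = "D (- b) (- a)"
  have e0: "w \<otimes> U (- a) \<otimes> w = ?v \<otimes> D (- 1) (- 1)"
    by (simp add: m_assoc flip: w_w) (simp flip: m_assoc)
  have e1: "U b \<otimes> w = ?v \<otimes> (?d \<otimes> U (- a))"
    using U_w[OF ab] ba by (simp add: m_assoc)
  have "frag_of (tri \<one> a) \<in> {c. supported c Y2}"
    using ab by (auto simp: Y2_def carrier_unit_group)
  then have "bdy (frag_of (tri \<one> a)) \<in> B1" unfolding B1_def by (rule imageI)
  then have t: "yy (eg (w \<otimes> U (- a))) - yy (eg (U b)) + yy (eg \<one>) \<in> S" (is "?T \<in> S")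
    using yy_N B1_N Y_boundary_tri[OF one_closed ab] by (auto simp flip: yy_simps)
  have f0: "yy (eg (w \<otimes> U (- a))) - (kap + eta (w \<otimes> U (- a)) - eta (?v \<otimes> D (- 1) (- 1))) \<in> S" (is "?F0 \<in> S")
    using eta_edge[of "w \<otimes> U (- a)"] by (simp only: e0 w_closed U_closed m_closed)
  have f1: "yy (eg (U b)) - (kap + sig b - eta (?v \<otimes> (?d \<otimes> U (- a)))) \<in> S" (is "?F1 \<in> S")
    using eta_edge[of "U b"] by (simp only: e1 U_closed)
  have f2: "yy (eg \<one>) - (kap + eta \<one> - eta w) \<in> S" (is "?F2 \<in> S")
    using eta_edge[of \<one>] by simp
  have g0: "eta w + sig (- a) - eta (w \<otimes> U (- a)) \<in> S" (is "?G0 \<in> S")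
    by (intro eta_B) auto
  have g1: "eta ?v + eta (D (- 1) (- 1)) - eta (?v \<otimes> D (- 1) (- 1)) \<in> S" (is "?G1 \<in> S")
    by (intro eta_B) auto
  have g2: "eta ?v + eta (?d \<otimes> U (- a)) - eta (?v \<otimes> (?d \<otimes> U (- a))) \<in> S" (is "?G2 \<in> S")
    using ba by (intro eta_B mult_B) auto
  have g3: "eta ?d + sig (- a) - eta (?d \<otimes> U (- a)) \<in> S" (is "?G3 \<in> S")
    using ba by (intro eta_B) auto
  have g4: "eta (D (- 1) (- 1)) + eta (D b a) - eta ?d \<in> S" (is "?G4 \<in> S")
    using eta_D_mult[of "- 1" "- 1" b a] ba by simp
  have g5: "sig (b * b * a) - sig a \<in> S"
    using sig_square[OF ba(2)] .
  \<comment> \<open>Conjugation by \<open>D b a\<close> takes \<open>U a\<close> to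
    \<open>U b\<close>, so the contribution of \<open>U b\<close> counts as a third
    \<open>sig a\<close>.\<close>
  have "b * b * a = b" using ba(2) by (simp add: mult.assoc)
  with g5 have g5': "sig b - sig a \<in> S" by simp
  have "kap - (sig a + sig a + sig a) + eta (D b a) =
     ?T - ?F0 + ?F1 - ?F2 + ?G0 - ?G1 + ?G2 + ?G3 + ?G4 - eta \<one> + (sig b - sig a)
     - (sig a + sig (- a)) - (sig a + sig (- a))"
    by (simp only: algebra_simps)
  also have "\<dots> \<in> S"
    by (intro S_intros(2,4) t f0 f1 f2 g0 g1 g2 g3 g4 g5' eta_one sig_minus)
  finally show ?thesis .
qed

lemma sig_triple: "sig x + sig x + sig x - sig (3 * x) \<in> S"
proof -
  have "sig x + sig x + sig x - sig (3 * x) =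
    (sig x + sig x - sig (x + x)) + (sig (x + x) + sig x - sig (x + x + x))"
    by (simp add: three_times)
  also have "\<dots> \<in> S" by (intro S_intros(4) sig_add)
  finally show ?thesis .
qed

text \<open>The triangle relation at a = 1, where the diagonal term is trivial.\<close>

lemma kap_sig: "kap - sig 3 \<in> S"
proof -
  have "kap - sig 3 = (kap - (sig 1 + sig 1 + sig 1) + eta (D 1 1)) - eta (D 1 1) + (sig 1 + sig 1 + sig 1 - sig (3 * 1))"
    by simp
  also have "\<dots> \<in> S"
    using eta_one by (intro S_intros(2,4) kap_eq sig_triple) auto
  finally show ?thesis .
qed

text \<open>Subtract the triangle relation at 1 from the one at \<open>a\<close>;
  \<open>eta_D_double\<close> replaces \<open>D b a\<close> by \<open>D a b\<close>.\<close>

lemma eta_D_sig: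
  assumes ab: "a * b = 1"
  shows "eta (D a b) - sig (3 * (a - 1)) \<in> S"
proof -
  let ?k = "kap - (sig a + sig a + sig a) + eta (D b a)"
  have "eta (D a b) - sig (3 * (a - 1)) =
    (eta (D a b) - eta (D b a)) + ?k - (kap - sig 3) + (sig a + sig a + sig a - sig (3 * a))
    + (sig (3 * a) - sig 3 - sig (3 * a - 3))"
    by (simp add: right_diff_distrib)
  also have "\<dots> \<in> S"
    by (intro S_intros(2,4) eta_D_double kap_eq kap_sig sig_triple sig_diff ab)
  finally show ?thesis .
qed

lemma sig_M:
  assumes "x \<in> subgroup_M"
  shows "sig x \<in> S"
proof -
  have "x \<in> {x. sig x \<in> S}"
  proof (rule M_least[OF _ _ _ assms])
    show "add_subgroup {x. sig x \<in> S}"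
    proof (rule add_subgroupI)
      fix x y assume "x \<in> {x. sig x \<in> S}" "y \<in> {x. sig x \<in> S}"
      then have xy: "sig x \<in> S" "sig y \<in> S" by auto
      have "sig (x - y) = sig x - sig y - (sig x - sig y - sig (x - y))" by simp
      also have "\<dots> \<in> S" by (intro S_intros(2) xy sig_diff)
      finally show "x - y \<in> {x. sig x \<in> S}" by simp
    qed (use eta_one in simp)
  next
    fix x a :: 'a assume "a \<in> units"
    then obtain b where ab: "a * b = 1" by (auto simp: carrier_unit_group)
    have "sig (x * (a * a - 1)) = (sig (a * a * x) - sig x) - (sig (a * a * x) - sig x - sig (a * a * x - x))"
      by (simp add: right_diff_distrib ac_simps)
    also have "\<dots> \<in> S" by (rule S_intros(2)[OF sig_square[OF ab] sig_diff])
    finally show "x * (a * a - 1) \<in> {x. sig x \<in> S}" by simp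
  next
    fix b c :: 'a assume "b \<in> units" "c \<in> units"
    then obtain b' c' where b: "b * b' = 1" and c: "c * c' = 1" by (auto simp: carrier_unit_group)
    have bc: "(b * c) * (b' * c') = 1"
      using b c by (metis mult.assoc mult.commute mult_1)
    \<comment> \<open>Multiplicativity of \<open>D\<close> is applied at \<open>- b\<close> and
      \<open>- c\<close>: the signs turn the defect 3 (b - 1) (c - 1) into the generator 3 (b + 1)
      (c + 1).\<close>
    have b': "(- b) * (- b') = 1" and c': "(- c) * (- c') = 1" using b c by simp_all
    have e: "(3 * (b * c - 1)) - (3 * (- b - 1) + 3 * (- c - 1)) = 3 * (b + 1) * (c + 1)"
      by (simp add: algebra_simps three_times)
    let ?x = "3 * (- b - 1)" and ?y = "3 * (- c - 1)" and ?z = "3 * (b * c - 1)"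
    let ?m = "eta (D (- b) (- b')) + eta (D (- c) (- c')) - eta (D (- b * - c) (- b' * - c'))"
    have "sig (3 * (b + 1) * (c + 1)) =
       (eta (D (- b) (- b')) - sig ?x) + (eta (D (- c) (- c')) - sig ?y) - (eta (D (b * c) (b' * c')) - sig ?z)
       + (sig ?x + sig ?y - sig (?x + ?y)) - ?m - (sig ?z - sig (?x + ?y) - sig (?z - (?x + ?y)))"
      unfolding e by simp
    also have "\<dots> \<in> S"
      by (intro S_intros(2,4) sig_add sig_diff eta_D_sig eta_D_mult b' c' bc)
    finally show "3 * (b + 1) * (c + 1) \<in> {x. sig x \<in> S}" by simp
  qed
  then show ?thesis by simp
qed

section \<open>Representatives of G/B; every cycle has a class sigma(x)\<close>

definition sec :: "'l \<Rightarrow> 'g" where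
  "sec l = (if l = pt then \<one> else SOME g. g \<in> carrier G \<and> act g pt = l)"

text \<open>This normalisation makes \<open>lam\<close> agree with \<open>chi\<close> on
  \<open>B\<close>, which gives \<open>Psi (sig x) = x\<close>.\<close>

lemma sec_pt [simp]: "sec pt = \<one>"
  by (simp add: sec_def)

lemma sec_closed [simp]: "g \<in> carrier G \<Longrightarrow> sec (act g pt) \<in> carrier G"
  and act_sec [simp]: "g \<in> carrier G \<Longrightarrow> act (sec (act g pt)) pt = act g pt"
proof -
  assume g: "g \<in> carrier G"
  have "sec (act g pt) \<in> carrier G \<and> act (sec (act g pt)) pt = act g pt"
  proof (cases "act g pt = pt")
    case False
    show ?thesis
      using someI_ex[of "\<lambda>h. h \<in> carrier G \<and> act h pt = act g pt"] g False unfolding sec_def by auto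
  qed simp
  then show "sec (act g pt) \<in> carrier G" "act (sec (act g pt)) pt = act g pt" by auto
qed

lemma sec_part:
  assumes "g \<in> carrier G"
  shows "inv (sec (act g pt)) \<otimes> g \<in> B" "sec (act g pt) \<otimes> (inv (sec (act g pt)) \<otimes> g) = g"
  using assms by (auto intro!: same_point simp flip: m_assoc)

definition sig_image :: "(('g list \<Rightarrow>\<^sub>0 int) \<times> ('l list \<Rightarrow>\<^sub>0 int)) set" where
  "sig_image = {v. \<exists>x. v - sig x \<in> S}"

lemma sig_image_subgroup: "add_subgroup sig_image"
proof (rule add_subgroupI)
  show "0 \<in> sig_image"
    unfolding sig_image_def by (rule CollectI, rule exI[of _ 0]) (use eta_one S_intros(3) in simp)
next
  fix v v' assume "v \<in> sig_image" "v' \<in> sig_image"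
  then obtain x y where x: "v - sig x \<in> S" and y: "v' - sig y \<in> S" by (auto simp: sig_image_def)
  have "v - v' - sig (x - y) = (v - sig x) - (v' - sig y) + (sig x - sig y - sig (x - y))" by simp
  also have "\<dots> \<in> S" by (intro S_intros(2,4) x y sig_diff)
  finally show "v - v' \<in> sig_image" by (auto simp: sig_image_def)
qed

lemmas sig_image_intros = add_subgroup_intros[OF sig_image_subgroup]

lemma S_sig_image: "v \<in> S \<Longrightarrow> v \<in> sig_image"
  unfolding sig_image_def by (rule CollectI, rule exI[of _ 0]) (use eta_one S_intros(2) in simp)

lemma kap_sig_image: "kap \<in> sig_image"
  using kap_sig by (auto simp: sig_image_def)

lemma B_cases:
  assumes "b \<in> B"
  obtains a a' x where "a * a' = 1" "b = D a a' \<otimes> U x"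
  using stab[of b] assms by auto

lemma eta_B_sig_image:
  assumes "b \<in> B"
  shows "eta b \<in> sig_image"
  using assms
proof (rule B_cases)
  fix a a' x assume a: "a * a' = 1" and b: "b = D a a' \<otimes> U x"
  have 1: "eta (D a a') \<in> sig_image" using eta_D_sig[OF a] by (auto simp: sig_image_def)
  have 2: "sig x \<in> sig_image" using S_intros(1) by (auto simp: sig_image_def intro!: exI[of _ x])
  have 3: "eta (D a a') + sig x - eta (D a a' \<otimes> U x) \<in> sig_image"
    using a by (intro S_sig_image eta_B) auto
  have "eta b = eta (D a a') + sig x - (eta (D a a') + sig x - eta (D a a' \<otimes> U x))"
    unfolding b by simp
  also have "\<dots> \<in> sig_image" by (intro sig_image_intros(2,4) 1 2 3)
  finally show ?thesis .
qed

lemma eta_sec: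
  assumes "g \<in> carrier G"
  shows "eta g - eta (sec (act g pt)) \<in> sig_image"
proof -
  let ?s = "sec (act g pt)" and ?b = "inv (sec (act g pt)) \<otimes> g"
  have 1: "eta ?s + eta ?b - eta (?s \<otimes> ?b) \<in> sig_image"
    using assms by (intro S_sig_image eta_B sec_part) auto
  have "eta g - eta ?s = eta ?b - (eta ?s + eta ?b - eta (?s \<otimes> ?b))"
    using sec_part(2)[OF assms] by simp
  also have "\<dots> \<in> sig_image"
    by (intro sig_image_intros(2) 1 eta_B_sig_image sec_part assms)
  finally show ?thesis .
qed

text \<open>Adding \<open>eta\<close> of the representatives of the endpoints, with the signs of the
  boundary, corrects each single edge to a class in \<open>sig_image\<close>. The correction is a
  function of the boundary, so it disappears for a cycle.\<close>

lemma cycle_sig: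
  assumes "z \<in> Z1"
  obtains x where "yy z - sig x \<in> S"
proof -
  define \<tau> where "\<tau> = lin_ext (\<lambda>l. eta (sec (hd l)))"
  have \<tau>: "Modules.additive \<tau>" unfolding \<tau>_def by (rule lin_ext_additive)
  have "(\<lambda>c. yy c + \<tau> (bdy c)) z \<in> sig_image"
  proof (rule additive_mem_of_basis[where F = "\<lambda>c. yy c + \<tau> (bdy c)", OF _ sig_image_subgroup])
    show "Modules.additive (\<lambda>c. yy c + \<tau> (bdy c))"
      by (simp add: Modules.additive_def yy_simps frag_extend_add additive.add[OF \<tau>])
    show "chain1 z" using assms by (simp add: Z1_def)
    fix l assume "l \<in> Y1"
    then obtain g where l: "l = edge g" and g: "g \<in> carrier G" by (auto simp: Y1_def)
    have 1: "yy (eg g) - (kap + eta g - eta (g \<otimes> w)) \<in> sig_image"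
      by (intro S_sig_image eta_edge g)
    have 2: "eta (g \<otimes> w) - eta (sec (act (g \<otimes> w) pt)) \<in> sig_image" using g by (intro eta_sec) auto
    have "yy (frag_of l) + \<tau> (bdy (frag_of l)) =
      (yy (eg g) - (kap + eta g - eta (g \<otimes> w))) + kap + (eta g - eta (sec (act g pt)))
      - (eta (g \<otimes> w) - eta (sec (act (g \<otimes> w) pt)))"
      by (simp add: l additive.diff[OF \<tau>]) (simp add: \<tau>_def)
    also have "\<dots> \<in> sig_image"
      by (intro sig_image_intros(2,4) kap_sig_image eta_sec g 1 2)
    finally show "yy (frag_of l) + \<tau> (bdy (frag_of l)) \<in> sig_image" .
  qed
  then show ?thesis
    using assms that additive.zero[OF \<tau>] by (auto simp: Z1_def sig_image_def)
qed

section \<open>The inverse map from X to A/M\<close>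

definition chi :: "'g \<Rightarrow> 'a" where
  "chi g = (SOME y. \<exists>a b x. a * b = 1 \<and> g = D a b \<otimes> U x \<and> y = x + 3 * (a - 1))"

lemma chi_DU [simp]:
  assumes ab: "a * b = 1"
  shows "chi (D a b \<otimes> U x) = x + 3 * (a - 1)"
proof -
  have "\<exists>a' b' x'. a' * b' = 1 \<and> D a b \<otimes> U x = D a' b' \<otimes> U x' \<and> chi (D a b \<otimes> U x) = x' + 3 * (a' - 1)"
    unfolding chi_def by (rule someI_ex) (use ab in blast)
  then show ?thesis using DU_inj[OF ab] by blast
qed

lemma chi_U [simp]: "chi (U x) = x"
  using chi_DU[of 1 1 x] by simp

text \<open>The value is forced by \<open>eta_D_sig\<close>, because \<open>chi\<close> is to invert
  \<open>sig\<close> on \<open>B\<close>.\<close>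

lemma chi_D: "a * b = 1 \<Longrightarrow> chi (D a b) = 3 * (a - 1)"
  using chi_DU[of a b 0] by simp

lemma unitI: "a * b = 1 \<Longrightarrow> a \<in> units"
  by (auto simp: carrier_unit_group)

text \<open>Two obstructions occur, one for each kind of generator of M. Moving \<open>U x\<close>
  past \<open>D d d'\<close> costs x (d'^2 - 1), and 3 (a - 1) is multiplicative only up to
  \<open>M_three_hom\<close>.\<close>

lemma chi_mult:
  assumes "b \<in> B" "c \<in> B"
  shows "chi (b \<otimes> c) - (chi b + chi c) \<in> subgroup_M"
proof -
  obtain a a' x where a: "a * a' = 1" and b: "b = D a a' \<otimes> U x" using assms(1) by (rule B_cases)
  obtain d d' y where d: "d * d' = 1" and c: "c = D d d' \<otimes> U y" using assms(2) by (rule B_cases)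
  have d': "d' * d = 1" using d by (simp add: mult.commute)
  have ad: "(a * d) * (a' * d') = 1" using a d by (metis mult.assoc mult.commute mult_1)
  have "b \<otimes> c = D a a' \<otimes> (U x \<otimes> D d d') \<otimes> U y" using a d by (simp add: b c m_assoc)
  also have "\<dots> = (D a a' \<otimes> D d d') \<otimes> (U (d' * d' * x) \<otimes> U y)"
    using a d by (simp add: U_D m_assoc)
  also have "\<dots> = D (a * d) (a' * d') \<otimes> U (d' * d' * x + y)" using a d by (simp add: D_mult U_add)
  finally have "chi (b \<otimes> c) = d' * d' * x + y + 3 * (a * d - 1)" using ad by simp
  moreover have "chi b = x + 3 * (a - 1)" "chi c = y + 3 * (d - 1)"
    unfolding b c using a d by simp_all
  moreover have "x * (d' * d' - 1) = d' * d' * x - x" by (simp add: right_diff_distrib ac_simps)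
  ultimately have "chi (b \<otimes> c) - (chi b + chi c) =
     x * (d' * d' - 1) + (3 * (a * d - 1) - (3 * (a - 1) + 3 * (d - 1)))"
    by simp
  also have "\<dots> \<in> subgroup_M"
    by (intro M_intros(4) M_square M_three_hom unitI[OF a] unitI[OF d] unitI[OF d'])
  finally show ?thesis .
qed

definition lam :: "'g \<Rightarrow> 'a" where "lam g = chi (inv (sec (act g pt)) \<otimes> g)"

lemma lam_mult:
  assumes "g \<in> carrier G" "b \<in> B"
  shows "lam (g \<otimes> b) - (lam g + chi b) \<in> subgroup_M"
  using chi_mult[OF sec_part(1)[OF assms(1)] assms(2)] assms
  by (simp add: lam_def act_mult_B m_assoc)

text \<open>Split \<open>h\<close> into its representative and its part in \<open>B\<close>. The
  term \<open>lam (g \<otimes> sec (act h pt))\<close> depends on \<open>h\<close> only through its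
  point, so it can be absorbed into a function on vertices, namely \<open>Lam\<close>.\<close>

lemma lam_trans:
  assumes "g \<in> carrier G" "h \<in> carrier G"
  shows "lam (g \<otimes> h) - (lam (g \<otimes> sec (act h pt)) + lam h) \<in> subgroup_M"
  using lam_mult[of "g \<otimes> sec (act h pt)", OF _ sec_part(1)[OF assms(2)]] sec_part(2)[OF assms(2)] assms
  by (simp add: m_assoc lam_def)

text \<open>The constant \<open>3\<close> is the value forced by \<open>kap_sig\<close>.\<close>

definition edge_val :: "'g \<Rightarrow> 'a" where "edge_val g = 3 + lam g - lam (g \<otimes> w)"

text \<open>\<open>inv h \<otimes> g\<close> fixes both endpoints of the standard edge, and
  \<open>stab_edge\<close> identifies the common stabiliser.\<close>

lemma edge_eq:
  assumes g: "g \<in> carrier G" and h: "h \<in> carrier G" and e: "edge g = edge h"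
  obtains a b where "a * b = 1" "g = h \<otimes> D a b"
proof -
  have e: "act g pt = act h pt" "act (g \<otimes> w) pt = act (h \<otimes> w) pt" using e by (auto simp: edge_def)
  have "act (inv h \<otimes> g \<otimes> w) pt = act (inv h) (act (g \<otimes> w) pt)"
    using g h by (simp add: act_act m_assoc)
  also have "\<dots> = act (inv h \<otimes> (h \<otimes> w)) pt"
    unfolding e using h by (simp add: act_act)
  also have "inv h \<otimes> (h \<otimes> w) = w" using h by (simp flip: m_assoc)
  finally have "act (inv h \<otimes> g \<otimes> w) pt = act w pt" .
  moreover have "inv h \<otimes> g \<in> B" using g h e by (intro same_point) auto
  ultimately obtain a b where "a * b = 1" "inv h \<otimes> g = D a b"
    using stab_edge[of "inv h \<otimes> g"] by auto
  then show ?thesis using that g h by (metis D_closed inv_solve_left)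
qed

text \<open>The change is 3 (a - 1) - 3 (b - 1), one term from each endpoint. It lies in M because 3
  (a - 1) is a homomorphism in \<open>a\<close> with values of order at most two.\<close>

lemma edge_val_D:
  assumes g: "g \<in> carrier G" and ab: "a * b = 1"
  shows "edge_val (g \<otimes> D a b) - edge_val g \<in> subgroup_M"
proof -
  have ba: "b * a = 1" using ab by (simp add: mult.commute)
  have "g \<otimes> D a b \<otimes> w = g \<otimes> w \<otimes> D b a" using g ab ba by (simp add: m_assoc D_w)
  then have "edge_val (g \<otimes> D a b) - edge_val g =
     (lam (g \<otimes> D a b) - (lam g + chi (D a b))) - (lam (g \<otimes> w \<otimes> D b a) - (lam (g \<otimes> w) + chi (D b a)))
     + ((3 * (a - 1) + 3 * (a - 1)) + (3 * (a * b - 1) - (3 * (a - 1) + 3 * (b - 1))))"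
    using ab ba by (simp add: edge_val_def chi_D)
  also have "\<dots> \<in> subgroup_M"
    using g ab ba by (intro M_intros(2,4)[OF lam_mult] M_intros(2,4) lam_mult M_three_double M_three_hom
      unitI[OF ab] unitI[OF ba]) auto
  finally show ?thesis .
qed

text \<open>An edge determines \<open>g\<close> only up to \<open>D a b\<close>, so \<open>phi\<close> depends on choices, but not modulo \<open>M\<close>.\<close>

definition phi :: "('l list \<Rightarrow>\<^sub>0 int) \<Rightarrow> 'a" where
  "phi = lin_ext (\<lambda>l. edge_val (SOME g. g \<in> carrier G \<and> edge g = l))"

lemma additive_phi: "Modules.additive phi"
  unfolding phi_def by (rule lin_ext_additive)

lemmas phi_simps = additive.add[OF additive_phi] additive.diff[OF additive_phi]
  additive.minus[OF additive_phi] additive.zero[OF additive_phi]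

lemma phi_edge:
  assumes g: "g \<in> carrier G"
  shows "phi (eg g) - edge_val g \<in> subgroup_M"
proof -
  define h where "h = (SOME h. h \<in> carrier G \<and> edge h = edge g)"
  have h: "h \<in> carrier G" "edge h = edge g"
    using someI[of "\<lambda>h. h \<in> carrier G \<and> edge h = edge g" g] g unfolding h_def by auto
  obtain a b where "a * b = 1" "h = g \<otimes> D a b" using edge_eq[OF h(1) g h(2)] .
  moreover have "phi (eg g) = edge_val h" by (simp add: phi_def h_def)
  ultimately show ?thesis using edge_val_D[OF g] by simp
qed

definition Lam :: "'g \<Rightarrow> ('l list \<Rightarrow>\<^sub>0 int) \<Rightarrow> 'a" where
  "Lam g = lin_ext (\<lambda>l. lam (g \<otimes> sec (hd l)))"

text \<open>By \<open>lam_trans\<close>, translation changes the value of an edge by terms that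
  depend only on its endpoints, and \<open>Lam\<close> records them. On cycles they vanish, so there
  \<open>phi\<close> is invariant modulo M.\<close>

lemma phi_tact:
  assumes g: "g \<in> carrier G" and c: "chain1 c"
  shows "phi (tact g c) - phi c + Lam g (bdy c) \<in> subgroup_M"
proof (rule additive_mem_of_basis[OF _ add_subgroup_M c])
  show "Modules.additive (\<lambda>c. phi (tact g c) - phi c + Lam g (bdy c))"
    by (simp add: Modules.additive_def phi_simps tuple_chain_map_simps frag_extend_add Lam_def lin_ext_add)
  fix l assume "l \<in> Y1"
  then obtain h where l: "l = edge h" and h: "h \<in> carrier G" by (auto simp: Y1_def)
  let ?s = "sec (act h pt)" and ?t = "sec (act (h \<otimes> w) pt)"
  have gh: "g \<otimes> h \<in> carrier G" and hw: "h \<otimes> w \<in> carrier G" using g h by auto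
  have "phi (tact g (frag_of l)) - phi (frag_of l) + Lam g (bdy (frag_of l)) =
     (phi (eg (g \<otimes> h)) - edge_val (g \<otimes> h)) - (phi (eg h) - edge_val h)
     + (lam (g \<otimes> h) - (lam (g \<otimes> ?s) + lam h))
     - (lam (g \<otimes> (h \<otimes> w)) - (lam (g \<otimes> ?t) + lam (h \<otimes> w)))"
    using g h by (simp add: l edge_val_def m_assoc Lam_def lin_ext_diff)
  also have "\<dots> \<in> subgroup_M"
    by (intro M_intros(2,4)[OF M_intros(4)[OF M_intros(2)]] phi_edge lam_trans g h gh hw)
  finally show "phi (tact g (frag_of l)) - phi (frag_of l) + Lam g (bdy (frag_of l)) \<in> subgroup_M" .
qed

text \<open>The computation of \<open>kap_eq\<close> seen through \<open>phi\<close>: the values of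
  \<open>lam\<close> at the three vertices cancel, and the factors in \<open>B\<close> contribute
  through \<open>chi\<close>.\<close>

lemma phi_tri:
  assumes g: "g \<in> carrier G" and ab: "a * b = 1"
  shows "phi (Y_boundary (tri g a)) \<in> subgroup_M"
proof -
  have ba: "(- b) * (- a) = 1" "b * a = 1" using ab by (simp_all add: mult.commute)
  let ?d = "D (- b) (- a) \<otimes> U (- a)"
  have dB: "?d \<in> B" using ba by (intro mult_B) auto
  have e0: "g \<otimes> w \<otimes> U (- a) \<otimes> w = g \<otimes> V a \<otimes> D (- 1) (- 1)"
  proof -
    have "w \<otimes> U (- a) \<otimes> w = V a \<otimes> D (- 1) (- 1)"
      unfolding V_def by (simp add: m_assoc flip: w_w) (simp flip: m_assoc)
    then show ?thesis using g by (simp add: m_assoc)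
  qed
  have e1: "g \<otimes> U b \<otimes> w = g \<otimes> V a \<otimes> ?d"
    using U_w[OF ab] ba g by (simp add: m_assoc V_def)
  have gw: "g \<otimes> w \<in> carrier G" and gV: "g \<otimes> V a \<in> carrier G" and gwU: "g \<otimes> w \<otimes> U (- a) \<in> carrier G"
    and gU: "g \<otimes> U b \<in> carrier G" using g by auto
  have chi_d: "chi ?d = - a + 3 * (- b - 1)" using ba by simp
  have chi_m: "chi (D (- 1) (- 1)) = 3 * (- 1 - 1)" by (rule chi_D) simp
  have s: "a - b \<in> subgroup_M"
  proof -
    have "a - b = b * (a * a - 1)" using ab by (simp add: right_diff_distrib mult.left_commute mult.commute)
    then show ?thesis using M_square[OF unitI[OF ab]] by simp
  qed
  \<comment> \<open>The left side is 6 - 2 a - 4 b. Modulo M one has a = b and 6 (a - 1) =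
    0.\<close>
  have r: "- a - (3 * (- 1 - 1)) - b + (- a + 3 * (- b - 1)) + 3 =
     (a - b) + (a - b) + (a - b) + (a - b) - (3 * (a - 1) + 3 * (a - 1))"
    by (simp add: three_times three_times[unfolded mult.commute[of 3]] algebra_simps)
  have "phi (Y_boundary (tri g a)) =
      (phi (eg (g \<otimes> w \<otimes> U (- a))) - edge_val (g \<otimes> w \<otimes> U (- a)))
    - (phi (eg (g \<otimes> U b)) - edge_val (g \<otimes> U b))
    + (phi (eg g) - edge_val g)
    + (lam (g \<otimes> w \<otimes> U (- a)) - (lam (g \<otimes> w) + chi (U (- a))))
    - (lam (g \<otimes> V a \<otimes> D (- 1) (- 1)) - (lam (g \<otimes> V a) + chi (D (- 1) (- 1))))
    - (lam (g \<otimes> U b) - (lam g + chi (U b)))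
    + (lam (g \<otimes> V a \<otimes> ?d) - (lam (g \<otimes> V a) + chi ?d))
    + (- a - (3 * (- 1 - 1)) - b + (- a + 3 * (- b - 1)) + 3)"
    unfolding Y_boundary_tri[OF g ab] phi_simps edge_val_def e0 e1 chi_d chi_m chi_U
    by (simp only: algebra_simps)
  also have "\<dots> \<in> subgroup_M"
    unfolding r
    by (intro M_intros(2,4) phi_edge lam_mult M_three_double s unitI[OF ab] gw gV gwU gU g dB U_B D_minus_one_B)
  finally show ?thesis .
qed

lemma phi_N:
  assumes "n \<in> N"
  shows "phi n \<in> subgroup_M"
proof -
  have "N \<subseteq> {z. phi z \<in> subgroup_M}"
  proof (rule N_least)
    show "add_subgroup {z. phi z \<in> subgroup_M}"
      by (rule add_subgroupI) (auto simp: phi_simps intro: M_intros)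
    have "phi (bdy c) \<in> subgroup_M" if c: "supported c Y2" for c
    proof (rule additive_mem_of_basis[where F = "\<lambda>c. phi (bdy c)", OF _ add_subgroup_M c])
      show "Modules.additive (\<lambda>c. phi (bdy c))"
        by (rule additive_comp[OF additive_phi additive_frag_extend])
    qed (auto simp: Y2_def carrier_unit_group phi_tri)
    then show "B1 \<subseteq> {z. phi z \<in> subgroup_M}" by (auto simp: B1_def)
  next
    fix g z assume g: "g \<in> carrier G" and z: "z \<in> Z1"
    then have "phi (tact g z) - phi z \<in> subgroup_M"
      using phi_tact[of g z] by (simp add: Z1_def Lam_def)
    then show "tact g z - z \<in> {z. phi z \<in> subgroup_M}" by (simp add: phi_simps)
  qed
  then show ?thesis using assms by auto
qed

text \<open>The term \<open>phi (path g)\<close> compensates the path removed in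
  \<open>eta g\<close>, so that \<open>Psi (eta g)\<close> is \<open>lam g\<close>.\<close>

definition Psi :: "(('g list \<Rightarrow>\<^sub>0 int) \<times> ('l list \<Rightarrow>\<^sub>0 int)) \<Rightarrow> 'a" where
  "Psi v = lin_ext (\<lambda>gs. lam (hd gs) + phi (path (hd gs))) (fst v) + phi (snd v)"

lemma additive_Psi: "Modules.additive Psi"
  by (simp add: Modules.additive_def Psi_def lin_ext_add phi_simps)

text \<open>On [g|h] the change of \<open>phi\<close> along the translated path of \<open>h\<close>,
  given by \<open>phi_tact\<close>, matches the failure of \<open>lam\<close> to be additive, given
  by \<open>lam_trans\<close>.\<close>

lemma Psi_S:
  assumes "v \<in> S"
  shows "Psi v \<in> subgroup_M"
proof -
  obtain c n where v: "v = (bar_bdy c, n - alpha c)" and c: "supported c (bar_basis G 2)" and n: "n \<in> N"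
    using assms by (auto simp: S_def)
  have "Psi (bar_bdy c, - alpha c) \<in> subgroup_M"
  proof (rule additive_mem_of_basis[where F = "\<lambda>c. Psi (bar_bdy c, - alpha c)", OF _ add_subgroup_M c])
    show "Modules.additive (\<lambda>c. Psi (bar_bdy c, - alpha c))"
      by (simp add: Modules.additive_def Psi_def lin_ext_add phi_simps frag_extend_add alpha_simps)
    fix gs assume "gs \<in> bar_basis G 2"
    then obtain g h where gs: "gs = [g, h]" and g: "g \<in> carrier G" and h: "h \<in> carrier G"
      by (auto simp: bar_basis_2)
    have 1: "phi (tact g (path h)) - phi (path h) + (lam (g \<otimes> sec (act h pt)) - lam g) \<in> subgroup_M"
      using phi_tact[OF g path_chain1[OF h]] g h by (simp add: Lam_def lin_ext_diff)
    have "Psi (bar_bdy (frag_of gs), - alpha (frag_of gs)) =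
       - (phi (tact g (path h)) - phi (path h) + (lam (g \<otimes> sec (act h pt)) - lam g))
       - (lam (g \<otimes> h) - (lam (g \<otimes> sec (act h pt)) + lam h))"
      by (simp add: gs Psi_def bar_boundary_2 lin_ext_add lin_ext_diff phi_simps)
    also have "\<dots> \<in> subgroup_M"
      by (intro M_intros(2) M_intros(3)[OF 1] lam_trans g h)
    finally show "Psi (bar_bdy (frag_of gs), - alpha (frag_of gs)) \<in> subgroup_M" .
  qed
  moreover have "Psi v = Psi (bar_bdy c, - alpha c) + phi n"
    by (simp add: v Psi_def phi_simps)
  ultimately show ?thesis using phi_N[OF n] by (auto intro: M_intros)
qed

lemma Psi_yy [simp]: "Psi (yy z) = phi z"
  by (simp add: Psi_def yy_def)

lemma Psi_sig [simp]: "Psi (sig x) = x"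
  by (simp add: Psi_def eta_def br_def yy_def phi_simps lam_def)

lemma phi_sig:
  assumes "yy z - sig x \<in> S"
  shows "phi z - x \<in> subgroup_M"
  using Psi_S[OF assms] by (simp add: additive.diff[OF additive_Psi])

text \<open>With its converse \<open>phi_sig\<close> this is the isomorphism of X with A/M on
  classes of cycles: z represents sigma(x) exactly if \<open>phi z\<close> equals x modulo M.
  Exactness at the two middle terms follows by comparing components of \<open>S\<close>.\<close>

lemma sig_phi:
  assumes "z \<in> Z1" "phi z - x \<in> subgroup_M"
  shows "yy z - sig x \<in> S"
proof -
  obtain y where y: "yy z - sig y \<in> S" using cycle_sig[OF assms(1)] .
  have "phi z - x - (phi z - y) \<in> subgroup_M" by (intro M_intros(2) assms(2) phi_sig y)
  then have yx: "sig (y - x) \<in> S" by (intro sig_M) simp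
  have "yy z - sig x = (yy z - sig y) + (sig y - sig x - sig (y - x)) + sig (y - x)" by simp
  also have "\<dots> \<in> S" by (intro S_intros(4) y sig_diff yx)
  finally show ?thesis .
qed

section \<open>Exactness on the level of chains\<close>

lemma alpha_surj:
  assumes "z \<in> Z1" "phi z \<in> subgroup_M"
  obtains c where "supported c (bar_basis G 2)" "bar_bdy c = 0" "z - alpha c \<in> N"
proof -
  have "yy z - sig 0 \<in> S" using assms by (intro sig_phi) auto
  then have "yy z - sig 0 + sig 0 \<in> S" using eta_one by (intro S_intros(4)) auto
  then have "yy z \<in> S" by simp
  then obtain c n where c: "0 = bar_bdy c" "z = n - alpha c" "supported c (bar_basis G 2)" "n \<in> N"
    by (auto simp: S_def yy_def)
  \<comment> \<open>The sign changes because elements of \<open>S\<close> carry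
    \<open>- alpha c\<close> in the second component.\<close>
  then show ?thesis
    using that[of "- c"] by (simp add: frag_extend_minus alpha_simps)
qed

lemma phi_alpha:
  assumes "supported c (bar_basis G 2)" "bar_bdy c = 0"
  shows "phi (alpha c) \<in> subgroup_M"
proof -
  have "yy (- alpha c) \<in> S"
    unfolding S_def yy_def using assms N_intros(1)
    by (intro CollectI exI[of _ c] exI[of _ 0]) simp
  then have "Psi (yy (- alpha c)) \<in> subgroup_M" by (rule Psi_S)
  then have "- phi (alpha c) \<in> subgroup_M" unfolding Psi_yy phi_simps .
  then show ?thesis using M_intros(3) by fastforce
qed

text \<open>The first component of \<open>sig_phi\<close>: sigma of \<open>phi z\<close> comes from
  a cycle of Y, so its image in H_1(E) is zero.\<close>

lemma bar_phi:
  assumes "z \<in> Z1"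
  obtains c where "supported c (bar_basis G 2)" "frag_of [U (phi z)] = bar_bdy c"
proof -
  have "yy z - sig (phi z) \<in> S" using assms M_intros(1) by (intro sig_phi) auto
  then obtain c n where c: "- frag_of [U (phi z)] = bar_bdy c" "supported c (bar_basis G 2)"
    by (auto simp: S_def yy_def eta_def br_def)
  then show ?thesis using that[of "- c"] by (metis frag_extend_minus keys_minus minus_minus)
qed

lemma phi_surj:
  assumes "supported c (bar_basis G 2)" "frag_of [U x] = bar_bdy c"
  obtains z where "z \<in> Z1" "phi z - x \<in> subgroup_M"
proof
  \<comment> \<open>The witness is forced: subtracting the relation
    \<open>(bar_bdy c, - alpha c)\<close> from \<open>sig (U x)\<close>-type data must leave a pure
    Y-chain, and the path inside \<open>sig x\<close> supplies the second term.\<close>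
  show "alpha c - path (U x) \<in> Z1"
    by (intro add_subgroup_diff[OF Z1_subgroup] alpha_Z1 assms(1) path_Z1) simp
  have "sig x - yy (alpha c - path (U x)) = (bar_bdy c, 0 - alpha c)"
    by (simp add: eta_def br_def yy_def assms(2))
  also have "\<dots> \<in> S" unfolding S_def using assms(1) N_intros(1) by blast
  finally have "- (sig x - yy (alpha c - path (U x))) \<in> S" by (rule S_intros(3))
  then show "phi (alpha c - path (U x)) - x \<in> subgroup_M" by (intro phi_sig) simp
qed

section \<open>The first homology of the group\<close>

definition D1 :: "('g list \<Rightarrow>\<^sub>0 int) set" where
  "D1 = bar_bdy ` {c. supported c (bar_basis G 2)}"

lemma D1_subgroup: "add_subgroup D1"
proof (rule add_subgroupI)
  show "0 \<in> D1" unfolding D1_def by (rule image_eqI[of _ _ 0]) auto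
next
  fix x y assume "x \<in> D1" "y \<in> D1"
  then obtain c c' where "x = bar_bdy c" "y = bar_bdy c'" "supported c (bar_basis G 2)"
     "supported c' (bar_basis G 2)"
    by (auto simp: D1_def)
  then show "x - y \<in> D1"
    unfolding D1_def using keys_diff[of c c']
    by (intro image_eqI[of _ _ "c - c'"]) (auto simp: frag_extend_diff)
qed

lemmas D1_intros = add_subgroup_intros[OF D1_subgroup]

text \<open>The first component is the projection from X to H_1(E), so each relation proved in X
  yields one in H_1(E).\<close>

lemma fst_S: "v \<in> S \<Longrightarrow> fst v \<in> D1"
  by (auto simp: S_def D1_def)

lemma D1_mult:
  assumes "g \<in> carrier G" "h \<in> carrier G"
  shows "frag_of [g] + frag_of [h] - frag_of [g \<otimes> h] \<in> D1"
  using fst_S[OF eta_mult[OF assms]] by (simp add: eta_def br_def yy_def)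

text \<open>This is what makes the map from A/M to H_1(E) well defined.\<close>

lemma D1_U_M: "x \<in> subgroup_M \<Longrightarrow> frag_of [U x] \<in> D1"
  using fst_S[OF sig_M] by (simp add: eta_def br_def yy_def)

lemma D1_U_add: "frag_of [U (x + y)] - (frag_of [U x] + frag_of [U y]) \<in> D1"
  using D1_intros(3)[OF D1_mult[of "U x" "U y"]] by (simp add: U_add algebra_simps)

lemma D1_surj:
  assumes "supported k (bar_basis G 1)"
  obtains x where "k - frag_of [U x] \<in> D1"
proof -
  let ?T = "{k. \<exists>x. k - frag_of [U x] \<in> D1}"
  have oneD: "frag_of [\<one>] \<in> D1" using D1_mult[of \<one> \<one>] by simp
  have T: "add_subgroup ?T"
  proof (rule add_subgroupI)
    show "0 \<in> ?T" by (rule CollectI, rule exI[of _ 0]) (use oneD D1_intros(3) in simp)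
  next
    fix k l assume "k \<in> ?T" "l \<in> ?T"
    then obtain x y where xy: "k - frag_of [U x] \<in> D1" "l - frag_of [U y] \<in> D1" by auto
    have "k - l - frag_of [U (x - y)] = (k - frag_of [U x]) - (l - frag_of [U y])
       + (frag_of [U (x - y + y)] - (frag_of [U (x - y)] + frag_of [U y]))"
      by simp
    also have "\<dots> \<in> D1" by (intro D1_intros(2,4) xy D1_U_add)
    finally show "k - l \<in> ?T" by auto
  qed
  have DT: "d \<in> ?T" if "d \<in> D1" for d
    by (rule CollectI, rule exI[of _ 0]) (use oneD that D1_intros(2) in simp)
  note T_intros = add_subgroup_intros[OF T]
  have UT: "frag_of [U x] \<in> ?T" for x
    using D1_intros(1) by (intro CollectI exI[of _ x]) simp
  \<comment> \<open>The first component of \<open>kap_sig\<close> says that \<open>w\<close> and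
    \<open>U 3\<close> have the same class in H_1(E).\<close>
  have wT: "frag_of [w] \<in> ?T"
    using fst_S[OF kap_sig] by (intro CollectI exI[of _ 3]) (simp add: kap_def eta_def br_def yy_def)
  have invT: "frag_of [inv g] \<in> ?T" if "g \<in> carrier G" "frag_of [g] \<in> ?T" for g
  proof -
    have "frag_of [inv g] = (frag_of [inv g] + frag_of [g] - frag_of [inv g \<otimes> g]) + frag_of [\<one>] - frag_of [g]"
      using that by simp
    also have "\<dots> \<in> ?T"
      by (rule T_intros(2)[OF T_intros(4)[OF DT[OF D1_mult] DT[OF oneD]] that(2)]) (use that in auto)
    finally show ?thesis .
  qed
  have "frag_of [g] \<in> ?T" if "g \<in> generate G (range U \<union> {w})" for g
    using that
  proof (induction rule: generate.induct)
    case one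
    then show ?case using DT oneD by blast
  next
    case (incl h)
    then have "h = w \<or> (\<exists>x. h = U x)" by auto
    then show ?case using UT wT by blast
  next
    case (inv h)
    then have "h = w \<or> (\<exists>x. h = U x)" by auto
    then have "h \<in> carrier G" "frag_of [h] \<in> ?T" using UT wT by auto
    then show ?case by (rule invT)
  next
    case (eng h1 h2)
    have h: "h1 \<in> carrier G" "h2 \<in> carrier G" using eng.hyps by (simp_all only: gen)
    have "frag_of [h1 \<otimes> h2] = frag_of [h1] + frag_of [h2] - (frag_of [h1] + frag_of [h2] - frag_of [h1 \<otimes> h2])"
      by simp
    also have "\<dots> \<in> ?T" by (rule T_intros(2)[OF T_intros(4)[OF eng.IH] DT[OF D1_mult[OF h]]])
    finally show ?case .
  qed
  then have "frag_of gs \<in> ?T" if "gs \<in> bar_basis G 1" for gs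
    using that unfolding gen[symmetric] by (auto simp: bar_basis_def length_Suc_conv)
  then have "k \<in> ?T"
    using additive_mem_of_basis[where F = "\<lambda>k. k" and S = ?T, OF _ T assms] by (auto simp: Modules.additive_def)
  then show ?thesis using that by auto
qed

end

section \<open>The bar complex and conjugation\<close>

lemma map_bar_basis:
  "f \<in> hom G H \<Longrightarrow> gs \<in> bar_basis G n \<Longrightarrow> map f gs \<in> bar_basis H n"
  by (auto simp: bar_basis_def hom_def)

lemma bar_boundary_map:
  assumes f: "f \<in> hom G H" and gs: "gs \<in> bar_basis G n"
  shows "bar_boundary H (map f gs) = tuple_chain_map f (bar_boundary G gs)"
proof -
  have face: "bar_face H i (map f gs) = map f (bar_face G i gs)" if "i \<le> length gs" for i
  proof (cases "i = 0 \<or> i = length gs")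
    case False
    then have "i - 1 < length gs" using that by auto
    then have "map f gs ! (i - Suc 0) = f (gs ! (i - Suc 0))" by simp
    moreover
    have "gs ! (i - 1) \<in> carrier G" "gs ! i \<in> carrier G"
      using gs that False by (auto simp: bar_basis_def intro!: subsetD[OF _ nth_mem])
    then have "f (gs ! (i - 1) \<otimes>\<^bsub>G\<^esub> gs ! i) = f (gs ! (i - 1)) \<otimes>\<^bsub>H\<^esub> f (gs ! i)"
      using f by (simp add: hom_def)
    ultimately show ?thesis
      using False that by (simp add: bar_face_def take_map drop_map nth_map)
  qed (auto simp: bar_face_def map_tl map_butlast)
  show ?thesis
    by (simp add: bar_boundary_def face tuple_chain_map_def frag_extend_cmul
        additive.sum[OF additive_frag_extend])
qed

lemma bar_boundary_1: "bar_boundary G [g] = 0"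
  by (simp add: bar_boundary_def bar_face_def)

lemma bar_boundary_3:
  "bar_boundary G [g, h, k] =
     frag_of [h, k] - frag_of [g \<otimes>\<^bsub>G\<^esub> h, k] + frag_of [g, h \<otimes>\<^bsub>G\<^esub> k] - frag_of [g, h]"
  by (simp add: bar_boundary_def bar_face_def numeral_3_eq_3)

lemma bar_basis_1: "bar_basis G (Suc 0) = {[g] | g. g \<in> carrier G}"
  by (auto simp: bar_basis_def length_Suc_conv)

lemma bar_basis_3:
  "bar_basis G 3 = {[g, h, k] | g h k. g \<in> carrier G \<and> h \<in> carrier G \<and> k \<in> carrier G}"
  by (auto simp: bar_basis_def numeral_3_eq_3 length_Suc_conv)

lemma cycles_bar_1: "cycles (bar_basis G) (bar_boundary G) 1 = {c. supported c (bar_basis G 1)}"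
proof -
  have "frag_extend (bar_boundary G) c = 0" if "supported c (bar_basis G 1)" for c
    using that by (intro frag_extend_eq_0) (auto simp: bar_basis_1 bar_boundary_1)
  then show ?thesis by (auto simp: cycles_def)
qed

lemma (in group) boundaries_bar_1: "boundaries (bar_basis G) (bar_boundary G) 1 \<subseteq> cycles (bar_basis G) (bar_boundary G) 1"
proof -
  have "frag_extend (bar_boundary G) c \<in> {c. supported c (bar_basis G 1)}"
    if c: "supported c (bar_basis G 2)" for c
  proof (rule additive_mem_of_basis[OF additive_frag_extend add_subgroup_keys c])
    fix gs assume "gs \<in> bar_basis G 2"
    then obtain g h where gs: "gs = [g, h]" "g \<in> carrier G" "h \<in> carrier G" by (auto simp: bar_basis_2)
    have "frag_of [h] - frag_of [g \<otimes> h] + frag_of [g] \<in> {c. supported c (bar_basis G 1)}"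
      by (intro add_subgroup_diff[OF add_subgroup_keys] add_subgroup_add[OF add_subgroup_keys])
         (use gs in \<open>auto simp: bar_basis_1\<close>)
    then show "frag_extend (bar_boundary G) (frag_of gs) \<in> {c. supported c (bar_basis G 1)}"
      by (simp add: gs bar_boundary_2)
  qed
  note sub = this
  show ?thesis
  proof
    fix x assume "x \<in> boundaries (bar_basis G) (bar_boundary G) 1"
    then obtain c where "supported c (bar_basis G 2)" "x = frag_extend (bar_boundary G) c"
      by (auto simp: boundaries_def numeral_2_eq_2)
    then show "x \<in> cycles (bar_basis G) (bar_boundary G) 1"
      unfolding cycles_bar_1 using sub by blast
  qed
qed

lemma (in group) boundaries_bar_2: "boundaries (bar_basis G) (bar_boundary G) 2 \<subseteq> cycles (bar_basis G) (bar_boundary G) 2"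
proof -
  have "frag_extend (bar_boundary G) c \<in> cycles (bar_basis G) (bar_boundary G) 2"
    if c: "supported c (bar_basis G 3)" for c
  proof (rule additive_mem_of_basis[OF additive_frag_extend cycles_subgroup c])
    fix gs assume "gs \<in> bar_basis G 3"
    then obtain g h k where gs: "gs = [g, h, k]" "g \<in> carrier G" "h \<in> carrier G" "k \<in> carrier G"
      by (auto simp: bar_basis_3)
    have "frag_of [h, k] - frag_of [g \<otimes> h, k] + frag_of [g, h \<otimes> k] - frag_of [g, h]
        \<in> {c. supported c (bar_basis G 2)}"
      by (intro add_subgroup_diff[OF add_subgroup_keys] add_subgroup_add[OF add_subgroup_keys])
         (use gs in \<open>auto simp: bar_basis_2\<close>)
    then show "frag_extend (bar_boundary G) (frag_of gs) \<in> cycles (bar_basis G) (bar_boundary G) 2"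
      using gs by (simp add: cycles_def bar_boundary_3 bar_boundary_2 frag_extend_add frag_extend_diff m_assoc)
  qed
  moreover have "Suc 2 = (3 :: nat)" by simp
  ultimately show ?thesis by (auto simp only: boundaries_def carrier_free_Abelian_group_iff)
qed

section \<open>Inner automorphisms act trivially on homology\<close>

context group
begin

text \<open>With \<open>conj_homotopy2\<close>, the prism operators of the chain homotopy between
  the identity and conjugation by \<open>a\<close>, in degrees 1 and 2.\<close>

definition conj_homotopy1 :: "'a \<Rightarrow> ('a list \<Rightarrow>\<^sub>0 int) \<Rightarrow> ('a list \<Rightarrow>\<^sub>0 int)" where
  "conj_homotopy1 a = frag_extend (\<lambda>gs. frag_of [a, gs ! 0] - frag_of [a \<otimes> gs ! 0 \<otimes> inv a, a])"

definition conj_homotopy2 :: "'a \<Rightarrow> ('a list \<Rightarrow>\<^sub>0 int) \<Rightarrow> ('a list \<Rightarrow>\<^sub>0 int)" where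
  "conj_homotopy2 a = frag_extend (\<lambda>gs. frag_of [a, gs ! 0, gs ! 1] -
     frag_of [a \<otimes> gs ! 0 \<otimes> inv a, a, gs ! 1] +
     frag_of [a \<otimes> gs ! 0 \<otimes> inv a, a \<otimes> gs ! 1 \<otimes> inv a, a])"

lemma conj_cancel:
  assumes "a \<in> carrier G" "x \<in> carrier G" "y \<in> carrier G"
  shows "a \<otimes> x \<otimes> inv a \<otimes> a = a \<otimes> x"
    "a \<otimes> x \<otimes> inv a \<otimes> (a \<otimes> y \<otimes> inv a) = a \<otimes> (x \<otimes> y) \<otimes> inv a"
proof -
  have "inv a \<otimes> (a \<otimes> (y \<otimes> inv a)) = y \<otimes> inv a" using assms by (simp flip: m_assoc)
  then show "a \<otimes> x \<otimes> inv a \<otimes> a = a \<otimes> x"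
    "a \<otimes> x \<otimes> inv a \<otimes> (a \<otimes> y \<otimes> inv a) = a \<otimes> (x \<otimes> y) \<otimes> inv a"
    using assms by (simp_all add: m_assoc)
qed

lemma conj_hom: "a \<in> carrier G \<Longrightarrow> (\<lambda>x. a \<otimes> x \<otimes> inv a) \<in> hom G G"
  by (rule homI) (auto simp: conj_cancel)

lemma conj_trivial_1:
  assumes a: "a \<in> carrier G" and c: "supported c (bar_basis G 1)"
  shows "tuple_chain_map (\<lambda>x. a \<otimes> x \<otimes> inv a) c - c \<in> boundaries (bar_basis G) (bar_boundary G) 1"
proof (rule additive_mem_of_basis[where F = "\<lambda>c. tuple_chain_map (\<lambda>x. a \<otimes> x \<otimes> inv a) c - c",
      OF _ boundaries_subgroup c])
  show "Modules.additive (\<lambda>c. tuple_chain_map (\<lambda>x. a \<otimes> x \<otimes> inv a) c - c)"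
    by (simp add: Modules.additive_def tuple_chain_map_simps)
  fix gs assume "gs \<in> bar_basis G 1"
  then obtain x where gs: "gs = [x]" "x \<in> carrier G" by (auto simp: bar_basis_1)
  let ?k = "frag_of [a \<otimes> x \<otimes> inv a, a] - frag_of [a, x]"
  have "?k \<in> {c. supported c (bar_basis G 2)}"
    by (intro add_subgroup_diff[OF add_subgroup_keys]) (use gs a in \<open>auto simp: bar_basis_2\<close>)
  then show "tuple_chain_map (\<lambda>x. a \<otimes> x \<otimes> inv a) (frag_of gs) - frag_of gs
      \<in> boundaries (bar_basis G) (bar_boundary G) 1"
    unfolding boundaries_def using gs a
    by (intro image_eqI[of _ _ ?k]) (auto simp: bar_boundary_2 frag_extend_diff conj_cancel numeral_2_eq_2)
qed

lemma conj_trivial_2: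
  assumes a: "a \<in> carrier G" and c: "c \<in> cycles (bar_basis G) (bar_boundary G) 2"
  shows "tuple_chain_map (\<lambda>x. a \<otimes> x \<otimes> inv a) c - c \<in> boundaries (bar_basis G) (bar_boundary G) 2"
proof -
  let ?\<theta> = "tuple_chain_map (\<lambda>x. a \<otimes> x \<otimes> inv a)"
  have add: "Modules.additive (conj_homotopy1 a)" "Modules.additive (conj_homotopy2 a)"
    unfolding conj_homotopy1_def conj_homotopy2_def by (rule additive_frag_extend)+
  have c2: "supported c (bar_basis G 2)" using c by (simp add: cycles_def)
  have "frag_extend (bar_boundary G) (conj_homotopy2 a c) + conj_homotopy1 a (frag_extend (bar_boundary G) c)
      = c - ?\<theta> c"
  proof (rule additive_eq_of_basis[where F = "\<lambda>c. frag_extend (bar_boundary G) (conj_homotopy2 a c) + conj_homotopy1 a (frag_extend (bar_boundary G) c)"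
        and F' = "\<lambda>c. c - ?\<theta> c", OF _ _ c2])
    fix gs assume "gs \<in> bar_basis G 2"
    then obtain x y where gs: "gs = [x, y]" "x \<in> carrier G" "y \<in> carrier G" by (auto simp: bar_basis_2)
    then show "frag_extend (bar_boundary G) (conj_homotopy2 a (frag_of gs)) +
        conj_homotopy1 a (frag_extend (bar_boundary G) (frag_of gs)) = frag_of gs - ?\<theta> (frag_of gs)"
      using a by (simp add: bar_boundary_2 additive.add[OF add(1)] additive.diff[OF add(1)])
        (simp add: conj_homotopy1_def conj_homotopy2_def bar_boundary_3 frag_extend_add frag_extend_diff conj_cancel)
  qed (simp_all add: Modules.additive_def frag_extend_add additive.add[OF add(1)] additive.add[OF add(2)]
      tuple_chain_map_simps)
  moreover have "frag_extend (bar_boundary G) c = 0" using c by (simp add: cycles_def)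
  ultimately have "frag_extend (bar_boundary G) (- conj_homotopy2 a c) = ?\<theta> c - c"
    by (simp add: additive.zero[OF add(1)] frag_extend_minus)
  moreover have "conj_homotopy2 a c \<in> {c. supported c (bar_basis G 3)}"
  proof (rule additive_mem_of_basis[OF add(2) add_subgroup_keys c2])
    fix gs assume "gs \<in> bar_basis G 2"
    then obtain x y where gs: "gs = [x, y]" "x \<in> carrier G" "y \<in> carrier G" by (auto simp: bar_basis_2)
    have "frag_of [a, x, y] - frag_of [a \<otimes> x \<otimes> inv a, a, y] + frag_of [a \<otimes> x \<otimes> inv a, a \<otimes> y \<otimes> inv a, a]
        \<in> {c. supported c (bar_basis G 3)}"
      by (intro add_subgroup_diff[OF add_subgroup_keys] add_subgroup_add[OF add_subgroup_keys])
         (use gs a in \<open>auto simp: bar_basis_3\<close>)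
    then show "conj_homotopy2 a (frag_of gs) \<in> {c. supported c (bar_basis G 3)}"
      by (simp add: conj_homotopy2_def gs)
  qed
  ultimately show ?thesis
    unfolding boundaries_def
    by (intro image_eqI[of _ _ "- conj_homotopy2 a c"]) (auto simp: numeral_2_eq_2 numeral_3_eq_3)
qed

end

text \<open>On [g|h|k] everything cancels except \<open>alpha\<close> of [h|k] minus its translate
  by \<open>g\<close>, and that is a coinvariant relation because \<open>alpha\<close> of [h|k] is a
  cycle. Hence \<open>alpha\<close> descends to H_2.\<close>

lemma (in elementary_action) alpha_boundary:
  assumes "supported c (bar_basis G 3)"
  shows "alpha (bar_bdy c) \<in> N"
proof (rule additive_mem_of_basis[where F = "\<lambda>c. alpha (bar_bdy c)", OF _ N_subgroup assms])
  show "Modules.additive (\<lambda>c. alpha (bar_bdy c))"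
    by (rule additive_comp[OF additive_alpha additive_frag_extend])
  fix gs assume "gs \<in> bar_basis G 3"
  then obtain g h k where gs: "gs = [g, h, k]" and g: "g \<in> carrier G" and h: "h \<in> carrier G" and k: "k \<in> carrier G"
    by (auto simp: bar_basis_3)
  have hk: "alpha (frag_of [h, k]) \<in> Z1"
    by (rule alpha_Z1) (use h k in \<open>auto simp: bar_basis_2\<close>)
  have "tact g (tact h (path k)) = tact (g \<otimes> h) (path k)"
    unfolding tuple_chain_map_compose using path_chain1[OF k]
    by (rule tuple_chain_map_cong) (use g h in \<open>auto simp: Y1_def edge_def act_act m_assoc\<close>)
  then have "alpha (bar_bdy (frag_of gs)) = - (tact g (alpha (frag_of [h, k])) - alpha (frag_of [h, k]))"
    using g h k
    by (simp add: gs bar_boundary_3 alpha_simps tuple_chain_map_simps m_assoc)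
  also have "\<dots> \<in> N" by (intro N_intros(3) tact_N g hk)
  finally show "alpha (bar_bdy (frag_of gs)) \<in> N" .
qed

text \<open>Models diag(u, 1), which normalises the group but need not lie in it: \<theta> is
  conjugation by it and \<delta> its action on lines.\<close>

locale elementary_twist = elementary_action G act pt U D w
  for G :: "('g, 'x) monoid_scheme" (structure) and act :: "'g \<Rightarrow> 'l \<Rightarrow> 'l" and pt :: 'l
    and U :: "'a::comm_ring_unit \<Rightarrow> 'g" and D :: "'a \<Rightarrow> 'a \<Rightarrow> 'g" and w :: 'g +
  fixes \<theta> :: "'g \<Rightarrow> 'g" and \<delta> :: "'l \<Rightarrow> 'l" and u v :: 'a
  assumes uv: "u * v = 1"
    and \<theta>_hom: "\<theta> \<in> hom G G"
    and \<delta>_act: "g \<in> carrier G \<Longrightarrow> \<delta> (act g pt) = act (\<theta> g) pt"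
    and \<theta>_U: "\<theta> (U x) = U (u * x)"
    and \<theta>_w: "\<theta> w = w \<otimes> D v u"
begin

lemma vu: "v * u = 1"
  using uv by (simp add: mult.commute)

lemma \<theta>_closed [simp]: "g \<in> carrier G \<Longrightarrow> \<theta> g \<in> carrier G"
  and \<theta>_mult: "g \<in> carrier G \<Longrightarrow> h \<in> carrier G \<Longrightarrow> \<theta> (g \<otimes> h) = \<theta> g \<otimes> \<theta> h"
  using \<theta>_hom by (auto simp: hom_def)

lemma \<theta>_inv: "g \<in> carrier G \<Longrightarrow> \<theta> (inv g) = inv (\<theta> g)"
  using group_hom.hom_inv[of G G \<theta> g] \<theta>_hom by (simp add: group_hom_def group_hom_axioms_def)

lemma \<theta>_one [simp]: "\<theta> \<one> = \<one>"
  using \<theta>_U[of 0] by simp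

lemma \<delta>_pt [simp]: "\<delta> pt = pt"
  using \<delta>_act[of \<one>] by simp

lemma act_\<theta>_w: "g \<in> carrier G \<Longrightarrow> act (\<theta> (g \<otimes> w)) pt = act (\<theta> g \<otimes> w) pt"
  using act_mult_B[of "\<theta> g \<otimes> w" "D v u"] by (simp add: \<theta>_mult \<theta>_w m_assoc vu)

lemma \<theta>_V: "\<theta> (V a) = V (v * a)"
proof -
  have "D v u \<otimes> U (- (u * a)) = U (- (v * a)) \<otimes> D v u"
  proof -
    have "v * v * - (u * a) = - (v * (v * u * a))" by (simp add: ac_simps)
    then show ?thesis using D_U[OF vu] by (simp add: vu)
  qed
  then have "D v u \<otimes> U (- (u * a)) \<otimes> inv (D v u) = U (- (v * a))"
    by (simp add: m_assoc vu)
  then have "w \<otimes> (D v u \<otimes> U (- (u * a)) \<otimes> inv (D v u)) \<otimes> inv w = V (v * a)" by (simp add: V_def)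
  then show ?thesis
    by (simp add: V_def \<theta>_mult \<theta>_inv \<theta>_U \<theta>_w inv_mult_group m_assoc vu)
qed

abbreviation t\<delta> :: "('l list \<Rightarrow>\<^sub>0 int) \<Rightarrow> ('l list \<Rightarrow>\<^sub>0 int)" where "t\<delta> \<equiv> tuple_chain_map \<delta>"

abbreviation t\<theta> :: "('g list \<Rightarrow>\<^sub>0 int) \<Rightarrow> ('g list \<Rightarrow>\<^sub>0 int)" where "t\<theta> \<equiv> tuple_chain_map \<theta>"

lemma map_edge: "g \<in> carrier G \<Longrightarrow> map \<delta> (edge g) = edge (\<theta> g)"
  by (simp add: edge_def \<delta>_act act_\<theta>_w)

lemma map_tri: "g \<in> carrier G \<Longrightarrow> map \<delta> (tri g a) = tri (\<theta> g) (v * a)"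
  by (simp add: tri_def \<delta>_act act_\<theta>_w) (simp add: \<theta>_mult \<theta>_V)

lemma map_Y1: "l \<in> Y1 \<Longrightarrow> map \<delta> l \<in> Y1"
  by (auto simp: Y1_def map_edge)

lemma map_Y2: "l \<in> Y2 \<Longrightarrow> map \<delta> l \<in> Y2"
proof -
  assume "l \<in> Y2"
  then obtain g a b where l: "l = tri g a" "g \<in> carrier G" "a * b = 1"
    by (auto simp: Y2_def carrier_unit_group)
  have "(v * a) * (u * b) = 1" using l vu by (metis mult.assoc mult.commute mult_1)
  then have "v * a \<in> units" by (rule unitI)
  then show ?thesis unfolding Y2_def using l map_tri[of g a] \<theta>_closed by blast
qed

lemma Y_boundary_map: "l \<in> Y1 \<or> l \<in> Y2 \<Longrightarrow> Y_boundary (map \<delta> l) = t\<delta> (Y_boundary l)"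
  by (auto simp: Y1_def Y2_def edge_def tri_def Y_boundary_def numeral_2_eq_2 numeral_3_eq_3 tuple_chain_map_simps)

lemma bdy_t\<delta>: "chain1 c \<Longrightarrow> bdy (t\<delta> c) = t\<delta> (bdy c)"
  using tuple_chain_map_commute[of c Y1] Y_boundary_map by blast

lemma t\<delta>_chain1: "chain1 c \<Longrightarrow> chain1 (t\<delta> c)"
  using tuple_chain_map_keys[of c Y1 \<delta> Y1] map_Y1 by blast

lemma t\<delta>_Z1: "z \<in> Z1 \<Longrightarrow> t\<delta> z \<in> Z1"
  by (simp add: Z1_def t\<delta>_chain1 bdy_t\<delta> tuple_chain_map_simps)

lemma t\<delta>_tact: "g \<in> carrier G \<Longrightarrow> chain1 c \<Longrightarrow> t\<delta> (tact g c) = tact (\<theta> g) (t\<delta> c)"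
  unfolding tuple_chain_map_compose
  by (rule tuple_chain_map_cong, assumption)
     (auto simp: Y1_def edge_def act_act \<delta>_act \<theta>_mult)

lemma t\<delta>_B1:
  assumes "z \<in> B1"
  shows "t\<delta> z \<in> B1"
proof -
  obtain c where c: "z = bdy c" "supported c Y2" using assms by (auto simp: B1_def)
  have "bdy (t\<delta> c) = t\<delta> z"
    unfolding c(1) by (rule tuple_chain_map_commute[OF c(2)]) (simp add: Y_boundary_map)
  moreover have "supported (t\<delta> c) Y2" using c(2) by (rule tuple_chain_map_keys) (rule map_Y2)
  ultimately show ?thesis unfolding B1_def by (intro image_eqI[of _ _ "t\<delta> c"]) auto
qed

lemma t\<delta>_N:
  assumes "n \<in> N"
  shows "t\<delta> n \<in> N"
proof -
  have "N \<subseteq> {n. t\<delta> n \<in> N}"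
  proof (rule N_least)
    show "add_subgroup {n. t\<delta> n \<in> N}"
      by (rule add_subgroupI) (auto simp: tuple_chain_map_simps intro: N_intros)
    show "B1 \<subseteq> {n. t\<delta> n \<in> N}" using B1_N t\<delta>_B1 by blast
    show "tact g z - z \<in> {n. t\<delta> n \<in> N}" if "g \<in> carrier G" "z \<in> Z1" for g z
      using that tact_N[of "\<theta> g" "t\<delta> z"] t\<delta>_Z1[of z] by (simp add: tuple_chain_map_simps t\<delta>_tact Z1_def)
  qed
  then show ?thesis using assms by auto
qed

text \<open>The failure of the chosen paths to be invariant under the twist.\<close>

definition defect :: "('g list \<Rightarrow>\<^sub>0 int) \<Rightarrow> ('l list \<Rightarrow>\<^sub>0 int)" where
  "defect = frag_extend (\<lambda>gs. path (\<theta> (hd gs)) - t\<delta> (path (hd gs)))"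

lemma defect_Z1:
  assumes g: "g \<in> carrier G"
  shows "path (\<theta> g) - t\<delta> (path g) \<in> Z1"
  using g by (simp add: Z1_def frag_extend_diff bdy_t\<delta> tuple_chain_map_simps \<delta>_act t\<delta>_chain1 chain1_intros(2))

text \<open>On [g|h] the difference is z translated by the twisted \<open>g\<close>, minus z, where
  z is the defect cycle of \<open>h\<close>. The term with \<open>defect\<close> depends on the
  boundary only, so \<open>alpha\<close> is equivariant on bar cycles.\<close>

lemma alpha_t\<theta>:
  assumes "supported c (bar_basis G 2)"
  shows "alpha (t\<theta> c) - t\<delta> (alpha c) - defect (bar_bdy c) \<in> N"
proof (rule additive_mem_of_basis[where F = "\<lambda>c. alpha (t\<theta> c) - t\<delta> (alpha c) - defect (bar_bdy c)",
      OF _ N_subgroup assms])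
  show "Modules.additive (\<lambda>c. alpha (t\<theta> c) - t\<delta> (alpha c) - defect (bar_bdy c))"
    by (simp add: Modules.additive_def tuple_chain_map_simps alpha_simps frag_extend_add defect_def)
  fix gs assume "gs \<in> bar_basis G 2"
  then obtain g h where gs: "gs = [g, h]" and g: "g \<in> carrier G" and h: "h \<in> carrier G"
    by (auto simp: bar_basis_2)
  have "alpha (t\<theta> (frag_of gs)) - t\<delta> (alpha (frag_of gs)) - defect (bar_bdy (frag_of gs)) =
    tact (\<theta> g) (path (\<theta> h) - t\<delta> (path h)) - (path (\<theta> h) - t\<delta> (path h))"
    using g h
    by (simp add: gs bar_boundary_2 \<theta>_mult defect_def frag_extend_add frag_extend_diff tuple_chain_map_simps t\<delta>_tact)
  also have "\<dots> \<in> N" using g h by (intro tact_N defect_Z1) auto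
  finally show "alpha (t\<theta> (frag_of gs)) - t\<delta> (alpha (frag_of gs)) - defect (bar_bdy (frag_of gs)) \<in> N" .
qed

lemma bar_bdy_t\<theta>:
  assumes "supported c (bar_basis G n)"
  shows "bar_bdy (t\<theta> c) = t\<theta> (bar_bdy c)"
  using assms by (rule tuple_chain_map_commute) (rule bar_boundary_map[OF \<theta>_hom])

lemma t\<theta>_keys: "supported c (bar_basis G n) \<Longrightarrow> supported (t\<theta> c) (bar_basis G n)"
  by (rule tuple_chain_map_keys[OF _ map_bar_basis[OF \<theta>_hom]])

text \<open>The choices in \<open>phi\<close> are not respected by the twist. Instead the relation
  saying that z has class sigma(x) is twisted as a whole, with \<open>alpha_t\<theta>\<close> and
  \<open>defect\<close> correcting the paths. The twisted cycle then has class sigma(u x), and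
  \<open>phi_sig\<close> evaluates both sides.\<close>

lemma phi_t\<delta>:
  assumes z: "z \<in> Z1"
  shows "phi (t\<delta> z) - u * phi z \<in> subgroup_M"
proof -
  obtain x where x: "yy z - sig x \<in> S" using cycle_sig[OF z] .
  then obtain c n where c: "supported c (bar_basis G 2)" and n: "n \<in> N"
    and e: "- frag_of [U x] = bar_bdy c" "z + path (U x) = n - alpha c"
    by (auto simp: S_def yy_def eta_def br_def)
  have "t\<theta> (bar_bdy c) = - frag_of [U (u * x)]"
    unfolding e(1)[symmetric] by (simp add: tuple_chain_map_simps \<theta>_U)
  then have e1: "- frag_of [U (u * x)] = bar_bdy (t\<theta> c)" by (simp add: bar_bdy_t\<theta>[OF c])
  have "defect (bar_bdy c) = - (path (U (u * x)) - t\<delta> (path (U x)))"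
    unfolding e(1)[symmetric] by (simp add: defect_def frag_extend_minus \<theta>_U)
  moreover have "t\<delta> z + t\<delta> (path (U x)) = t\<delta> n - t\<delta> (alpha c)"
    using arg_cong[OF e(2), of t\<delta>] by (simp add: tuple_chain_map_simps)
  ultimately have "t\<delta> z + path (U (u * x)) =
      (t\<delta> n + (alpha (t\<theta> c) - t\<delta> (alpha c) - defect (bar_bdy c))) - alpha (t\<theta> c)"
    by (simp add: algebra_simps)
  moreover have "t\<delta> n + (alpha (t\<theta> c) - t\<delta> (alpha c) - defect (bar_bdy c)) \<in> N"
    by (intro N_intros(4) t\<delta>_N n alpha_t\<theta> c)
  ultimately have "(- frag_of [U (u * x)], t\<delta> z + path (U (u * x))) \<in> S"
    unfolding S_def e1 using t\<theta>_keys[OF c] by blast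
  then have "yy (t\<delta> z) - sig (u * x) \<in> S"
    by (simp add: yy_def eta_def br_def)
  then have 1: "phi (t\<delta> z) - u * x \<in> subgroup_M" by (rule phi_sig)
  have 2: "u * (phi z - x) \<in> subgroup_M" by (rule M_mult_unit[OF unitI[OF uv] phi_sig[OF x]])
  have "phi (t\<delta> z) - u * phi z = (phi (t\<delta> z) - u * x) - u * (phi z - x)"
    by (simp add: right_diff_distrib)
  also have "\<dots> \<in> subgroup_M" by (rule M_intros(2)[OF 1 2])
  finally show ?thesis .
qed

end

section \<open>Matrices of size two\<close>

text \<open>An entrywise normal form that turns matrix identities into ring identities for the
  simplifier.\<close>

definition m2 :: "'a \<Rightarrow> 'a \<Rightarrow> 'a \<Rightarrow> 'a \<Rightarrow> 'a mat" where
  "m2 a b c d = mat_of_rows_list 2 [[a, b], [c, d]]"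

definition v2 :: "'a \<Rightarrow> 'a \<Rightarrow> 'a vec" where "v2 x y = vec_of_list [x, y]"

lemma less_two_cases: "i < 2 \<longleftrightarrow> i = 0 \<or> i = (1 :: nat)"
  by auto

lemma atLeast0_lessThan_two: "{0..<2} = {0, Suc 0}"
  by auto

lemma m2_carrier [simp]: "m2 a b c d \<in> carrier_mat 2 2"
  by (simp add: m2_def mat_of_rows_list_def numeral_2_eq_2)

lemma m2_dim [simp]: "dim_row (m2 a b c d) = 2" "dim_col (m2 a b c d) = 2"
  using m2_carrier[of a b c d] by (auto simp del: m2_carrier)

lemma m2_index [simp]: "m2 a b c d $$ (0, 0) = a" "m2 a b c d $$ (0, Suc 0) = b"
    "m2 a b c d $$ (Suc 0, 0) = c" "m2 a b c d $$ (Suc 0, Suc 0) = d"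
  by (simp_all add: m2_def mat_of_rows_list_def)

lemma m2_eqI:
  assumes "A \<in> carrier_mat 2 2" "A $$ (0, 0) = a" "A $$ (0, 1) = b" "A $$ (1, 0) = c" "A $$ (1, 1) = d"
  shows "A = m2 a b c d"
  using assms by (intro eq_matI) (auto simp: less_two_cases)

lemma m2_cases:
  assumes "A \<in> carrier_mat 2 2"
  obtains a b c d where "A = m2 a b c d"
  using m2_eqI[OF assms] by blast

lemma m2_eq_iff [simp]: "m2 a b c d = m2 a' b' c' d' \<longleftrightarrow> a = a' \<and> b = b' \<and> c = c' \<and> d = d'"
  by (metis m2_index)

lemma m2_mult [simp]:
  "m2 a b c d * m2 a' b' c' d' = (m2 (a * a' + b * c') (a * b' + b * d') (c * a' + d * c') (c * b' + d * d')
     :: 'a::comm_ring_unit mat)"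
  by (rule m2_eqI[OF mult_carrier_mat[OF m2_carrier m2_carrier]])
     (simp_all add: scalar_prod_def atLeast0_lessThan_two)

lemma one_m2: "(1\<^sub>m 2 :: 'a::comm_ring_unit mat) = m2 1 0 0 1"
  by (rule m2_eqI) auto

lemma v2_carrier [simp]: "v2 x y \<in> carrier_vec 2"
  by (rule carrier_vecI) (simp add: v2_def)

lemma v2_dim [simp]: "dim_vec (v2 x y) = 2"
  using v2_carrier[of x y] by (simp del: v2_carrier)

lemma v2_index [simp]: "v2 x y $ 0 = x" "v2 x y $ Suc 0 = y"
  by (simp_all add: v2_def)

lemma v2_eqI:
  assumes "v \<in> carrier_vec 2" "v $ 0 = x" "v $ 1 = y"
  shows "v = v2 x y"
  using assms by (intro eq_vecI) (auto simp: less_two_cases)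

lemma v2_cases:
  assumes "v \<in> carrier_vec 2"
  obtains x y where "v = v2 x y"
  using v2_eqI[OF assms] by blast

lemma v2_eq_iff [simp]: "v2 x y = v2 x' y' \<longleftrightarrow> x = x' \<and> y = y'"
  by (metis v2_index)

lemma m2_mult_vec [simp]:
  "m2 a b c d *\<^sub>v v2 x y = (v2 (a * x + b * y) (c * x + d * y) :: 'a::comm_ring_unit vec)"
  by (rule v2_eqI[OF mult_mat_vec_carrier[OF m2_carrier v2_carrier]])
     (simp_all add: scalar_prod_def atLeast0_lessThan_two)

lemma smult_v2 [simp]: "a \<cdot>\<^sub>v v2 x y = (v2 (a * x) (a * y) :: 'a::comm_ring_unit vec)"
  by (rule v2_eqI) auto

lemma mat_of_cols_v2 [simp]: "mat_of_cols 2 [v2 a c, v2 b d] = m2 a b c d"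
  by (rule m2_eqI) (auto simp: mat_of_cols_index)

lemma m2_assoc:
  assumes "A \<in> carrier_mat 2 2" "B \<in> carrier_mat 2 2" "C \<in> carrier_mat 2 2"
  shows "(A * B) * C = A * (B * (C :: 'a::comm_ring_unit mat))"
  using assms by (rule assoc_mult_mat)

section \<open>The groups GL_2, E_2 and GE_2\<close>

abbreviation M2 :: "'a::comm_ring_unit mat monoid" where
  "M2 \<equiv> \<lparr>carrier = carrier_mat 2 2, monoid.mult = (*), one = 1\<^sub>m 2\<rparr>"

lemma monoid_M2: "monoid (M2 :: 'a::comm_ring_unit mat monoid)"
proof (rule monoidI)
  fix x assume "x \<in> carrier (M2 :: 'a mat monoid)"
  then obtain a b c d where "x = m2 a b c d" by (auto elim: m2_cases)
  then show "\<one>\<^bsub>M2\<^esub> \<otimes>\<^bsub>M2\<^esub> x = x" "x \<otimes>\<^bsub>M2\<^esub> \<one>\<^bsub>M2\<^esub> = x"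
    by (simp_all add: one_m2)
qed (auto simp: m2_assoc)

lemma group_GL2: "group (GL2 :: 'a::comm_ring_unit mat monoid)"
  unfolding GL2_def by (rule monoid.units_group[OF monoid_M2])

lemma mult_GL2 [simp]: "monoid.mult GL2 = ((*) :: 'a::comm_ring_unit mat \<Rightarrow> _)"
  and one_GL2 [simp]: "\<one>\<^bsub>GL2\<^esub> = (m2 1 0 0 1 :: 'a::comm_ring_unit mat)"
  by (simp_all add: GL2_def units_of_def one_m2)

lemma GL2_carrier_mat: "A \<in> carrier GL2 \<Longrightarrow> A \<in> carrier_mat 2 2"
  by (auto simp: GL2_def units_of_def Units_def)

lemma GL2_cases:
  assumes "A \<in> carrier GL2"
  obtains a b c d where "A = m2 a b c d"
  using m2_cases[OF GL2_carrier_mat[OF assms]] by metis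

lemma m2_GL2_iff:
  "m2 a b c d \<in> carrier GL2 \<longleftrightarrow> (\<exists>e. (a * d - b * c) * e = (1 :: 'a::comm_ring_unit))"
proof
  assume "m2 a b c d \<in> carrier GL2"
  then obtain B where B: "B \<in> carrier_mat 2 2" "m2 a b c d * B = 1\<^sub>m 2"
    by (auto simp: GL2_def units_of_def Units_def)
  from B(1) obtain a' b' c' d' where "B = m2 a' b' c' d'" by (rule m2_cases)
  with B have e: "a * a' + b * c' = 1" "a * b' + b * d' = 0" "c * a' + d * c' = 0" "c * b' + d * d' = 1"
    by (simp_all add: one_m2)
  have "(a * d - b * c) * (a' * d' - b' * c') =
      (a * a' + b * c') * (c * b' + d * d') - (a * b' + b * d') * (c * a' + d * c')"
    by (simp add: algebra_simps)
  then show "\<exists>e. (a * d - b * c) * e = 1" unfolding e by (intro exI) simp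
next
  assume "\<exists>e. (a * d - b * c) * e = 1"
  then obtain e where e: "(a * d - b * c) * e = 1" by auto
  \<comment> \<open>The adjugate times the inverse \<open>e\<close> of the determinant.\<close>
  let ?B = "m2 (d * e) (- (b * e)) (- (c * e)) (a * e)"
  have "a * (d * e) + b * - (c * e) = 1" "- (c * b * e) + d * (a * e) = 1"
     "d * e * a + - (b * e) * c = 1" "- (c * e) * b + a * e * d = 1"
     "c * - (b * e) + d * (a * e) = 1"
    using e by (simp_all add: algebra_simps)
  moreover have "a * - (b * e) + b * (a * e) = 0" "c * (d * e) + d * - (c * e) = 0"
     "d * e * b + - (b * e) * d = 0" "- (c * e) * a + a * e * c = 0"
    by (simp_all add: algebra_simps)
  ultimately have "m2 a b c d * ?B = 1\<^sub>m 2" "?B * m2 a b c d = 1\<^sub>m 2"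
    by (simp_all only: one_m2 m2_mult)
  then show "m2 a b c d \<in> carrier GL2"
    unfolding GL2_def units_of_def Units_def by (auto intro!: bexI[of _ ?B])
qed

lemma E12_m2: "E12 a = m2 1 a 0 1" and E21_m2: "E21 a = m2 1 0 a 1" and diag2_m2: "diag2 a b = m2 a 0 0 b"
  by (simp_all add: E12_def E21_def diag2_def m2_def)

lemma E12_GL2: "E12 a \<in> carrier GL2" and E21_GL2: "E21 a \<in> carrier GL2"
  by (auto simp: E12_m2 E21_m2 m2_GL2_iff)

lemma diagonal_GL2_iff:
  "D \<in> carrier GL2 \<and> diagonal_mat D \<longleftrightarrow>
     (\<exists>a b a' b'. D = diag2 a b \<and> a * a' = 1 \<and> b * b' = (1 :: 'a::comm_ring_unit))"
proof
  assume D: "D \<in> carrier GL2 \<and> diagonal_mat D"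
  then obtain a b c d where D': "D = m2 a b c d" by (auto elim: GL2_cases)
  then have "b = 0" "c = 0"
    using D by (auto simp: diagonal_mat_def less_two_cases)
  moreover obtain e where "(a * d - b * c) * e = 1" using D D' by (auto simp: m2_GL2_iff)
  ultimately have "D = diag2 a d" "a * (d * e) = 1" "d * (a * e) = 1"
    using D' by (simp_all add: diag2_m2 ac_simps)
  then show "\<exists>a b a' b'. D = diag2 a b \<and> a * a' = 1 \<and> b * b' = 1" by blast
next
  assume "\<exists>a b a' b'. D = diag2 a b \<and> a * a' = 1 \<and> b * b' = 1"
  then obtain a b a' b' where D: "D = diag2 a b" "a * a' = 1" "b * b' = 1" by blast
  then have "(a * b) * (a' * b') = 1" by (metis mult.assoc mult.commute mult_1)
  then show "D \<in> carrier GL2 \<and> diagonal_mat D"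
    using D by (auto simp: diag2_m2 m2_GL2_iff diagonal_mat_def less_two_cases)
qed

lemma E2_carrier: "carrier E2 = generate GL2 (range E12 \<union> range E21)"
proof -
  have "carrier GL2 \<inter> (range E12 \<union> range E21) = range E12 \<union> (range E21 :: 'a mat set)"
    using E12_GL2 E21_GL2 by auto
  then show ?thesis by (simp add: E2_def carrier_subgroup_generated)
qed

lemma GE2_carrier: "carrier GE2 = generate GL2 (range E12 \<union> range E21 \<union> {D \<in> carrier GL2. diagonal_mat D})"
proof -
  have "carrier GL2 \<inter> (range E12 \<union> range E21 \<union> {D \<in> carrier GL2. diagonal_mat D}) =
     range E12 \<union> range E21 \<union> {D \<in> carrier (GL2 :: 'a mat monoid). diagonal_mat D}"
    using E12_GL2 E21_GL2 by auto
  then show ?thesis by (simp add: GE2_def carrier_subgroup_generated)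
qed

lemma group_E2: "group (E2 :: 'a::comm_ring_unit mat monoid)"
  unfolding E2_def by (rule group.group_subgroup_generated[OF group_GL2])

lemma mult_E2 [simp]: "monoid.mult E2 = ((*) :: 'a::comm_ring_unit mat \<Rightarrow> _)"
  and one_E2 [simp]: "\<one>\<^bsub>E2\<^esub> = (m2 1 0 0 1 :: 'a::comm_ring_unit mat)"
  by (simp_all add: E2_def)

lemma E2_subset_GL2: "A \<in> carrier E2 \<Longrightarrow> A \<in> carrier GL2"
  unfolding E2_carrier using group.generate_in_carrier[OF group_GL2, of "range E12 \<union> range E21"] E12_GL2 E21_GL2
  by blast

lemma E2_subset_GE2: "A \<in> carrier E2 \<Longrightarrow> A \<in> carrier GE2"
  unfolding E2_carrier GE2_carrier
  using group.mono_generate[OF group_GL2, of "range E12 \<union> range E21"] by blast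

lemma E12_E2 [simp]: "E12 a \<in> carrier E2" and E21_E2 [simp]: "E21 a \<in> carrier E2"
  unfolding E2_carrier by (auto intro: generate.incl)

lemma E2_mult: "A \<in> carrier E2 \<Longrightarrow> B \<in> carrier E2 \<Longrightarrow> A * B \<in> carrier E2"
  unfolding E2_carrier using generate.eng[of A GL2 _ B] by simp

lemma inv_GL2_eq:
  assumes "A * B = m2 1 0 0 (1 :: 'a::comm_ring_unit)" "A \<in> carrier GL2" "B \<in> carrier GL2"
  shows "inv\<^bsub>GL2\<^esub> B = A"
  using assms by (intro group.inv_equality[OF group_GL2]) auto

lemma inv_E12: "inv\<^bsub>GL2\<^esub> (E12 a) = E12 (- a)" and inv_E21: "inv\<^bsub>GL2\<^esub> (E21 a) = E21 (- a)"
  by (auto intro!: inv_GL2_eq simp: m2_GL2_iff E12_m2 E21_m2)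

lemma E2_det: "A \<in> carrier E2 \<Longrightarrow> \<exists>a b c d. A = m2 a b c d \<and> a * d - b * c = (1 :: 'a::comm_ring_unit)"
  unfolding E2_carrier
proof (induction rule: generate.induct)
  case one
  show ?case by simp
next
  case (incl h)
  then show ?case by (auto simp: E12_m2 E21_m2)
next
  case (inv h)
  then show ?case by (auto simp: inv_E12 inv_E21, auto simp: E12_m2 E21_m2)
next
  case (eng h1 h2)
  then obtain a b c d a' b' c' d' where h: "h1 = m2 a b c d" "a * d - b * c = 1"
     "h2 = m2 a' b' c' d'" "a' * d' - b' * c' = 1"
    by blast
  have "(a * a' + b * c') * (c * b' + d * d') - (a * b' + b * d') * (c * a' + d * c') =
     (a * d - b * c) * (a' * d' - b' * c')"
    by (simp add: algebra_simps)
  then show ?case using h by auto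
qed

lemma diag_E2:
  assumes "a * b = (1 :: 'a::comm_ring_unit)"
  shows "diag2 a b \<in> carrier E2"
proof -
  have ba: "b * a = 1" using assms by (simp add: mult.commute)
  \<comment> \<open>The first three factors multiply to the antidiagonal matrix with entries a and
    -b; the bracket is the inverse of this matrix for a = b = 1.\<close>
  have "diag2 a b = E12 a * E21 (- b) * E12 a * (E12 (- 1) * E21 1 * E12 (- 1))"
    using assms ba by (simp add: diag2_m2 E12_m2 E21_m2)
  then show ?thesis by (auto intro!: E2_mult)
qed

definition weyl :: "'a::comm_ring_unit mat" where "weyl = m2 0 1 (- 1) 0"

lemma weyl_E2 [simp]: "weyl \<in> carrier E2"
proof -
  have "weyl = E12 1 * E21 (- 1) * E12 (1 :: 'a)" by (simp add: weyl_def E12_m2 E21_m2)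
  then show ?thesis using E2_mult[OF E2_mult[OF E12_E2 E21_E2] E12_E2] by metis
qed

lemma inv_E2 [simp]: "A \<in> carrier E2 \<Longrightarrow> inv\<^bsub>E2\<^esub> A = inv\<^bsub>GL2\<^esub> (A :: 'a::comm_ring_unit mat)"
  using group.inv_subgroup_generated[OF group_GL2] unfolding E2_def by blast

lemma inv_weyl: "inv\<^bsub>GL2\<^esub> weyl = m2 0 (- 1) 1 (0 :: 'a::comm_ring_unit)"
  by (rule inv_GL2_eq) (simp_all add: weyl_def m2_GL2_iff)

section \<open>Lines and the action of E_2 on them\<close>

definition mat_act :: "'a::comm_ring_unit mat \<Rightarrow> 'a vec set \<Rightarrow> 'a vec set" where
  "mat_act g L = (\<lambda>v. g *\<^sub>v v) ` L"

lemma line_v2: "line (v2 x y) = {v2 (a * x) (a * y) | a. True}"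
  by (simp add: line_def)

lemma mat_act_line:
  "mat_act (m2 a b c d) (line (v2 x y)) = line (v2 (a * x + b * y) (c * x + d * (y :: 'a::comm_ring_unit)))"
proof -
  have "m2 a b c d *\<^sub>v v2 (k * x) (k * y) = v2 (k * (a * x + b * y)) (k * (c * x + d * y))" for k
    by (simp add: algebra_simps)
  moreover have "line (v2 x y) = range (\<lambda>k. v2 (k * x) (k * y))" for x y :: 'a
    unfolding line_v2 by auto
  ultimately show ?thesis by (simp add: mat_act_def image_image del: m2_mult_vec)
qed

lemma line_unit:
  assumes "a * b = (1 :: 'a::comm_ring_unit)"
  shows "line (v2 (a * x) (a * y)) = line (v2 x y)"
proof -
  have "c * b * (a * z) = a * b * (c * z)" for c z by (simp add: ac_simps)
  then have "v2 (c * x) (c * y) = v2 (c * b * (a * x)) (c * b * (a * y))" for c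
    by (simp add: assms)
  moreover have "v2 (c * (a * x)) (c * (a * y)) = v2 (c * a * x) (c * a * y)" for c
    by (simp add: mult.assoc)
  ultimately show ?thesis unfolding line_v2 by blast
qed

lemma line_eqD:
  assumes "line (v2 x y) = line (v2 x' y')"
  shows "\<exists>a. x = a * x' \<and> y = a * (y' :: 'a::comm_ring_unit)"
proof -
  have "v2 x y \<in> line (v2 x y)" unfolding line_v2 by (auto intro: exI[of _ 1])
  then show ?thesis unfolding assms by (auto simp: line_v2)
qed

abbreviation infty :: "'a::comm_ring_unit vec set" where "infty \<equiv> line (v2 1 0)"

lemma E2_D_U: "diag2 a b * E12 x = m2 a (a * x) 0 (b :: 'a::comm_ring_unit)"
  by (simp add: diag2_m2 E12_m2)

lemma E2_cases:
  assumes "A \<in> carrier E2"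
  obtains a b c d where "A = m2 a b c d" "a * d - b * c = (1 :: 'a::comm_ring_unit)"
  using E2_det[OF assms] by blast

lemma E2_generators:
  "carrier E2 = generate E2 (range E12 \<union> {weyl :: 'a::comm_ring_unit mat})" (is "_ = generate E2 ?X")
proof
  interpret E2: group "E2 :: 'a mat monoid" by (rule group_E2)
  show "generate E2 ?X \<subseteq> carrier E2"
    by (rule E2.generate_incl) auto
  have w: "weyl \<in> generate E2 ?X" and iw: "m2 0 (- 1) 1 0 \<in> generate E2 ?X"
    using generate.incl[of weyl ?X E2] generate.inv[of weyl ?X E2] by (simp_all add: inv_weyl)
  have E12: "E12 x \<in> generate E2 ?X" for x by (rule generate.incl) auto
  have E21: "E21 x \<in> generate E2 ?X" for x
  proof -
    have "E21 x = weyl * E12 (- x) * m2 0 (- 1) 1 0" by (simp add: weyl_def E12_m2 E21_m2)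
    then show ?thesis
      using generate.eng[OF generate.eng[OF w E12[of "- x"]] iw] by simp
  qed
  show "carrier E2 \<subseteq> generate E2 ?X"
  proof
    fix A :: "'a mat" assume "A \<in> carrier E2"
    then show "A \<in> generate E2 ?X"
      unfolding E2_carrier
    proof (induction rule: generate.induct)
      case one
      show ?case using generate.one[of E2 ?X] by simp
    next
      case (incl h)
      then show ?case using E12 E21 by auto
    next
      case (inv h)
      then show ?case using E12 E21 by (auto simp: inv_E12 inv_E21)
    next
      case (eng h1 h2)
      then show ?case using generate.eng[of h1 E2 ?X h2] by simp
    qed
  qed
qed

lemma mat_act_infty: "mat_act (m2 a b c d) infty = line (v2 a (c :: 'a::comm_ring_unit))"
  using mat_act_line[of a b c d 1 0] by simp

lemma elementary_action_E2:
  "elementary_action E2 mat_act (infty :: 'a::comm_ring_unit vec set) E12 diag2 weyl"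
proof -
  interpret E2: group "E2 :: 'a mat monoid" by (rule group_E2)
  show ?thesis
  proof unfold_locales
    show "mat_act g (mat_act h infty) = mat_act (g \<otimes>\<^bsub>E2\<^esub> h) infty"
      if "g \<in> carrier E2" "h \<in> carrier E2" for g h :: "'a mat"
      using that by (auto elim!: E2_cases simp: mat_act_infty mat_act_line)
    show "mat_act (E12 x) infty = infty" for x :: 'a
      by (simp add: E12_m2 mat_act_infty)
    show "mat_act (diag2 a b) infty = infty" if "a * b = 1" for a b :: 'a
      using line_unit[OF that, of 1 0] by (simp add: diag2_m2 mat_act_infty)
    show "diag2 a b \<in> carrier E2" if "a * b = 1" for a b :: 'a
      using that by (rule diag_E2)
    show "diag2 a b \<otimes>\<^bsub>E2\<^esub> E12 x = E12 (a * a * x) \<otimes>\<^bsub>E2\<^esub> diag2 a b" if "a * b = 1" for a b x :: 'a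
    proof -
      have "a * a * x * b = a * x * (a * b)" by (simp add: ac_simps)
      then show ?thesis using that by (simp add: diag2_m2 E12_m2)
    qed
    show "E12 b \<otimes>\<^bsub>E2\<^esub> weyl =
        weyl \<otimes>\<^bsub>E2\<^esub> E12 (- a) \<otimes>\<^bsub>E2\<^esub> inv\<^bsub>E2\<^esub> weyl \<otimes>\<^bsub>E2\<^esub> diag2 (- b) (- a) \<otimes>\<^bsub>E2\<^esub> E12 (- a)"
      if "a * b = 1" for a b :: 'a
    proof -
      have iw: "inv\<^bsub>E2\<^esub> weyl = m2 0 (- 1) 1 (0 :: 'a)" by (simp add: inv_weyl)
      show ?thesis
        unfolding iw using that by (simp add: weyl_def E12_m2 diag2_m2 mult.commute)
    qed
    show stab: "\<exists>a b x. a * b = 1 \<and> g = diag2 a b \<otimes>\<^bsub>E2\<^esub> E12 x"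
      if g: "g \<in> carrier E2" "mat_act g infty = infty" for g :: "'a mat"
    proof -
      obtain a b c d where g': "g = m2 a b c d" "a * d - b * c = 1" using g(1) by (rule E2_cases)
      have "c = 0" using g(2) line_eqD[of a c 1 0] by (simp add: g' mat_act_infty)
      moreover from this have "a * d = 1" using g' by simp
      moreover from this have "a * (d * b) = b" by (simp flip: mult.assoc)
      ultimately show ?thesis using g' by (intro exI[of _ a] exI[of _ d] exI[of _ "d * b"]) (simp add: E2_D_U)
    qed
    show "\<exists>a b. a * b = 1 \<and> g = diag2 a b"
      if g: "g \<in> carrier E2" "mat_act g infty = infty" "mat_act (g \<otimes>\<^bsub>E2\<^esub> weyl) infty = mat_act weyl infty"
      for g :: "'a mat"
    proof -
      obtain a b x where ab: "a * b = 1" "g = m2 a (a * x) 0 b"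
        using stab[OF g(1,2)] by (auto simp: E2_D_U)
      \<comment> \<open>The two vectors compared here are the first columns of the product of
        \<open>g\<close> with \<open>weyl\<close> and of \<open>weyl\<close> itself.\<close>
      then have "a * x = 0"
        using g(3) line_eqD[of "- (a * x)" "- b" 0 "- 1"] by (simp add: weyl_def mat_act_infty)
      then show ?thesis using ab by (auto simp: diag2_m2)
    qed
    show "a = c \<and> x = y"
      if "a * b = 1" "c * d = 1" "diag2 a b \<otimes>\<^bsub>E2\<^esub> E12 x = diag2 c d \<otimes>\<^bsub>E2\<^esub> E12 y" for a b c d x y :: 'a
    proof -
      have "a = c" "a * x = a * y" using that by (auto simp: E2_D_U)
      moreover have "b * a = 1" using that(1) by (simp add: mult.commute)
      ultimately show ?thesis by (metis mult.assoc mult_1)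
    qed
    show "carrier E2 = generate E2 (range E12 \<union> {weyl :: 'a mat})" by (rule E2_generators)
    show "E12 x \<otimes>\<^bsub>E2\<^esub> E12 y = E12 (x + y)" for x y :: 'a
      by (simp add: E12_m2 add.commute)
    show "diag2 a b \<otimes>\<^bsub>E2\<^esub> weyl = weyl \<otimes>\<^bsub>E2\<^esub> diag2 b a" for a b :: 'a
      by (simp add: diag2_m2 weyl_def)
    show "weyl \<otimes>\<^bsub>E2\<^esub> weyl = diag2 (- 1) (- 1 :: 'a)"
      by (simp add: diag2_m2 weyl_def)
  qed (simp_all add: diag2_m2)
qed

section \<open>Conjugation by diagonal matrices\<close>

lemma diag_GL2: "a * a' = 1 \<Longrightarrow> b * b' = 1 \<Longrightarrow> diag2 a b \<in> carrier (GL2 :: 'a::comm_ring_unit mat monoid)"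
  using diagonal_GL2_iff[of "diag2 a b"] by blast

lemma inv_diag2:
  assumes "a * a' = 1" "b * b' = (1 :: 'a::comm_ring_unit)"
  shows "inv\<^bsub>GL2\<^esub> (diag2 a b) = diag2 a' b'"
proof (rule inv_GL2_eq)
  have "a' * a = 1" "b' * b = 1" using assms by (simp_all add: mult.commute)
  then show "diag2 a' b' * diag2 a b = m2 1 0 0 1" "diag2 a' b' \<in> carrier GL2" "diag2 a b \<in> carrier GL2"
    using assms by (auto simp: diag2_m2 intro: diag_GL2[unfolded diag2_m2])
qed

abbreviation conj_chain :: "'a::comm_ring_unit \<Rightarrow> ('a mat list \<Rightarrow>\<^sub>0 int) \<Rightarrow> ('a mat list \<Rightarrow>\<^sub>0 int)" where
  "conj_chain a \<equiv> tuple_chain_map (conj_by (diag2 a 1))"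

abbreviation act_chain :: "'a::comm_ring_unit \<Rightarrow> ('a vec set list \<Rightarrow>\<^sub>0 int) \<Rightarrow> ('a vec set list \<Rightarrow>\<^sub>0 int)" where
  "act_chain a \<equiv> tuple_chain_map (mat_act (diag2 a 1))"

lemma conj_by_hom:
  assumes "d \<in> carrier GL2"
  shows "conj_by d \<in> hom GL2 (GL2 :: 'a::comm_ring_unit mat monoid)"
  using group.conj_hom[OF group_GL2 assms] unfolding conj_by_def by simp

lemma conj_by_diag2:
  assumes "a * a' = 1" "b * b' = (1 :: 'a::comm_ring_unit)"
  shows "conj_by (diag2 a b) (m2 x y z t) = m2 x (a * b' * y) (b * a' * z) t"
proof -
  have "a * x * a' = (a * a') * x" "b * t * b' = (b * b') * t" by (simp_all add: ac_simps)
  then show ?thesis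
    using assms by (simp add: conj_by_def inv_diag2[OF assms]) (simp add: diag2_m2 ac_simps)
qed

lemma conj_by_E2:
  assumes "a * a' = 1" "b * b' = (1 :: 'a::comm_ring_unit)" and A: "A \<in> carrier E2"
  shows "conj_by (diag2 a b) A \<in> carrier E2"
  using A unfolding E2_carrier
proof (induction rule: generate.induct)
  case one
  show ?case using generate.one[of GL2] by (simp add: conj_by_diag2[OF assms(1,2)])
next
  case (incl h)
  then obtain x where "h = E12 x \<or> h = E21 x" by auto
  then have "conj_by (diag2 a b) h = E12 (a * b' * x) \<or> conj_by (diag2 a b) h = E21 (b * a' * x)"
    by (auto simp: E12_m2 E21_m2 conj_by_diag2[OF assms(1,2)])
  then show ?case by (auto intro: generate.incl)
next
  case (inv h)
  then obtain x where "h = E12 x \<or> h = E21 x" by auto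
  then have "inv\<^bsub>GL2\<^esub> h = E12 (- x) \<or> inv\<^bsub>GL2\<^esub> h = E21 (- x)" by (auto simp: inv_E12 inv_E21)
  then have "conj_by (diag2 a b) (inv\<^bsub>GL2\<^esub> h) = E12 (a * b' * (- x)) \<or> conj_by (diag2 a b) (inv\<^bsub>GL2\<^esub> h) = E21 (b * a' * (- x))"
    by (auto simp: E12_m2 E21_m2 conj_by_diag2[OF assms(1,2)])
  then show ?case by (auto intro: generate.incl)
next
  case (eng h1 h2)
  have "h1 \<in> carrier GL2" "h2 \<in> carrier GL2"
    using eng.hyps E2_subset_GL2 unfolding E2_carrier by auto
  then have "conj_by (diag2 a b) (h1 * h2) = conj_by (diag2 a b) h1 * conj_by (diag2 a b) h2"
    using conj_by_hom[OF diag_GL2[OF assms(1,2)]] by (simp add: hom_def)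
  then show ?case using generate.eng[OF eng.IH] by simp
qed

lemma elementary_twist_E2:
  assumes uv: "u * v = (1 :: 'a::comm_ring_unit)"
  shows "elementary_twist E2 mat_act infty E12 diag2 weyl (conj_by (diag2 u 1)) (mat_act (diag2 u 1)) u v"
proof -
  interpret elementary_action E2 mat_act "infty :: 'a vec set" E12 diag2 weyl by (rule elementary_action_E2)
  have one: "1 * 1 = (1 :: 'a)" by simp
  note conj = conj_by_diag2[OF uv one]
  show ?thesis
  proof unfold_locales
    show "conj_by (diag2 u 1) \<in> hom E2 E2"
    proof (rule homI)
      show "conj_by (diag2 u 1) A \<in> carrier E2" if "A \<in> carrier E2" for A
        using conj_by_E2[OF uv one that] .
      show "conj_by (diag2 u 1) (A \<otimes>\<^bsub>E2\<^esub> B) = conj_by (diag2 u 1) A \<otimes>\<^bsub>E2\<^esub> conj_by (diag2 u 1) B"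
        if "A \<in> carrier E2" "B \<in> carrier E2" for A B
        using conj_by_hom[OF diag_GL2[OF uv one]] that[THEN E2_subset_GL2] by (simp add: hom_def)
    qed
    show "mat_act (diag2 u 1) (mat_act g infty) = mat_act (conj_by (diag2 u 1) g) infty"
      if g: "g \<in> carrier E2" for g
    proof -
      obtain a b c d where g: "g = m2 a b c d" using g by (rule E2_cases)
      have "line (v2 (u * a) (u * (v * c))) = line (v2 a (v * c))" by (rule line_unit[OF uv])
      moreover have "u * (v * c) = c" using uv by (simp flip: mult.assoc)
      ultimately show ?thesis unfolding g conj by (simp add: mat_act_infty diag2_m2 mat_act_line)
    qed
    show "conj_by (diag2 u 1) (E12 x) = E12 (u * x)" for x
      by (simp add: E12_m2 conj)
    show "conj_by (diag2 u 1) weyl = weyl \<otimes>\<^bsub>E2\<^esub> diag2 v u"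
      unfolding weyl_def conj by (simp add: diag2_m2)
  qed (rule uv)
qed

text \<open>Diagonal matrices normalise E_2, so they can be collected on the right. Consequently the
  first column of a matrix in GE_2 is a unit multiple of the first column of one in E_2.\<close>

lemma GE2_decomposition:
  assumes "A \<in> carrier (GE2 :: 'a::comm_ring_unit mat monoid)"
  shows "\<exists>e\<in>carrier E2. \<exists>a b a' b'. a * a' = 1 \<and> b * b' = 1 \<and> A = e * diag2 a b"
  using assms unfolding GE2_carrier
proof (induction rule: generate.induct)
  case one
  have "m2 1 0 0 1 \<in> carrier (E2 :: 'a mat monoid)"
    using group.is_monoid[OF group_E2, THEN monoid.one_closed] by simp
  then show ?case
    by (intro bexI[of _ "m2 1 0 0 1"] exI[of _ 1]) (simp_all add: diag2_m2)
next
  case (incl h)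
  then consider "h \<in> carrier E2" | "h \<in> carrier GL2 \<and> diagonal_mat h" by auto
  then show ?case
  proof cases
    case 1
    then obtain a b c d where "h = m2 a b c d" by (rule E2_cases)
    then show ?thesis using 1 by (intro bexI[of _ h] exI[of _ 1]) (simp_all add: diag2_m2)
  next
    case 2
    then obtain a b a' b' where "h = diag2 a b" "a * a' = 1" "b * b' = 1" unfolding diagonal_GL2_iff by blast
    then show ?thesis
      using diag_E2[of 1 1] by (intro bexI[of _ "diag2 1 1"] exI[of _ a] exI[of _ b] exI[of _ a'] exI[of _ b'])
        (simp_all add: diag2_m2)
  qed
next
  case (inv h)
  then consider "h \<in> range E12 \<union> range E21" | "h \<in> carrier GL2 \<and> diagonal_mat h" by auto
  then show ?case
  proof cases
    case 1
    then have h: "inv\<^bsub>GL2\<^esub> h \<in> carrier E2" by (auto simp: inv_E12 inv_E21)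
    then obtain a b c d where "inv\<^bsub>GL2\<^esub> h = m2 a b c d" by (rule E2_cases)
    then show ?thesis using h by (intro bexI[of _ "inv\<^bsub>GL2\<^esub> h"] exI[of _ 1]) (simp_all add: diag2_m2)
  next
    case 2
    then obtain a b a' b' where h: "h = diag2 a b" "a * a' = 1" "b * b' = 1" unfolding diagonal_GL2_iff by blast
    then have "inv\<^bsub>GL2\<^esub> h = diag2 a' b'" by (simp add: inv_diag2)
    then show ?thesis
      using diag_E2[of 1 1] h by (intro bexI[of _ "diag2 1 1"] exI[of _ a'] exI[of _ b'] exI[of _ a] exI[of _ b])
        (simp_all add: diag2_m2 mult.commute)
  qed
next
  case (eng h1 h2)
  then obtain e a b a' b' f c d c' d' where e: "e \<in> carrier E2" "a * a' = 1" "b * b' = 1" "h1 = e * diag2 a b"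
    and f: "f \<in> carrier E2" "c * c' = 1" "d * d' = 1" "h2 = f * diag2 c d"
    by blast
  note ab = e(2,3)
  obtain p q r s where f': "f = m2 p q r s" using f(1) by (rule E2_cases)
  have "a * b' * q * b = a * q * (b * b')" "b * a' * r * a = b * r * (a * a')" by (simp_all add: ac_simps)
  then have "diag2 a b * f = conj_by (diag2 a b) f * diag2 a b"
    unfolding f' conj_by_diag2[OF ab] using ab by (simp add: diag2_m2 mult.commute)
  then have "diag2 a b * (f * diag2 c d) = conj_by (diag2 a b) f * diag2 (a * c) (b * d)"
    unfolding f' conj_by_diag2[OF ab] by (simp add: diag2_m2 mult.assoc flip: mult.assoc)
  moreover have car: "e \<in> carrier_mat 2 2" "f \<in> carrier_mat 2 2" "conj_by (diag2 a b) f \<in> carrier_mat 2 2"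
      "diag2 x y \<in> carrier_mat 2 2" for x y
    using e(1) f(1) conj_by_E2[OF ab f(1)] by (auto simp: diag2_m2 dest!: E2_subset_GL2 GL2_carrier_mat)
  moreover have fD: "f * diag2 c d \<in> carrier_mat 2 2" by (rule mult_carrier_mat[OF car(2,4)])
  ultimately have "h1 * h2 = (e * conj_by (diag2 a b) f) * diag2 (a * c) (b * d)"
    unfolding e f m2_assoc[OF car(1,4) fD] m2_assoc[OF car(1,3,4)] by simp
  moreover have "e * conj_by (diag2 a b) f \<in> carrier E2"
    by (intro E2_mult e conj_by_E2[OF ab] f)
  moreover have "(a * c) * (a' * c') = 1" "(b * d) * (b' * d') = 1"
    using e f by (metis mult.assoc mult.commute mult_1)+
  ultimately show ?case by auto
qed

section \<open>The complex of lines\<close>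

lemma unit_mult:
  fixes a b :: "'a::comm_ring_unit"
  shows "a * a' = 1 \<Longrightarrow> b * b' = 1 \<Longrightarrow> (a * b) * (a' * b') = 1"
  by (metis mult.assoc mult.commute mult_1)

text \<open>Transitivity of E_2 on edges. Unimodularity of \<open>u\<close> provides a matrix in E_2
  whose first column spans the line of \<open>u\<close>; right multiplication by a suitable
  \<open>E12\<close> keeps that column and moves the second one onto the line of
  \<open>v\<close>.\<close>

lemma adapted_basis:
  assumes u: "GE2_unimodular u" and v: "v \<in> carrier_vec 2" and uv: "mat_of_cols 2 [u, v] \<in> carrier GL2"
  obtains p q r s a a' y y' where "m2 p q r s \<in> carrier E2" "p * s - q * r = (1 :: 'a::comm_ring_unit)"
    "a * a' = 1" "y * y' = 1" "u = v2 (a * p) (a * r)" "v = v2 (y * q) (y * s)"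
proof -
  obtain v' where u2: "u \<in> carrier_vec 2" and v': "v' \<in> carrier_vec 2" "mat_of_cols 2 [u, v'] \<in> carrier GE2"
    using u by (auto simp: GE2_unimodular_def)
  obtain u1 u2 where u_eq: "u = v2 u1 u2" using u2 by (rule v2_cases)
  obtain w1 w2 where "v' = v2 w1 w2" using v'(1) by (rule v2_cases)
  with v' u_eq have "m2 u1 w1 u2 w2 \<in> carrier GE2" by simp
  from GE2_decomposition[OF this] obtain e a b a' b' where e: "e \<in> carrier E2" "a * a' = 1"
    "m2 u1 w1 u2 w2 = e * diag2 a b" by blast
  obtain p q r s where e': "e = m2 p q r s" and det: "p * s - q * r = 1" using e(1) by (rule E2_cases)
  have u_eq: "u = v2 (a * p) (a * r)" using e(3) u_eq by (simp add: e' diag2_m2 mult.commute)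
  obtain v1 v2' where v_eq: "v = v2 v1 v2'" using v by (rule v2_cases)
  \<comment> \<open>The coordinates of \<open>v\<close> in the columns of \<open>e\<close>, by
    Cramer's rule with determinant 1.\<close>
  define x y where "x = s * v1 - q * v2'" and "y = p * v2' - r * v1"
  obtain k where "(a * p * v2' - v1 * (a * r)) * k = 1"
    using uv by (auto simp: u_eq v_eq m2_GL2_iff)
  moreover have "a * p * v2' - v1 * (a * r) = y * a" by (simp add: y_def algebra_simps)
  ultimately have y: "y * (a * k) = 1" by (simp add: mult.assoc)
  let ?y' = "a * k"
  have 1: "p * x + q * y = v1" and 2: "r * x + s * y = v2'"
  proof -
    have "p * x + q * y = (p * s - q * r) * v1" "r * x + s * y = (p * s - q * r) * v2'"
      by (simp_all add: x_def y_def algebra_simps)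
    then show "p * x + q * y = v1" "r * x + s * y = v2'" using det by simp_all
  qed
  \<comment> \<open>The second column of \<open>e * E12 (x * ?y')\<close>, which is \<open>v\<close>
    divided by the unit \<open>y\<close>.\<close>
  let ?q = "p * (x * ?y') + q" and ?s = "r * (x * ?y') + s"
  have "y * ?q = p * x * (y * ?y') + q * y" "y * ?s = r * x * (y * ?y') + s * y"
    by (simp_all add: algebra_simps)
  then have "v = v2 (y * ?q) (y * ?s)" by (simp add: v_eq y 1 2)
  moreover have "m2 p ?q r ?s \<in> carrier E2"
    using E2_mult[OF e(1) E12_E2[of "x * ?y'"]] by (simp add: e' E12_m2)
  moreover have "p * ?s - ?q * r = 1" using det by (simp add: algebra_simps)
  ultimately show ?thesis using that e(2) y u_eq by blast
qed

interpretation EA: elementary_action E2 mat_act "infty :: 'a::comm_ring_unit vec set" E12 diag2 weyl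
  by (rule elementary_action_E2)

lemma EA_edge:
  assumes "m2 p q r s \<in> carrier E2"
  shows "EA.edge (m2 p q r s) = [line (v2 p r), line (v2 q (s :: 'a::comm_ring_unit))]"
  using line_unit[of "- 1" "- 1" q s] by (simp add: EA.edge_def mat_act_infty) (simp add: weyl_def mat_act_infty)

lemma EA_V: "EA.V a = (E21 a :: 'a::comm_ring_unit mat)"
  by (simp add: EA.V_def inv_weyl) (simp add: weyl_def E12_m2 E21_m2)

lemma EA_tri:
  assumes "m2 p q r s \<in> carrier E2"
  shows "EA.tri (m2 p q r s) a = [line (v2 p r), line (v2 q s), line (v2 (p + q * a) (r + s * (a :: 'a::comm_ring_unit)))]"
  using line_unit[of "- 1" "- 1" q s]
  by (simp add: EA.tri_def EA_V mat_act_infty) (simp add: E21_m2 weyl_def mat_act_infty)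

lemma first_column_unimodular:
  assumes "m2 p q r s \<in> carrier (E2 :: 'a::comm_ring_unit mat monoid)"
  shows "GE2_unimodular (v2 p r)"
  using E2_subset_GE2[OF assms] unfolding GE2_unimodular_def by (auto intro!: bexI[of _ "v2 q s"])

text \<open>Each vector is the first column of a matrix in E_2: of the matrix itself and of its
  products with \<open>weyl\<close> and with \<open>E21 a\<close>. The signs of the second vector
  come from \<open>weyl\<close>.\<close>

lemma columns_unimodular:
  assumes E: "m2 p q r s \<in> carrier (E2 :: 'a::comm_ring_unit mat monoid)"
  shows "GE2_unimodular (v2 p r)" "GE2_unimodular (v2 (- q) (- s))" "GE2_unimodular (v2 (p + q * a) (r + s * a))"
  using E2_mult[OF E weyl_E2] E2_mult[OF E E21_E2[of a]] E
  by (auto simp: weyl_def E21_m2 intro: first_column_unimodular)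

lemma det_columns:
  assumes "p * s - q * r = (1 :: 'a::comm_ring_unit)"
  shows "p * (- s) - (- q) * r = - 1" "(- q) * r - p * (- s) = 1"
    "p * (r + s * a) - (p + q * a) * r = a" "(p + q * a) * r - p * (r + s * a) = - a"
    "(- q) * (r + s * a) - (p + q * a) * (- s) = 1" "(p + q * a) * (- s) - (- q) * (r + s * a) = - 1"
proof -
  have "p * (- s) - (- q) * r = - (p * s - q * r)" "(- q) * r - p * (- s) = p * s - q * r"
    "p * (r + s * a) - (p + q * a) * r = (p * s - q * r) * a"
    "(p + q * a) * r - p * (r + s * a) = - ((p * s - q * r) * a)"
    "(- q) * (r + s * a) - (p + q * a) * (- s) = p * s - q * r"
    "(p + q * a) * (- s) - (- q) * (r + s * a) = - (p * s - q * r)"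
    by (simp_all add: algebra_simps)
  then show "p * (- s) - (- q) * r = - 1" "(- q) * r - p * (- s) = 1"
    "p * (r + s * a) - (p + q * a) * r = a" "(p + q * a) * r - p * (r + s * a) = - a"
    "(- q) * (r + s * a) - (p + q * a) * (- s) = 1" "(p + q * a) * (- s) - (- q) * (r + s * a) = - 1"
    unfolding assms by simp_all
qed

text \<open>By \<open>adapted_basis\<close> a pair of lines is spanned by the columns of a matrix in
  E_2, which makes it an edge. Conversely the second line is represented by (- q, - s), whose
  unimodularity is visible through \<open>weyl\<close>.\<close>

lemma Y_basis_1: "Y_basis 1 = (EA.Y1 :: 'a::comm_ring_unit vec set list set)"
proof (intro equalityI subsetI)
  fix l :: "'a vec set list" assume "l \<in> Y_basis 1"
  then obtain vs where vs: "l = map line vs" "length vs = 2" "\<forall>v\<in>set vs. GE2_unimodular v"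
      "\<forall>i<length vs. \<forall>j<length vs. i \<noteq> j \<longrightarrow> mat_of_cols 2 [vs ! i, vs ! j] \<in> carrier GL2"
    by (auto simp: Y_basis_def)
  obtain u v where uv: "vs = [u, v]" using vs(2) by (auto simp: numeral_2_eq_2 length_Suc_conv)
  have "GE2_unimodular u" "v \<in> carrier_vec 2" using vs(3) uv by (auto simp: GE2_unimodular_def)
  moreover have "mat_of_cols 2 [u, v] \<in> carrier GL2" using vs(4)[rule_format, of 0 1] by (simp add: uv)
  ultimately obtain p q r s a a' y y' where *: "m2 p q r s \<in> carrier E2" "p * s - q * r = 1"
    "a * a' = 1" "y * y' = 1" "u = v2 (a * p) (a * r)" "v = v2 (y * q) (y * s)"
    by (rule adapted_basis)
  have "l = EA.edge (m2 p q r s)"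
    unfolding EA_edge[OF *(1)] by (simp add: vs(1) uv * line_unit[OF *(3)] line_unit[OF *(4)])
  then show "l \<in> EA.Y1" using *(1) by (simp add: EA.Y1_def)
next
  fix l :: "'a vec set list" assume "l \<in> EA.Y1"
  then obtain g where g: "g \<in> carrier E2" "l = EA.edge g" by (auto simp: EA.Y1_def)
  obtain p q r s where g': "g = m2 p q r s" "p * s - q * r = 1" using g(1) by (rule E2_cases)
  note E = g(1)[unfolded g'(1)]
  have "l = map line [v2 p r, v2 (- q) (- s)]"
    using line_unit[of "- 1" "- 1" q s] by (simp add: g g' EA_edge[OF E])
  moreover have "m2 p (- q) r (- s) \<in> carrier GL2" "m2 (- q) p (- s) r \<in> carrier GL2"
    unfolding m2_GL2_iff det_columns[OF g'(2)] by (auto intro: exI[of _ 1] exI[of _ "- 1"])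
  ultimately show "l \<in> Y_basis 1"
    unfolding Y_basis_def using columns_unimodular[OF E]
    by (intro CollectI exI[of _ "[v2 p r, v2 (- q) (- s)]"]) (auto simp: less_Suc_eq)
qed

text \<open>After the first two lines are put in adapted form, the third vector has coordinates X
  and Y in that basis. Both are units because it forms invertible matrices with the first two, so
  the third line is determined by the unit Y/X, the parameter of the triangle.\<close>

lemma Y_basis_2: "Y_basis 2 = (EA.Y2 :: 'a::comm_ring_unit vec set list set)"
proof (intro equalityI subsetI)
  fix l :: "'a vec set list" assume "l \<in> Y_basis 2"
  then obtain vs where vs: "l = map line vs" "length vs = 3" "\<forall>v\<in>set vs. GE2_unimodular v"
      "\<forall>i<length vs. \<forall>j<length vs. i \<noteq> j \<longrightarrow> mat_of_cols 2 [vs ! i, vs ! j] \<in> carrier GL2"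
    by (auto simp: Y_basis_def)
  obtain u v z where uv: "vs = [u, v, z]" using vs(2) by (auto simp: numeral_3_eq_3 length_Suc_conv)
  have un: "GE2_unimodular u" "v \<in> carrier_vec 2" "z \<in> carrier_vec 2"
    using vs(3) uv by (auto simp: GE2_unimodular_def)
  have uv': "mat_of_cols 2 [u, v] \<in> carrier GL2" and uz: "mat_of_cols 2 [u, z] \<in> carrier GL2"
    and vz: "mat_of_cols 2 [v, z] \<in> carrier GL2"
    using vs(4)[rule_format, of 0 1] vs(4)[rule_format, of 0 2] vs(4)[rule_format, of 1 2] by (simp_all add: uv)
  obtain p q r s a a' y y' where *: "m2 p q r s \<in> carrier E2" "p * s - q * r = 1"
    "a * a' = 1" "y * y' = 1" "u = v2 (a * p) (a * r)" "v = v2 (y * q) (y * s)"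
    using un(1,2) uv' by (rule adapted_basis)
  obtain z1 z2 where z: "z = v2 z1 z2" using un(3) by (rule v2_cases)
  define X Y where "X = s * z1 - q * z2" and "Y = p * z2 - r * z1"
  have zX: "p * X + q * Y = z1" "r * X + s * Y = z2"
  proof -
    have "p * X + q * Y = (p * s - q * r) * z1" "r * X + s * Y = (p * s - q * r) * z2"
      by (simp_all add: X_def Y_def algebra_simps)
    then show "p * X + q * Y = z1" "r * X + s * Y = z2" using *(2) by simp_all
  qed
  obtain k where "(a * p * z2 - z1 * (a * r)) * k = 1" using uz by (auto simp: * z m2_GL2_iff)
  moreover have "a * p * z2 - z1 * (a * r) = Y * a" by (simp add: Y_def algebra_simps)
  ultimately have Y: "Y * (a * k) = 1" by (simp add: mult.assoc)
  obtain m where "(y * q * z2 - z1 * (y * s)) * m = 1" using vz by (auto simp: * z m2_GL2_iff)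
  moreover have "y * q * z2 - z1 * (y * s) = X * (- y)" by (simp add: X_def algebra_simps)
  ultimately have X: "X * (- y * m) = 1" by (simp add: mult.assoc)
  let ?X' = "- y * m"
  let ?b = "Y * ?X'"
  have "X * (p + q * ?b) = p * X + q * Y * (X * ?X')" "X * (r + s * ?b) = r * X + s * Y * (X * ?X')"
    by (simp_all add: algebra_simps)
  then have "z = v2 (X * (p + q * ?b)) (X * (r + s * ?b))" unfolding X by (simp add: z zX)
  then have "line z = line (v2 (p + q * ?b) (r + s * ?b))" using line_unit[OF X] by simp
  then have "l = EA.tri (m2 p q r s) ?b"
    unfolding EA_tri[OF *(1)] by (simp add: vs(1) uv *(5,6) line_unit[OF *(3)] line_unit[OF *(4)])
  moreover have "?X' * X = 1" using X by (simp add: mult.commute)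
  then have "?b \<in> units"
    using unit_mult[OF Y] unfolding carrier_unit_group by blast
  ultimately show "l \<in> EA.Y2" unfolding EA.Y2_def using *(1) by blast
next
  fix l :: "'a vec set list" assume "l \<in> EA.Y2"
  then obtain g a b where g: "g \<in> carrier E2" "l = EA.tri g a" and ab: "a * b = 1"
    by (auto simp: EA.Y2_def carrier_unit_group)
  obtain p q r s where g': "g = m2 p q r s" "p * s - q * r = 1" using g(1) by (rule E2_cases)
  note E = g(1)[unfolded g'(1)]
  let ?z1 = "p + q * a" and ?z2 = "r + s * a"
  have "l = map line [v2 p r, v2 (- q) (- s), v2 ?z1 ?z2]"
    using line_unit[of "- 1" "- 1" q s] by (simp add: g g' EA_tri[OF E])
  moreover have u1: "\<exists>e. 1 * e = (1 :: 'a)" and u2: "\<exists>e. - 1 * e = (1 :: 'a)" and u3: "\<exists>e. a * e = 1"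
    and u4: "\<exists>e. - a * e = 1"
    using ab by (auto intro: exI[of _ 1] exI[of _ "- 1"] exI[of _ "- b"])
  then have "m2 p (- q) r (- s) \<in> carrier GL2" "m2 (- q) p (- s) r \<in> carrier GL2"
    "m2 p ?z1 r ?z2 \<in> carrier GL2" "m2 ?z1 p ?z2 r \<in> carrier GL2"
    "m2 (- q) ?z1 (- s) ?z2 \<in> carrier GL2" "m2 ?z1 (- q) ?z2 (- s) \<in> carrier GL2"
    unfolding m2_GL2_iff det_columns[OF g'(2)] by blast+
  ultimately show "l \<in> Y_basis 2"
    unfolding Y_basis_def using columns_unimodular[OF E]
    by (intro CollectI exI[of _ "[v2 p r, v2 (- q) (- s), v2 ?z1 ?z2]"])
       (auto simp: less_Suc_eq mat_of_cols_v2[unfolded numeral_2_eq_2])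
qed

section \<open>Modules over the square class group\<close>

lemma unit_group_comm: "comm_group (unit_group :: 'a::comm_ring_unit monoid)"
proof (rule comm_groupI)
  fix x y :: 'a
  assume "x \<in> units" "y \<in> units"
  then have "x * y \<in> units"
    unfolding carrier_unit_group using unit_mult by blast
  then show "x \<otimes>\<^bsub>unit_group\<^esub> y \<in> units"
    by (simp add: unit_group_def units_of_def)
next
  fix x :: 'a assume "x \<in> units"
  then obtain y where "x * y = 1" by (auto simp: carrier_unit_group)
  then show "\<exists>y\<in>units. y \<otimes>\<^bsub>unit_group\<^esub> x = \<one>\<^bsub>unit_group\<^esub>"
    by (intro bexI[of _ y]) (auto simp: carrier_unit_group mult.commute, auto simp: unit_group_def units_of_def mult.commute)
next
  show "\<one>\<^bsub>unit_group\<^esub> \<in> (units :: 'a set)"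
    unfolding carrier_unit_group by (auto simp: unit_group_def units_of_def)
qed (auto simp: unit_group_def units_of_def ac_simps)

lemma mult_unit_group [simp]: "monoid.mult unit_group = ((*) :: 'a::comm_ring_unit \<Rightarrow> _)"
  and one_unit_group [simp]: "\<one>\<^bsub>unit_group\<^esub> = (1 :: 'a::comm_ring_unit)"
  by (simp_all add: unit_group_def units_of_def)

lemma one_unit [simp]: "(1 :: 'a::comm_ring_unit) \<in> units"
  by (auto simp: carrier_unit_group)

lemma unit_mult_closed:
  "a \<in> units \<Longrightarrow> b \<in> units \<Longrightarrow> a * b \<in> (units :: 'a::comm_ring_unit set)"
  unfolding carrier_unit_group using unit_mult by blast

lemma unit_squares_subgroup: "subgroup unit_squares (unit_group :: 'a::comm_ring_unit monoid)"
proof -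
  interpret comm_group "unit_group :: 'a monoid" by (rule unit_group_comm)
  show ?thesis
  proof (rule subgroupI)
    show "unit_squares \<subseteq> (units :: 'a set)"
      by (auto simp: unit_squares_def power2_eq_square intro: unit_mult_closed)
    show "(unit_squares :: 'a set) \<noteq> {}"
      using one_unit unfolding unit_squares_def by blast
    fix x y :: 'a assume x: "x \<in> unit_squares"
    then obtain a where a: "x = a * a" "a \<in> units" by (auto simp: unit_squares_def power2_eq_square)
    have "inv\<^bsub>unit_group\<^esub> x = inv\<^bsub>unit_group\<^esub> a * inv\<^bsub>unit_group\<^esub> a"
      using inv_mult_group[OF a(2,2)] by (simp add: a(1))
    then show "inv\<^bsub>unit_group\<^esub> x \<in> unit_squares"
      unfolding unit_squares_def power2_eq_square using a(2) by auto
    assume "y \<in> unit_squares"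
    then obtain b where b: "y = b * b" "b \<in> units" by (auto simp: unit_squares_def power2_eq_square)
    have "x * y = (a * b) * (a * b)" by (simp add: a b ac_simps)
    then show "x \<otimes>\<^bsub>unit_group\<^esub> y \<in> unit_squares"
      unfolding unit_squares_def power2_eq_square using unit_mult_closed[OF a(2) b(2)] by auto
  qed
qed

lemma normal_unit_squares: "unit_squares \<lhd> (unit_group :: 'a::comm_ring_unit monoid)"
  using comm_group.subgroup_imp_normal[OF unit_group_comm unit_squares_subgroup] .

lemma carrier_square_class_group: "carrier square_class_group = square_class ` (units :: 'a::comm_ring_unit set)"
  by (simp add: square_class_group_def carrier_FactGroup square_class_def)

lemma square_class_mult:
  "a \<in> units \<Longrightarrow> b \<in> units \<Longrightarrow>
    square_class a \<otimes>\<^bsub>square_class_group\<^esub> square_class b = square_class (a * b :: 'a::comm_ring_unit)"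
  using normal.rcos_sum[OF normal_unit_squares] by (simp add: square_class_def square_class_group_def)

lemma square_class_eqD:
  fixes a b :: "'a::comm_ring_unit"
  assumes "a \<in> units" "b \<in> units" "square_class a = square_class b"
  shows "\<exists>c\<in>units. a = c * c * b"
proof -
  interpret comm_group "unit_group :: 'a monoid" by (rule unit_group_comm)
  have "a \<in> square_class b"
    using rcos_self[OF assms(1) unit_squares_subgroup] assms(3) by (simp add: square_class_def)
  then show ?thesis by (auto simp: square_class_def r_coset_def unit_squares_def power2_eq_square)
qed

lemma square_class_module_exists:
  fixes act :: "'a::comm_ring_unit \<Rightarrow> 'm \<Rightarrow> 'm"
  assumes Q: "comm_group Q"
    and hom: "\<And>a. a \<in> units \<Longrightarrow> act a \<in> hom Q Q"
    and one: "\<And>m. m \<in> carrier Q \<Longrightarrow> act 1 m = m"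
    and mult: "\<And>a b m. a \<in> units \<Longrightarrow> b \<in> units \<Longrightarrow> m \<in> carrier Q \<Longrightarrow>
      act (a * b) m = act a (act b m)"
    and square: "\<And>a m. a \<in> units \<Longrightarrow> m \<in> carrier Q \<Longrightarrow> act (a * a) m = m"
  shows "\<exists>\<rho>. square_class_module Q act \<rho>"
proof -
  interpret comm_group Q by (rule Q)
  have closed: "act a m \<in> carrier Q" if "a \<in> units" "m \<in> carrier Q" for a m
    using hom[OF that(1)] that(2) by (auto simp: hom_def)
  \<comment> \<open>Any representative of the class serves because squares act trivially; the
    restriction makes the map extensional, as membership in \<open>BijGroup\<close> demands.\<close>
  define \<rho> where "\<rho> C = restrict (act (SOME a. a \<in> units \<and> square_class a = C)) (carrier Q)" for C
  have \<rho>: "\<rho> (square_class a) = restrict (act a) (carrier Q)" if a: "a \<in> units" for a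
  proof -
    define b where "b = (SOME b. b \<in> units \<and> square_class b = square_class a)"
    have b: "b \<in> units \<and> square_class b = square_class a"
      unfolding b_def by (rule someI[of _ a]) (use a in auto)
    then obtain c where "c \<in> units" "b = c * c * a" using square_class_eqD a by blast
    then have "act b m = act a m" if "m \<in> carrier Q" for m
      using mult[OF unit_mult_closed[of c c] a that] square[OF _ closed[OF a that]] by simp
    then show ?thesis unfolding \<rho>_def b_def[symmetric] by (rule restrict_ext)
  qed
  have Bij: "restrict (act a) (carrier Q) \<in> Bij (carrier Q)" if a: "a \<in> units" for a
  proof -
    obtain b where b: "b \<in> units" "a * b = 1" "b * a = 1"
      using a unfolding carrier_unit_group by (metis mult.commute)
    have "bij_betw (act a) (carrier Q) (carrier Q)"
      by (rule bij_betw_byWitness[of _ "act b"])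
         (use a b closed in \<open>auto simp: one simp flip: mult\<close>)
    then show ?thesis by (simp add: Bij_def)
  qed
  have "group_action square_class_group (carrier Q) \<rho>"
    unfolding group_action_def group_hom_def group_hom_axioms_def
  proof (intro conjI)
    show "group (square_class_group :: 'a set monoid)"
      unfolding square_class_group_def by (rule normal.factorgroup_is_group[OF normal_unit_squares])
    show "group (BijGroup (carrier Q))" by (rule group_BijGroup)
    show "\<rho> \<in> hom square_class_group (BijGroup (carrier Q))"
    proof (rule homI)
      show "\<rho> C \<in> carrier (BijGroup (carrier Q))" if "C \<in> carrier square_class_group" for C
        using that Bij \<rho> by (auto simp: carrier_square_class_group BijGroup_def)
    next
      fix C C' :: "'a set" assume "C \<in> carrier square_class_group" "C' \<in> carrier square_class_group"
      then obtain a b where ab: "a \<in> units" "b \<in> units" "C = square_class a" "C' = square_class b"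
        by (auto simp: carrier_square_class_group)
      then show "\<rho> (C \<otimes>\<^bsub>square_class_group\<^esub> C') = \<rho> C \<otimes>\<^bsub>BijGroup (carrier Q)\<^esub> \<rho> C'"
        using Bij[OF ab(1)] Bij[OF ab(2)] closed[OF ab(2)] mult[OF ab(1,2)] unit_mult_closed[OF ab(1,2)]
        by (auto simp: square_class_mult \<rho> BijGroup_def compose_def fun_eq_iff)
    qed
  qed
  moreover have "\<rho> C \<in> hom Q Q" if "C \<in> carrier square_class_group" for C
    using that hom \<rho> closed by (auto simp: carrier_square_class_group hom_def)
  ultimately have "square_class_module Q act \<rho>"
    using \<rho> by (auto simp: square_class_module_def is_module_def Q)
  then show ?thesis by blast
qed

text \<open>The laws are asked on representatives only modulo \<open>N\<close>: on bar chains,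
  squares act through inner automorphisms, which are the identity only up to boundaries.\<close>

lemma quotient_square_class_module:
  fixes act :: "'a::comm_ring_unit \<Rightarrow> 'm \<Rightarrow> 'm"
  assumes Q: "quotient_map Q Z N q"
    and act: "\<And>a z. a \<in> units \<Longrightarrow> z \<in> Z \<Longrightarrow> act a (q z) = q (op a z)"
    and op: "\<And>a z. a \<in> units \<Longrightarrow> z \<in> Z \<Longrightarrow> op a z \<in> Z"
      "\<And>a x y. a \<in> units \<Longrightarrow> x \<in> Z \<Longrightarrow> y \<in> Z \<Longrightarrow> op a (x + y) = op a x + op a y"
    and one: "\<And>z. z \<in> Z \<Longrightarrow> op 1 z - z \<in> N"
    and mult: "\<And>a b z. a \<in> units \<Longrightarrow> b \<in> units \<Longrightarrow> z \<in> Z \<Longrightarrow>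
      op (a * b) z - op a (op b z) \<in> N"
    and square: "\<And>a z. a \<in> units \<Longrightarrow> z \<in> Z \<Longrightarrow> op (a * a) z - z \<in> N"
  shows "\<exists>\<rho>. square_class_module Q act \<rho>"
proof (rule square_class_module_exists)
  note Q' = quotient_mapD[OF Q]
  have Z: "\<exists>z\<in>Z. m = q z" if "m \<in> carrier Q" for m using that Q'(5) by blast
  show "comm_group Q" by (rule Q')
  show "act a \<in> hom Q Q" if a: "a \<in> units" for a
  proof (rule homI)
    show "act a m \<in> carrier Q" if "m \<in> carrier Q" for m
      using Z[OF that] a act op Q'(8) by auto
    fix m n assume "m \<in> carrier Q" "n \<in> carrier Q"
    then obtain x y where xy: "x \<in> Z" "y \<in> Z" "m = q x" "n = q y" using Z by metis
    have "act a (q x \<otimes>\<^bsub>Q\<^esub> q y) = act a (q (x + y))" using xy Q'(6) by simp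
    also have "\<dots> = q (op a x + op a y)" using act[OF a] op(2)[OF a] xy Q'(2) by (simp add: add_subgroup_add)
    also have "\<dots> = act a (q x) \<otimes>\<^bsub>Q\<^esub> act a (q y)" using act[OF a] op(1)[OF a] xy Q'(6) by simp
    finally show "act a (m \<otimes>\<^bsub>Q\<^esub> n) = act a m \<otimes>\<^bsub>Q\<^esub> act a n" using xy by simp
  qed
  show "act 1 m = m" if "m \<in> carrier Q" for m
    using Z[OF that] act[OF one_unit] op(1)[OF one_unit] one quotient_map_eq_iff[OF Q] by auto
  show "act (a * b) m = act a (act b m)"
    if "a \<in> units" "b \<in> units" "m \<in> carrier Q" for a b m
    using Z[OF that(3)] act op(1) mult[OF that(1,2)] quotient_map_eq_iff[OF Q] unit_mult_closed[OF that(1,2)] that(1,2)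
    by auto
  show "act (a * a) m = m" if "a \<in> units" "m \<in> carrier Q" for a m
    using Z[OF that(2)] act op(1) square[OF that(1)] quotient_map_eq_iff[OF Q] unit_mult_closed[OF that(1,1)] that(1)
    by auto
qed

lemma equivariant_homI:
  assumes Q: "quotient_map Q Z N q" and R: "quotient_map R Z' N' r"
    and F: "F \<in> hom Q R" "\<And>x. x \<in> Z \<Longrightarrow> F (q x) = r (f x)" "\<And>x. x \<in> Z \<Longrightarrow> f x \<in> Z'"
    and \<rho>: "square_class_module Q act \<rho>" and \<sigma>: "square_class_module R act' \<sigma>"
    and act: "\<And>a z. a \<in> units \<Longrightarrow> z \<in> Z \<Longrightarrow> act a (q z) = q (op a z)"
      "\<And>a z. a \<in> units \<Longrightarrow> z \<in> Z \<Longrightarrow> op a z \<in> Z"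
    and act': "\<And>a z. a \<in> units \<Longrightarrow> z \<in> Z' \<Longrightarrow> act' a (r z) = r (op' a z)"
      "\<And>a z. a \<in> units \<Longrightarrow> z \<in> Z' \<Longrightarrow> op' a z \<in> Z'"
    and f: "\<And>a z. a \<in> units \<Longrightarrow> z \<in> Z \<Longrightarrow> f (op a z) - op' a (f z) \<in> N'"
  shows "F \<in> equivariant_hom square_class_group Q \<rho> R (\<sigma> :: 'a::comm_ring_unit set \<Rightarrow> _)"
  unfolding equivariant_hom_def
proof (intro CollectI conjI ballI F(1))
  fix g :: "'a set" and m assume "g \<in> carrier square_class_group" "m \<in> carrier Q"
  then obtain a z where az: "a \<in> units" "z \<in> Z" "g = square_class a" "m = q z"
    unfolding carrier_square_class_group quotient_mapD(5)[OF Q, symmetric] by blast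
  have "F (\<rho> g m) = F (act a (q z))"
    using \<rho> az quotient_mapD(8)[OF Q] by (simp add: square_class_module_def)
  also have "\<dots> = r (f (op a z))" using act F(2) az by simp
  also have "\<dots> = r (op' a (f z))"
    using quotient_map_eq_iff[OF R] f F(3) act(2) act'(2) az by simp
  also have "\<dots> = \<sigma> g (F m)"
    using \<sigma> az act'(1) F(2,3) quotient_mapD(8)[OF R] by (simp add: square_class_module_def)
  finally show "F (\<rho> g m) = \<sigma> g (F m)" .
qed

section \<open>The actions on A/M and on the homology of E_2\<close>

lemma quotient_A: "quotient_map A_mod_M UNIV (subgroup_M :: 'a::comm_ring_unit set) (coset subgroup_M)"
  using quotient_map_record[of UNIV "subgroup_M :: 'a set"] add_subgroup_M
  by (simp add: A_mod_M_def additive_group_def add_subgroup_def)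

lemma mult_action_coset:
  assumes a: "a \<in> units"
  shows "mult_action a (coset subgroup_M z) = coset subgroup_M (a * (z :: 'a::comm_ring_unit))"
proof -
  obtain b where b: "b \<in> units" "a * b = 1"
    using a unfolding carrier_unit_group by (metis mult.commute)
  have "(*) a ` subgroup_M = subgroup_M"
  proof (intro equalityI subsetI)
    fix x :: 'a assume x: "x \<in> subgroup_M"
    have "x = a * (b * x)" using b by (simp flip: mult.assoc)
    then show "x \<in> (*) a ` subgroup_M" using M_mult_unit[OF b(1) x] by (rule image_eqI)
  qed (use M_mult_unit[OF a] in auto)
  then show ?thesis
    unfolding mult_action_def by (intro image_coset) (simp_all add: Modules.additive_def distrib_left)
qed

lemma square_class_module_A:
  "\<exists>\<rho>. square_class_module (A_mod_M :: 'a::comm_ring_unit set monoid) mult_action \<rho>"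
proof (rule quotient_square_class_module[where op = "(*)", OF quotient_A mult_action_coset])
  show "a * a * z - z \<in> subgroup_M" if "a \<in> units" for a z :: 'a
    using M_square[OF that, of z] by (simp add: right_diff_distrib mult.commute)
qed (auto simp: distrib_left mult.assoc M_intros(1))

lemma quotient_H:
  "quotient_map (group_homology n E2) (cycles (bar_basis E2) (bar_boundary E2) n)
     (boundaries (bar_basis E2) (bar_boundary E2) n)
     (coset (boundaries (bar_basis E2) (bar_boundary (E2 :: 'a::comm_ring_unit mat monoid)) n))"
  if "n = 1 \<or> n = 2"
  unfolding group_homology_def
  using that group.boundaries_bar_1[OF group_E2] group.boundaries_bar_2[OF group_E2]
  by (intro homology_quotient_map) auto

lemma conj_diag_E2_hom:
  assumes "u * v = (1 :: 'a::comm_ring_unit)"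
  shows "conj_by (diag2 u 1) \<in> hom E2 E2"
  using elementary_twist.\<theta>_hom[OF elementary_twist_E2[OF assms]] .

lemma conj_diag_mult:
  assumes "u * v = 1" "u' * v' = (1 :: 'a::comm_ring_unit)" "A \<in> carrier E2"
  shows "conj_by (diag2 (u * u') 1) A = conj_by (diag2 u 1) (conj_by (diag2 u' 1) A)"
proof -
  obtain a b c d where A: "A = m2 a b c d" using assms(3) by (rule E2_cases)
  have one: "1 * 1 = (1 :: 'a)" by simp
  show ?thesis
    unfolding A conj_by_diag2[OF assms(1) one] conj_by_diag2[OF assms(2) one]
      conj_by_diag2[OF unit_mult[OF assms(1,2)] one]
    by (simp add: ac_simps)
qed

lemma conj_diag_one:
  assumes "A \<in> carrier E2"
  shows "conj_by (diag2 1 1) A = (A :: 'a::comm_ring_unit mat)"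
proof -
  obtain a b c d where A: "A = m2 a b c d" using assms by (rule E2_cases)
  have one: "1 * 1 = (1 :: 'a)" by simp
  show ?thesis unfolding A conj_by_diag2[OF one one] by simp
qed

text \<open>diag(u^2, 1) is the central scalar u times diag(u, u^-1), and the latter lies in E_2. So
  squares act by inner automorphisms of E_2.\<close>

lemma conj_diag_square:
  assumes uv: "u * v = (1 :: 'a::comm_ring_unit)" and "A \<in> carrier E2"
  shows "conj_by (diag2 (u * u) 1) A = diag2 u v \<otimes>\<^bsub>E2\<^esub> A \<otimes>\<^bsub>E2\<^esub> inv\<^bsub>E2\<^esub> (diag2 u v)"
proof -
  obtain a b c d where A: "A = m2 a b c d" using assms(2) by (rule E2_cases)
  have one: "1 * 1 = (1 :: 'a)" and vu: "v * u = 1" using uv by (simp_all add: mult.commute)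
  have "conj_by (diag2 (u * u) 1) A = conj_by (diag2 u v) A"
    unfolding A conj_by_diag2[OF unit_mult[OF uv uv] one] conj_by_diag2[OF uv vu] by simp
  then show ?thesis using diag_E2[OF uv] by (simp add: conj_by_def)
qed

lemma bar_chain_eq:
  assumes "supported c (bar_basis E2 n)" "\<And>A. A \<in> carrier E2 \<Longrightarrow> f A = g A"
  shows "tuple_chain_map f c = tuple_chain_map g c"
  using assms(1) by (rule tuple_chain_map_cong) (use assms(2) in \<open>auto simp: bar_basis_def\<close>)

context
  fixes B :: "nat \<Rightarrow> 'a::comm_ring_unit mat list set" and d :: "'a mat list \<Rightarrow> ('a mat list \<Rightarrow>\<^sub>0 int)"
  defines "B \<equiv> bar_basis E2" and "d \<equiv> bar_boundary E2"
begin

lemma keys_boundaries: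
  "n = 1 \<or> n = 2 \<Longrightarrow> c \<in> boundaries B d n \<Longrightarrow> supported c (B n)"
  using quotient_mapD(4)[OF quotient_H[of n, where 'a = 'a]] unfolding B_def d_def by (auto simp: cycles_def)

lemma conj_inverse:
  assumes uv: "u * v = (1 :: 'a)" and c: "supported c (B n)"
  shows "conj_chain u (conj_chain v c) = c"
proof -
  have vu: "v * u = 1" using uv by (simp add: mult.commute)
  have "tuple_chain_map (\<lambda>A. conj_by (diag2 u 1) (conj_by (diag2 v 1) A)) c = tuple_chain_map (\<lambda>A. A) c"
    using c unfolding B_def by (rule bar_chain_eq) (simp add: uv conj_diag_one del: EA.D_one flip: conj_diag_mult[OF uv vu])
  also have "\<dots> = c" using tuple_chain_map_id[of c "B n"] c by simp
  finally show ?thesis by (simp add: tuple_chain_map_compose)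
qed

lemma conj_boundaries:
  assumes uv: "u * v = (1 :: 'a)" and n: "n = 1 \<or> n = 2"
  shows "conj_chain u ` boundaries B d n = boundaries B d n"
proof (intro equalityI subsetI)
  have sub: "conj_chain u c \<in> boundaries B d n"
    if "c \<in> boundaries B d n" "u * v = 1" for c u v
    unfolding B_def d_def
    by (rule tuple_chain_map_boundaries[OF that(1)[unfolded B_def d_def]])
       (auto intro: map_bar_basis[OF conj_diag_E2_hom[OF that(2)]] bar_boundary_map[OF conj_diag_E2_hom[OF that(2)]])
  show "c \<in> boundaries B d n" if "c \<in> conj_chain u ` boundaries B d n" for c
    using that sub uv by auto
  fix c assume c: "c \<in> boundaries B d n"
  have vu: "v * u = 1" using uv by (simp add: mult.commute)
  show "c \<in> conj_chain u ` boundaries B d n"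
    by (rule image_eqI[OF _ sub[OF c vu]]) (rule conj_inverse[OF uv keys_boundaries[OF n c], symmetric])
qed

lemma conj_action_coset:
  assumes a: "a \<in> units" and n: "n = 1 \<or> n = 2"
  shows "conj_action a (coset (boundaries B d n) z) =
     coset (boundaries B d n) (conj_chain (a :: 'a) z)"
proof -
  obtain b where "a * b = 1" using a by (auto simp: carrier_unit_group)
  then show ?thesis
    unfolding conj_action_def by (intro image_coset additive_tuple_chain_map conj_boundaries n)
qed

lemma conj_cycles:
  assumes a: "(a :: 'a) \<in> units" and z: "z \<in> cycles B d n"
  shows "conj_chain a z \<in> cycles B d n"
proof -
  obtain b where ab: "a * b = 1" using a by (auto simp: carrier_unit_group)
  show ?thesis
    unfolding B_def d_def
    by (rule tuple_chain_map_cycles[OF z[unfolded B_def d_def]])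
       (auto intro: map_bar_basis[OF conj_diag_E2_hom[OF ab]] bar_boundary_map[OF conj_diag_E2_hom[OF ab]])
qed

lemma square_class_module_H:
  assumes n: "n = 1 \<or> n = 2"
  shows "\<exists>\<rho>. square_class_module (group_homology n E2) (conj_action :: 'a \<Rightarrow> _) \<rho>"
proof (rule quotient_square_class_module[where op = "conj_chain", OF quotient_H[OF n] conj_action_coset[unfolded B_def d_def]])
  fix a b :: 'a and x y z :: "'a mat list \<Rightarrow>\<^sub>0 int"
  let ?Z = "cycles (bar_basis E2) (bar_boundary E2) n" and ?N = "boundaries (bar_basis E2) (bar_boundary E2) n"
  note zero = add_subgroup_zero[OF boundaries_subgroup]
  assume a: "a \<in> units"
  then obtain a' where a': "a * a' = 1" by (auto simp: carrier_unit_group)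
  show "n = 1 \<or> n = 2" by (rule n)
  show "conj_chain a (x + y) =
    conj_chain a x + conj_chain a y"
    by (rule tuple_chain_map_simps(1))
  assume z: "z \<in> ?Z"
  then have k: "supported z (bar_basis E2 n)" by (simp add: cycles_def)
  show "conj_chain a z \<in> ?Z"
    using conj_cycles[OF a] z unfolding B_def d_def by blast
  have "conj_chain (a * a) z
      = tuple_chain_map (\<lambda>A. diag2 a a' \<otimes>\<^bsub>E2\<^esub> A \<otimes>\<^bsub>E2\<^esub> inv\<^bsub>E2\<^esub> (diag2 a a')) z"
    using k by (rule bar_chain_eq) (rule conj_diag_square[OF a'])
  then show "conj_chain (a * a) z - z \<in> ?N"
    using group.conj_trivial_1[OF group_E2 diag_E2[OF a']] group.conj_trivial_2[OF group_E2 diag_E2[OF a']] n k z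
    by auto
  assume b: "b \<in> units"
  then obtain b' where b': "b * b' = 1" by (auto simp: carrier_unit_group)
  have "conj_chain (a * b) z =
     conj_chain a (conj_chain b z)"
    unfolding tuple_chain_map_compose using k by (rule bar_chain_eq) (rule conj_diag_mult[OF a' b'])
  then show "conj_chain (a * b) z -
     conj_chain a (conj_chain b z) \<in> ?N"
    using zero by simp
next
  fix z :: "'a mat list \<Rightarrow>\<^sub>0 int"
  assume "z \<in> cycles (bar_basis E2) (bar_boundary E2) n"
  then have "supported z (bar_basis E2 n)" by (simp add: cycles_def)
  then have "conj_chain 1 z = tuple_chain_map (\<lambda>A. A) z"
    by (rule bar_chain_eq) (rule conj_diag_one)
  moreover have "tuple_chain_map (\<lambda>A. A) z = z" using tuple_chain_map_id[of z UNIV] by simp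
  ultimately show "conj_chain 1 z - z \<in> boundaries (bar_basis E2) (bar_boundary E2) n"
    using add_subgroup_zero[OF boundaries_subgroup] by simp
qed

end

section \<open>Coinvariants\<close>

context elementary_action
begin

lemma tact_inverse:
  assumes g: "g \<in> carrier G" and c: "chain1 c"
  shows "tact g (tact (inv g) c) = c"
proof -
  have "tact g (tact (inv g) c) = tuple_chain_map (\<lambda>l. act g (act (inv g) l)) c"
    by (rule tuple_chain_map_compose)
  also have "\<dots> = c"
  proof (rule tuple_chain_map_id[OF c])
    fix l assume "l \<in> Y1"
    then show "map (\<lambda>l. act g (act (inv g) l)) l = l"
      using g by (auto simp: Y1_def edge_def act_act simp flip: m_assoc)
  qed
  finally show ?thesis .
qed

lemma tact_B1: "g \<in> carrier G \<Longrightarrow> tact g ` B1 = B1"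
proof (intro equalityI subsetI)
  have sub: "tact g z \<in> B1" if g: "g \<in> carrier G" and z: "z \<in> B1" for g z
  proof -
    obtain c where c: "z = bdy c" "supported c Y2" using z by (auto simp: B1_def)
    have 1: "map (act g) l \<in> Y2" if l: "l \<in> Y2" for l
    proof -
      obtain h a where h: "l = tri h a" "h \<in> carrier G" "a \<in> units" using l by (auto simp: Y2_def)
      then have "map (act g) l = tri (g \<otimes> h) a" using g by (simp add: tri_def act_act m_assoc)
      then show ?thesis unfolding Y2_def using g h by blast
    qed
    have "Y_boundary (map (act g) l) = tact g (Y_boundary l)" if "l \<in> Y2" for l
      using that by (auto simp: Y2_def tri_def Y_boundary_def numeral_2_eq_2 tuple_chain_map_simps)
    then have "bdy (tact g c) = tact g z"
      unfolding c(1) by (rule tuple_chain_map_commute[OF c(2)])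
    moreover have "supported (tact g c) Y2" using c(2) by (rule tuple_chain_map_keys) (rule 1)
    ultimately show ?thesis unfolding B1_def by (intro image_eqI[of _ _ "tact g c"]) auto
  qed
  assume g: "g \<in> carrier G"
  show "z \<in> B1" if "z \<in> tact g ` B1" for z using that sub g by auto
  fix z assume z: "z \<in> B1"
  then have "chain1 z" using B1_Z1 by (auto simp: Z1_def)
  then show "z \<in> tact g ` B1"
    using sub[of "inv g" z] z g by (intro image_eqI[of _ _ "tact (inv g) z"]) (simp_all add: tact_inverse)
qed

text \<open>Matches the subgroup generated by cosets in \<open>coinvariants\<close> with
  \<open>N\<close>: one inclusion is an induction over the generated elements, the other is the
  minimality of \<open>N\<close>.\<close>

lemma quotient_coinvariants:
  fixes Q :: "('l list \<Rightarrow>\<^sub>0 int) set monoid"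
  assumes Q: "quotient_map Q Z1 B1 (coset B1)"
    and K: "K = generate Q {(\<lambda>C. tact g ` C) m \<otimes>\<^bsub>Q\<^esub> inv\<^bsub>Q\<^esub> m | g m. g \<in> carrier G \<and> m \<in> carrier Q}"
  shows "quotient_map (Q Mod K) Z1 N (\<lambda>z. K #>\<^bsub>Q\<^esub> coset B1 z)" "K \<subseteq> carrier Q" "K = coset B1 ` N"
proof -
  note Q' = quotient_mapD[OF Q]
  interpret Q: comm_group Q by (rule Q'(1))
  let ?X = "{tact g ` m \<otimes>\<^bsub>Q\<^esub> inv\<^bsub>Q\<^esub> m | g m. g \<in> carrier G \<and> m \<in> carrier Q}"
  have diff: "coset B1 (x - y) = coset B1 x \<otimes>\<^bsub>Q\<^esub> inv\<^bsub>Q\<^esub> coset B1 y" if "x \<in> Z1" "y \<in> Z1" for x y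
    using Q'(6)[of "x - y" y] that Q'(8) add_subgroup_diff[OF Q'(2) that] by (simp add: Q.inv_solve_right)
  have act: "tact g ` coset B1 z = coset B1 (tact g z)" if "g \<in> carrier G" for g z
    by (intro image_coset additive_tuple_chain_map tact_B1 that)
  have X: "?X = {coset B1 (tact g z - z) | g z. g \<in> carrier G \<and> z \<in> Z1}"
  proof -
    have "?X = {tact g ` coset B1 z \<otimes>\<^bsub>Q\<^esub> inv\<^bsub>Q\<^esub> coset B1 z | g z. g \<in> carrier G \<and> z \<in> Z1}"
      unfolding Q'(5)[symmetric] by blast
    also have "\<dots> = {coset B1 (tact g z - z) | g z. g \<in> carrier G \<and> z \<in> Z1}"
      by (rule Collect_cong) (metis act diff tact_Z1)
    finally show ?thesis .
  qed
  have X_sub: "?X \<subseteq> carrier Q"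
    unfolding X using Q'(8) add_subgroup_diff[OF Q'(2)] tact_Z1 by blast
  show K_sub: "K \<subseteq> carrier Q" unfolding K using Q.generate_incl[OF X_sub] by simp
  have sub: "subgroup K Q" unfolding K using Q.generate_is_subgroup[OF X_sub] by simp
  note QK = quotient_map_Mod[OF Q sub]
  \<comment> \<open>All representatives are quantified over, since products and inverses are formed
    on cosets and do not keep a given representative.\<close>
  have K_N: "\<forall>z\<in>Z1. coset B1 z = C \<longrightarrow> z \<in> N" if "C \<in> K" for C
    using that unfolding K
  proof (induction rule: generate.induct)
    case one
    then show ?case using Q'(7) B1_N by auto
  next
    case (incl h)
    then obtain g x where h: "h = coset B1 (tact g x - x)" "g \<in> carrier G" "x \<in> Z1" using X by auto
    have t: "tact g x - x \<in> N" by (rule tact_N[OF h(2,3)])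
    show ?case
    proof (intro ballI impI)
      fix z assume z: "z \<in> Z1" "coset B1 z = h"
      then have "z - (tact g x - x) \<in> N"
        using quotient_map_eq_iff[OF Q z(1)] h t N_Z1 B1_N by blast
      then have "z - (tact g x - x) + (tact g x - x) \<in> N" using t by (rule N_intros(4))
      then show "z \<in> N" by simp
    qed
  next
    case (inv h)
    then obtain g x where h: "h = coset B1 (tact g x - x)" "g \<in> carrier G" "x \<in> Z1" using X by auto
    have t: "tact g x - x \<in> N" by (rule tact_N[OF h(2,3)])
    show ?case
    proof (intro ballI impI)
      fix z assume z: "z \<in> Z1" "coset B1 z = inv\<^bsub>Q\<^esub> h"
      have tz: "tact g x - x \<in> Z1" using t N_Z1 by blast
      have "coset B1 (z + (tact g x - x)) = \<one>\<^bsub>Q\<^esub>"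
        using Q'(6)[OF z(1) tz] z(2) h(1) Q'(8)[OF tz] by simp
      then have "z + (tact g x - x) \<in> N"
        using Q'(7) add_subgroup_add[OF Q'(2) z(1) tz] B1_N by blast
      then have "z + (tact g x - x) - (tact g x - x) \<in> N" using t by (rule N_intros(2))
      then show "z \<in> N" by simp
    qed
  next
    case (eng h1 h2)
    have "h1 \<in> carrier Q" "h2 \<in> carrier Q" using eng.hyps K_sub unfolding K by auto
    then obtain x y where xy: "x \<in> Z1" "y \<in> Z1" "h1 = coset B1 x" "h2 = coset B1 y"
      unfolding Q'(5)[symmetric] by blast
    then have N: "x \<in> N" "y \<in> N" using eng.IH by auto
    show ?case
    proof (intro ballI impI)
      fix z assume z: "z \<in> Z1" "coset B1 z = h1 \<otimes>\<^bsub>Q\<^esub> h2"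
      have "coset B1 z = coset B1 (x + y)" using Q'(6) xy z by simp
      then have "z - (x + y) \<in> N"
        using quotient_map_eq_iff[OF Q z(1) add_subgroup_add[OF Q'(2) xy(1,2)]] B1_N by blast
      then have "z - (x + y) + (x + y) \<in> N" using N by (intro N_intros(4))
      then show "z \<in> N" by simp
    qed
  qed
  have "N \<subseteq> {z \<in> Z1. coset B1 z \<in> K}"
  proof (rule N_least[OF quotient_mapD(3)[OF QK]])
    show "B1 \<subseteq> {z \<in> Z1. coset B1 z \<in> K}"
    proof
      fix z assume z: "z \<in> B1"
      then have "z \<in> Z1" using B1_Z1 by blast
      moreover from this have "coset B1 z = \<one>\<^bsub>Q\<^esub>" using Q'(7) z by blast
      ultimately show "z \<in> {z \<in> Z1. coset B1 z \<in> K}" using subgroup.one_closed[OF sub] by simp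
    qed
    fix g z assume gz: "g \<in> carrier G" "z \<in> Z1"
    then have "coset B1 (tact g z - z) \<in> ?X" unfolding X by blast
    then have "coset B1 (tact g z - z) \<in> K" unfolding K by (intro generate.incl) simp
    then show "tact g z - z \<in> {z \<in> Z1. coset B1 z \<in> K}"
      using gz tact_Z1 add_subgroup_diff[OF Q'(2)] by blast
  qed
  then have N_eq: "{z \<in> Z1. coset B1 z \<in> K} = N" using K_N by blast
  show "quotient_map (Q Mod K) Z1 N (\<lambda>z. K #>\<^bsub>Q\<^esub> coset B1 z)" using QK unfolding N_eq .
  show "K = coset B1 ` N"
    using K_sub unfolding N_eq[symmetric] Q'(5)[symmetric] by blast
qed

end

section \<open>The coinvariants of H_1(Y) for E_2\<close>

lemma EA_Z1: "EA.Z1 = cycles Y_basis Y_boundary (1 :: nat)"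
  and EA_B1: "EA.B1 = boundaries Y_basis Y_boundary (1 :: nat)"
proof -
  show "EA.Z1 = cycles Y_basis Y_boundary (1 :: nat)"
    unfolding EA.Z1_def cycles_def Y_basis_1 by simp
  have "Suc 1 = (2 :: nat)" by simp
  then show "EA.B1 = boundaries Y_basis Y_boundary (1 :: nat)"
    unfolding EA.B1_def boundaries_def by (simp only: Y_basis_2) (simp add: free_Abelian_group_def)
qed

lemma quotient_H1_Y: "quotient_map H1_Y EA.Z1 EA.B1 (coset (EA.B1 :: ('a::comm_ring_unit vec set list \<Rightarrow>\<^sub>0 int) set))"
  using homology_quotient_map[of Y_basis Y_boundary 1] EA.B1_Z1
  unfolding H1_Y_def EA_Z1 EA_B1 by blast

definition Y_kernel :: "('a::comm_ring_unit vec set list \<Rightarrow>\<^sub>0 int) set set" where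
  "Y_kernel = generate H1_Y {H1_Y_action g m \<otimes>\<^bsub>H1_Y\<^esub> inv\<^bsub>H1_Y\<^esub> m | g m. g \<in> carrier E2 \<and> m \<in> carrier H1_Y}"

definition Y_class :: "('a::comm_ring_unit vec set list \<Rightarrow>\<^sub>0 int) \<Rightarrow> ('a vec set list \<Rightarrow>\<^sub>0 int) set set" where
  "Y_class z = Y_kernel #>\<^bsub>H1_Y\<^esub> coset EA.B1 z"

lemma H1_Y_action_eq: "H1_Y_action g C = tuple_chain_map (mat_act g) ` C"
  by (simp add: H1_Y_action_def mat_act_def[abs_def])

lemma Y_kernel_eq: "Y_kernel = generate H1_Y {(\<lambda>C. tuple_chain_map (mat_act g) ` C) m \<otimes>\<^bsub>H1_Y\<^esub> inv\<^bsub>H1_Y\<^esub> m | g m.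
    g \<in> carrier E2 \<and> m \<in> carrier H1_Y}"
  unfolding Y_kernel_def H1_Y_action_eq ..

lemma quotient_H1_Y_E2: "quotient_map H1_Y_E2 EA.Z1 EA.N (Y_class :: ('a::comm_ring_unit vec set list \<Rightarrow>\<^sub>0 int) \<Rightarrow> _)"
  using EA.quotient_coinvariants(1)[OF quotient_H1_Y Y_kernel_eq]
  by (simp add: H1_Y_E2_def coinvariants_def Y_class_def[abs_def] Y_kernel_def)

lemma mat_act_diag_mult:
  "mat_act (diag2 (a * b) 1) (line (v2 x y)) = mat_act (diag2 a 1) (mat_act (diag2 b 1) (line (v2 x (y :: 'a::comm_ring_unit))))"
  by (simp add: diag2_m2 mat_act_line mult.assoc)

text \<open>diag(a^2, 1) is a times diag(a, b), and a unit scalar fixes every line. So squares act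
  on lines as elements of E_2 do.\<close>

lemma mat_act_diag_square:
  assumes "a * b = (1 :: 'a::comm_ring_unit)"
  shows "mat_act (diag2 (a * a) 1) (line (v2 x y)) = mat_act (diag2 a b) (line (v2 x y))"
proof -
  have "a * (b * y) = y" using assms by (simp flip: mult.assoc)
  then show ?thesis using line_unit[OF assms, of "a * x" "b * y"] by (simp add: diag2_m2 mat_act_line mult.assoc)
qed

lemma EA_chain_eq:
  assumes "supported c EA.Y1" "\<And>x y :: 'a::comm_ring_unit. f (line (v2 x y)) = g (line (v2 x y))"
  shows "tuple_chain_map f c = tuple_chain_map g c"
  using assms(1)
proof (rule tuple_chain_map_cong)
  fix l :: "'a vec set list" assume "l \<in> EA.Y1"
  then obtain A where A: "A \<in> carrier E2" "l = EA.edge A" by (auto simp: EA.Y1_def)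
  obtain p q r s where A': "A = m2 p q r s" using A(1) by (rule E2_cases)
  show "map f l = map g l" unfolding A(2) A' EA_edge[OF A(1)[unfolded A']] by (simp add: assms(2))
qed

lemma diag_inverse:
  assumes uv: "u * v = (1 :: 'a::comm_ring_unit)" and c: "supported c EA.Y1"
  shows "act_chain u (act_chain v c) = c"
proof -
  have "tuple_chain_map (\<lambda>l. mat_act (diag2 u 1) (mat_act (diag2 v 1) l)) c = tuple_chain_map (\<lambda>l. l) c"
    by (rule EA_chain_eq[OF c]) (simp add: diag2_m2 mat_act_line uv flip: mult.assoc)
  moreover have "tuple_chain_map (\<lambda>l. l) c = c" using tuple_chain_map_id[of c UNIV] by simp
  ultimately show ?thesis by (simp add: tuple_chain_map_compose)
qed

lemma diag_image:
  assumes uv: "u * v = (1 :: 'a::comm_ring_unit)" and X: "X \<subseteq> EA.Z1"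
    and sub: "\<And>u v z. u * v = (1 :: 'a) \<Longrightarrow> z \<in> X \<Longrightarrow> act_chain u z \<in> X"
  shows "act_chain u ` X = X"
proof (intro equalityI subsetI)
  fix z assume z: "z \<in> X"
  have vu: "v * u = 1" using uv by (simp add: mult.commute)
  have "supported z EA.Y1" using z X by (auto simp: EA.Z1_def)
  then show "z \<in> act_chain u ` X"
    by (intro image_eqI[OF _ sub[OF vu z]]) (simp add: diag_inverse[OF uv])
qed (use sub uv in auto)

lemma diag_N_image: "u * v = (1 :: 'a::comm_ring_unit) \<Longrightarrow> act_chain u ` EA.N = EA.N"
  by (erule diag_image[OF _ EA.N_Z1]) (rule elementary_twist.t\<delta>_N[OF elementary_twist_E2])

lemma diag_B1_image: "u * v = (1 :: 'a::comm_ring_unit) \<Longrightarrow> act_chain u ` EA.B1 = EA.B1"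
  by (erule diag_image[OF _ EA.B1_Z1]) (rule elementary_twist.t\<delta>_B1[OF elementary_twist_E2])

lemma diag_Z1:
  "a \<in> units \<Longrightarrow> z \<in> EA.Z1 \<Longrightarrow> act_chain (a :: 'a::comm_ring_unit) z \<in> EA.Z1"
  using elementary_twist.t\<delta>_Z1[OF elementary_twist_E2] by (auto simp: carrier_unit_group)

text \<open>The action is an image of an image, so the coset formula is used twice: once for
  boundaries inside cycles, once for \<open>Y_kernel\<close> inside H_1(Y).\<close>

lemma H1_Y_E2_action_class:
  assumes a: "a \<in> units" and z: "z \<in> EA.Z1"
  shows "H1_Y_E2_action a (Y_class z) = Y_class (act_chain (a :: 'a::comm_ring_unit) z)"
proof -
  let ?t = "act_chain a" and ?f = "H1_Y_action (diag2 a 1)"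
  obtain b where ab: "a * b = 1" using a by (auto simp: carrier_unit_group)
  note Q = quotient_mapD[OF quotient_H1_Y[where 'a = 'a]]
  have f: "?f (coset EA.B1 z) = coset EA.B1 (?t z)" for z
    unfolding H1_Y_action_eq by (intro image_coset additive_tuple_chain_map diag_B1_image[OF ab])
  have "?f \<in> hom H1_Y H1_Y"
  proof (rule homI)
    show "?f C \<in> carrier H1_Y" if "C \<in> carrier H1_Y" for C
      using that Q(8) diag_Z1[OF a] unfolding Q(5)[symmetric] by (auto simp: f)
    fix C C' :: "('a vec set list \<Rightarrow>\<^sub>0 int) set" assume "C \<in> carrier H1_Y" "C' \<in> carrier H1_Y"
    then obtain x y where xy: "x \<in> EA.Z1" "y \<in> EA.Z1" "C = coset EA.B1 x" "C' = coset EA.B1 y"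
      unfolding Q(5)[symmetric] by blast
    have "?f (C \<otimes>\<^bsub>H1_Y\<^esub> C') = ?f (coset EA.B1 (x + y))" using xy Q(6) by simp
    also have "\<dots> = coset EA.B1 (?t x + ?t y)" by (simp add: f tuple_chain_map_simps)
    also have "\<dots> = ?f C \<otimes>\<^bsub>H1_Y\<^esub> ?f C'" using xy Q(6) diag_Z1[OF a] by (simp add: f)
    finally show "?f (C \<otimes>\<^bsub>H1_Y\<^esub> C') = ?f C \<otimes>\<^bsub>H1_Y\<^esub> ?f C'" .
  qed
  moreover have "?f ` Y_kernel = Y_kernel"
  proof -
    have "?f ` Y_kernel = coset EA.B1 ` (?t ` EA.N)"
      unfolding EA.quotient_coinvariants(3)[OF quotient_H1_Y Y_kernel_eq] by (simp add: image_image f)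
    then show ?thesis
      unfolding diag_N_image[OF ab] EA.quotient_coinvariants(3)[OF quotient_H1_Y Y_kernel_eq] .
  qed
  ultimately have "?f ` (Y_kernel #>\<^bsub>H1_Y\<^esub> coset EA.B1 z) = Y_kernel #>\<^bsub>H1_Y\<^esub> ?f (coset EA.B1 z)"
    using EA.quotient_coinvariants(2)[OF quotient_H1_Y Y_kernel_eq] Q(1) Q(8)[OF z]
    by (intro image_r_coset_hom) (auto simp: comm_group_def)
  then show ?thesis unfolding H1_Y_E2_action_def Y_class_def f .
qed

lemma square_class_module_Y:
  "\<exists>\<rho>. square_class_module H1_Y_E2 (H1_Y_E2_action :: 'a::comm_ring_unit \<Rightarrow> _) \<rho>"
proof (rule quotient_square_class_module[where op = "act_chain",
      OF quotient_H1_Y_E2 H1_Y_E2_action_class diag_Z1])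
  fix a b :: 'a and x y z :: "'a vec set list \<Rightarrow>\<^sub>0 int"
  show "act_chain a (x + y) =
    act_chain a x + act_chain a y"
    by (rule tuple_chain_map_simps(1))
  assume z: "z \<in> EA.Z1"
  then have k: "supported z EA.Y1" by (simp add: EA.Z1_def)
  have "act_chain 1 z = tuple_chain_map (\<lambda>l. l) z"
    by (rule EA_chain_eq[OF k]) (simp add: mat_act_line)
  moreover have "tuple_chain_map (\<lambda>l. l) z = z" using tuple_chain_map_id[of z UNIV] by simp
  ultimately show "act_chain 1 z - z \<in> EA.N" using EA.N_intros(1) by simp
  assume a: "a \<in> units"
  then obtain a' where a': "a * a' = 1" by (auto simp: carrier_unit_group)
  have "act_chain (a * a) z = tuple_chain_map (mat_act (diag2 a a')) z"
    by (rule EA_chain_eq[OF k]) (rule mat_act_diag_square[OF a'])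
  then show "act_chain (a * a) z - z \<in> EA.N"
    using EA.tact_N[OF diag_E2[OF a'] z] by simp
  have "act_chain (a * b) z =
      act_chain a (act_chain b z)"
    unfolding tuple_chain_map_compose by (rule EA_chain_eq[OF k]) (rule mat_act_diag_mult)
  then show "act_chain (a * b) z -
      act_chain a (act_chain b z) \<in> EA.N"
    using EA.N_intros(1) by simp
qed

section \<open>The exact sequence\<close>

theorem theorem4p1:
  shows "\<exists>(\<rho>\<^sub>H\<^sub>2 :: 'a::comm_ring_unit set \<Rightarrow> ('a mat list \<Rightarrow>\<^sub>0 int) set \<Rightarrow> ('a mat list \<Rightarrow>\<^sub>0 int) set)
      (\<rho>\<^sub>Y :: 'a set \<Rightarrow> ('a vec set list \<Rightarrow>\<^sub>0 int) set set \<Rightarrow> ('a vec set list \<Rightarrow>\<^sub>0 int) set set)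
      (\<rho>\<^sub>A :: 'a set \<Rightarrow> 'a set \<Rightarrow> 'a set)
      (\<rho>\<^sub>H\<^sub>1 :: 'a set \<Rightarrow> ('a mat list \<Rightarrow>\<^sub>0 int) set \<Rightarrow> ('a mat list \<Rightarrow>\<^sub>0 int) set)
      \<alpha> \<beta> \<gamma>.
      square_class_module (group_homology 2 E2) conj_action \<rho>\<^sub>H\<^sub>2 \<and>
      square_class_module H1_Y_E2 H1_Y_E2_action \<rho>\<^sub>Y \<and>
      square_class_module A_mod_M mult_action \<rho>\<^sub>A \<and>
      square_class_module (group_homology 1 E2) conj_action \<rho>\<^sub>H\<^sub>1 \<and>
      \<alpha> \<in> equivariant_hom square_class_group (group_homology 2 E2) \<rho>\<^sub>H\<^sub>2 H1_Y_E2 \<rho>\<^sub>Y \<and>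
      \<beta> \<in> equivariant_hom square_class_group H1_Y_E2 \<rho>\<^sub>Y A_mod_M \<rho>\<^sub>A \<and>
      \<gamma> \<in> equivariant_hom square_class_group A_mod_M \<rho>\<^sub>A (group_homology 1 E2) \<rho>\<^sub>H\<^sub>1 \<and>
      (\<forall>x::'a. \<gamma> (subgroup_M #>\<^bsub>additive_group\<^esub> x) = H1_class E2 (E12 x)) \<and>
      \<alpha> ` carrier (group_homology 2 E2) = kernel H1_Y_E2 A_mod_M \<beta> \<and>
      \<beta> ` carrier H1_Y_E2 = kernel A_mod_M (group_homology 1 E2) \<gamma> \<and>
      \<gamma> ` carrier A_mod_M = carrier (group_homology 1 E2)"
proof -
  let ?Z = "cycles (bar_basis E2) (bar_boundary (E2 :: 'a mat monoid))"
  let ?D = "boundaries (bar_basis E2) (bar_boundary (E2 :: 'a mat monoid))"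
  have QH2: "quotient_map (group_homology 2 E2) (?Z 2) (?D 2) (coset (?D 2))" by (rule quotient_H) simp
  have QH1: "quotient_map (group_homology 1 E2) (?Z 1) (?D 1) (coset (?D 1))" by (rule quotient_H) simp
  note QY = quotient_H1_Y_E2[where 'a = 'a] and QA = quotient_A[where 'a = 'a]
  note H2 = quotient_mapD[OF QH2] and H1 = quotient_mapD[OF QH1]
    and Y = quotient_mapD[OF QY] and A = quotient_mapD[OF QA]
  have D1: "EA.D1 = ?D 1"
  proof -
    have "Suc 1 = (2 :: nat)" by simp
    then show ?thesis unfolding EA.D1_def boundaries_def by (simp only:) (simp add: free_Abelian_group_def)
  qed
  have Z2: "z \<in> ?Z 2 \<longleftrightarrow> supported z (bar_basis E2 2) \<and> EA.bar_bdy z = 0" for z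
    by (simp add: cycles_def)
  have U1: "frag_of [E12 x] \<in> ?Z 1" for x
    unfolding cycles_bar_1 by (simp add: bar_basis_1)
  have act2: "conj_action a (coset (?D 2) z) = coset (?D 2) (conj_chain a z)" "conj_chain a z \<in> ?Z 2"
    if "a \<in> units" "z \<in> ?Z 2" for a z
    using conj_action_coset[OF that(1)] conj_cycles[OF that] by auto
  have act1: "conj_action a (coset (?D 1) z) = coset (?D 1) (conj_chain a z)" "conj_chain a z \<in> ?Z 1"
    if "a \<in> units" "z \<in> ?Z 1" for a z
    using conj_action_coset[OF that(1), of 1] conj_cycles[OF that] by auto
  have actA: "mult_action a (coset subgroup_M z) = coset subgroup_M (a * z)" "a * z \<in> UNIV"
    if "a \<in> units" "z \<in> UNIV" for a z :: 'a
    using mult_action_coset[OF that(1)] by auto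
  obtain \<rho>2 where \<rho>2: "square_class_module (group_homology 2 E2) (conj_action :: 'a \<Rightarrow> _) \<rho>2"
    using square_class_module_H[of 2] by auto
  obtain \<rho>1 where \<rho>1: "square_class_module (group_homology 1 E2) (conj_action :: 'a \<Rightarrow> _) \<rho>1"
    using square_class_module_H[of 1] by auto
  obtain \<rho>Y where \<rho>Y: "square_class_module H1_Y_E2 (H1_Y_E2_action :: 'a \<Rightarrow> _) \<rho>Y"
    using square_class_module_Y by auto
  obtain \<rho>A where \<rho>A: "square_class_module A_mod_M (mult_action :: 'a \<Rightarrow> _) \<rho>A"
    using square_class_module_A by auto
  have aZ: "EA.alpha z \<in> EA.Z1" if "z \<in> ?Z 2" for z
    using that EA.alpha_Z1 Z2 by blast
  obtain \<alpha> where \<alpha>: "\<alpha> \<in> hom (group_homology 2 E2) H1_Y_E2"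
    "\<And>z. z \<in> ?Z 2 \<Longrightarrow> \<alpha> (coset (?D 2) z) = Y_class (EA.alpha z)"
  proof (rule quotient_map_induced[OF QH2 QY, of EA.alpha])
    show "EA.alpha (x + y) - (EA.alpha x + EA.alpha y) \<in> EA.N" for x y
      using EA.N_intros(1) by (simp add: EA.alpha_simps)
    show "EA.alpha z \<in> EA.N" if z: "z \<in> ?D 2" for z
    proof -
      obtain c where c: "z = EA.bar_bdy c" "supported c (bar_basis E2 3)"
        using z by (auto simp: boundaries_def)
      show ?thesis unfolding c(1) by (rule EA.alpha_boundary[OF c(2)])
    qed
  qed (use aZ in auto)
  have phi_add: "EA.phi (x + y) - (EA.phi x + EA.phi y) \<in> subgroup_M" for x y :: "'a vec set list \<Rightarrow>\<^sub>0 int"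
    by (simp add: EA.phi_simps M_intros(1))
  obtain \<beta> where \<beta>: "\<beta> \<in> hom H1_Y_E2 A_mod_M"
    "\<And>z :: 'a vec set list \<Rightarrow>\<^sub>0 int. z \<in> EA.Z1 \<Longrightarrow> \<beta> (Y_class z) = coset subgroup_M (EA.phi z)"
  proof (rule quotient_map_induced[OF QY QA UNIV_I phi_add EA.phi_N])
    fix F assume F: "F \<in> hom H1_Y_E2 (A_mod_M :: 'a set monoid)"
      "\<And>x. x \<in> EA.Z1 \<Longrightarrow> F (Y_class x) = coset subgroup_M (EA.phi x)"
    show thesis using F by (rule that)
  qed
  obtain \<gamma> where \<gamma>: "\<gamma> \<in> hom A_mod_M (group_homology 1 E2)"
    "\<And>x :: 'a. x \<in> UNIV \<Longrightarrow> \<gamma> (coset subgroup_M x) = coset (?D 1) (frag_of [E12 x])"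
  proof (rule quotient_map_induced[OF QA QH1, of "\<lambda>x. frag_of [E12 x]"])
    show "frag_of [E12 (x + y)] - (frag_of [E12 x] + frag_of [E12 y]) \<in> ?D 1" for x y :: 'a
      unfolding D1[symmetric] by (rule EA.D1_U_add)
    show "frag_of [E12 x] \<in> ?D 1" if "x \<in> subgroup_M" for x :: 'a
      unfolding D1[symmetric] using that by (rule EA.D1_U_M)
    fix F assume "F \<in> hom A_mod_M (group_homology 1 E2)"
      "\<And>x :: 'a. x \<in> UNIV \<Longrightarrow> F (coset subgroup_M x) = coset (?D 1) (frag_of [E12 x])"
    then show thesis by (rule that)
  qed (rule U1)
  have \<alpha>_eq: "\<alpha> \<in> equivariant_hom square_class_group (group_homology 2 E2) \<rho>2 H1_Y_E2 \<rho>Y"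
  proof (rule equivariant_homI[where op = conj_chain and op' = act_chain and f = EA.alpha, OF QH2 QY \<alpha> aZ \<rho>2 \<rho>Y act2 H1_Y_E2_action_class diag_Z1])
    fix a :: 'a and z assume a: "a \<in> units" and z: "z \<in> ?Z 2"
    obtain b where ab: "a * b = 1" using a by (auto simp: carrier_unit_group)
    \<comment> \<open>For a bar cycle the term with \<open>defect\<close> in
      \<open>alpha_t\<theta>\<close> is the defect of zero.\<close>
    show "EA.alpha (conj_chain a z) - act_chain a (EA.alpha z) \<in> EA.N"
      using elementary_twist.alpha_t\<theta>[OF elementary_twist_E2[OF ab], of z] z
      by (simp add: Z2 elementary_twist.defect_def[OF elementary_twist_E2[OF ab]])
  qed
  have \<beta>_eq: "\<beta> \<in> equivariant_hom square_class_group H1_Y_E2 \<rho>Y A_mod_M \<rho>A"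
  proof (rule equivariant_homI[where op = act_chain and op' = "(*)" and f = EA.phi, OF QY QA \<beta> UNIV_I \<rho>Y \<rho>A H1_Y_E2_action_class diag_Z1 actA])
    fix a :: 'a and z :: "'a vec set list \<Rightarrow>\<^sub>0 int"
    assume a: "a \<in> units" and z: "z \<in> EA.Z1"
    obtain b where ab: "a * b = 1" using a by (auto simp: carrier_unit_group)
    show "EA.phi (act_chain a z) - a * EA.phi z \<in> subgroup_M"
      by (rule elementary_twist.phi_t\<delta>[OF elementary_twist_E2[OF ab] z])
  qed
  have \<gamma>_eq: "\<gamma> \<in> equivariant_hom square_class_group A_mod_M \<rho>A (group_homology 1 E2) \<rho>1"
  proof (rule equivariant_homI[where op = "(*)" and op' = conj_chain and f = "\<lambda>x. frag_of [E12 x]", OF QA QH1 \<gamma> U1 \<rho>A \<rho>1 actA act1])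
    fix a x :: 'a assume a: "a \<in> units"
    obtain b where ab: "a * b = 1" using a by (auto simp: carrier_unit_group)
    show "frag_of [E12 (a * x)] - conj_chain a (frag_of [E12 x]) \<in> ?D 1"
      using add_subgroup_zero[OF boundaries_subgroup]
      by (simp add: elementary_twist.\<theta>_U[OF elementary_twist_E2[OF ab]])
  qed
  have \<gamma>_E12: "\<forall>x :: 'a. \<gamma> (subgroup_M #>\<^bsub>additive_group\<^esub> x) = H1_class E2 (E12 x)"
  proof
    fix x :: 'a
    have "H1_class E2 (E12 x) = coset (?D 1) (frag_of [E12 x])"
      unfolding H1_class_def by (intro r_coset_eq_coset) (simp add: free_Abelian_group_def)
    moreover have "subgroup_M #>\<^bsub>additive_group\<^esub> x = coset subgroup_M x"
      by (intro r_coset_eq_coset) (simp add: additive_group_def)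
    ultimately show "\<gamma> (subgroup_M #>\<^bsub>additive_group\<^esub> x) = H1_class E2 (E12 x)"
      using \<gamma>(2) by simp
  qed
  have exact_Y: "\<alpha> ` carrier (group_homology 2 E2) = kernel H1_Y_E2 A_mod_M \<beta>"
  proof (intro equalityI subsetI)
    fix m assume "m \<in> \<alpha> ` carrier (group_homology 2 E2)"
    then obtain c where c: "c \<in> ?Z 2" "m = Y_class (EA.alpha c)"
      unfolding H2(5)[symmetric] using \<alpha>(2) by auto
    then have "EA.phi (EA.alpha c) \<in> subgroup_M" using EA.phi_alpha Z2 by blast
    then have "\<beta> m = \<one>\<^bsub>A_mod_M\<^esub>" using c \<beta>(2)[OF aZ[OF c(1)]] A(7) by simp
    then show "m \<in> kernel H1_Y_E2 A_mod_M \<beta>" using c Y(8) aZ by (simp add: kernel_def)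
  next
    fix m assume "m \<in> kernel H1_Y_E2 A_mod_M \<beta>"
    then obtain z where z: "z \<in> EA.Z1" "m = Y_class z" "\<beta> m = \<one>\<^bsub>A_mod_M\<^esub>"
      unfolding kernel_def Y(5)[symmetric] by blast
    then have "EA.phi z \<in> subgroup_M" using \<beta>(2) A(7) by simp
    with z(1) obtain c where c: "supported c (bar_basis E2 2)" "EA.bar_bdy c = 0" "z - EA.alpha c \<in> EA.N"
      by (rule EA.alpha_surj)
    then have cZ: "c \<in> ?Z 2" by (simp add: Z2)
    then have "m = \<alpha> (coset (?D 2) c)" using \<alpha>(2) z c(3) quotient_map_eq_iff[OF QY z(1) aZ] by simp
    then show "m \<in> \<alpha> ` carrier (group_homology 2 E2)" using H2(8)[OF cZ] by blast
  qed
  have exact_A: "\<beta> ` carrier H1_Y_E2 = kernel A_mod_M (group_homology 1 E2) \<gamma>"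
  proof (intro equalityI subsetI)
    fix m assume "m \<in> \<beta> ` carrier H1_Y_E2"
    then obtain z where z: "z \<in> EA.Z1" "m = coset subgroup_M (EA.phi z)"
      unfolding Y(5)[symmetric] using \<beta>(2) by auto
    obtain c where "supported c (bar_basis E2 2)" "frag_of [E12 (EA.phi z)] = EA.bar_bdy c"
      using EA.bar_phi[OF z(1)] .
    then have "frag_of [E12 (EA.phi z)] \<in> ?D 1" unfolding D1[symmetric] EA.D1_def by blast
    then have "\<gamma> m = \<one>\<^bsub>group_homology 1 E2\<^esub>" using z \<gamma>(2)[OF UNIV_I] H1(7)[OF U1] by simp
    then show "m \<in> kernel A_mod_M (group_homology 1 E2) \<gamma>" using z A(8)[OF UNIV_I] by (simp add: kernel_def)
  next
    fix m assume "m \<in> kernel A_mod_M (group_homology 1 E2) \<gamma>"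
    then obtain x where x: "m = coset subgroup_M x" "\<gamma> m = \<one>\<^bsub>group_homology 1 E2\<^esub>"
      unfolding kernel_def A(5)[symmetric] by blast
    then have "frag_of [E12 x] \<in> EA.D1" using \<gamma>(2)[OF UNIV_I] H1(7)[OF U1] unfolding D1 by simp
    then obtain c where "supported c (bar_basis E2 2)" "frag_of [E12 x] = EA.bar_bdy c"
      unfolding EA.D1_def by blast
    then obtain z where z: "z \<in> EA.Z1" "EA.phi z - x \<in> subgroup_M" by (rule EA.phi_surj)
    then have "\<beta> (Y_class z) = m" using x \<beta>(2) quotient_map_eq_iff[OF QA UNIV_I UNIV_I] by simp
    then show "m \<in> \<beta> ` carrier H1_Y_E2" using Y(8)[OF z(1)] by blast
  qed
  have surj: "\<gamma> ` carrier A_mod_M = carrier (group_homology 1 E2)"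
  proof (intro equalityI subsetI)
    fix m assume "m \<in> \<gamma> ` carrier A_mod_M"
    then show "m \<in> carrier (group_homology 1 E2)" using \<gamma>(1) by (auto simp: hom_def)
  next
    fix m assume "m \<in> carrier (group_homology 1 (E2 :: 'a mat monoid))"
    then obtain k where k: "k \<in> ?Z 1" "m = coset (?D 1) k" unfolding H1(5)[symmetric] by blast
    then have "supported k (bar_basis E2 1)" unfolding cycles_bar_1 by simp
    then obtain x where "k - frag_of [E12 x] \<in> EA.D1" by (rule EA.D1_surj)
    then have "m = \<gamma> (coset subgroup_M x)"
      using k \<gamma>(2)[OF UNIV_I] quotient_map_eq_iff[OF QH1 k(1) U1] unfolding D1 by simp
    then show "m \<in> \<gamma> ` carrier A_mod_M" using A(8)[OF UNIV_I] by blast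
  qed
  show ?thesis
    using \<rho>2 \<rho>Y \<rho>A \<rho>1 \<alpha>_eq \<beta>_eq \<gamma>_eq \<gamma>_E12 exact_Y exact_A surj by blast
qed

end
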